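(* Let $\{\alpha_i\}_{i\in\mathbb{N}}$ be a sequence of real numbers and let $\{\lambda_i\}_{i\in\mathbb{N}}$ be a sequence of real numbers with $\lambda_i>0$ for all $i$ and $\lambda=\sup\{\lambda_i:i\ge 1\}<\infty$. For each $N\in\mathbb{N}$ with $N\ge\lambda$, let there be given $N$ freely independent and identically distributed sequences $\{p_{1,N}^{(i)}\}_{i\in\mathbb{N}},\{p_{2,N}^{(i)}\}_{i\in\mathbb{N}},\dots,\{p_{N,N}^{(i)}\}_{i\in\mathbb{N}}$ of projections in a $C^*$-probability space $(\mathcal{A}_N,\varphi_N)$ such that $\varphi_N(p_{r,N}^{(i)})=\frac{\lambda_i}{N}$ for $i=1,2,\dots$ and $r=1,\dots,N$. Put $a_{j,N}^{(i)}=\alpha_i p_{j,N}^{(i)}$ for $i\in\mathbb{N}$, $j=1,\dots,N$, $N\ge\lambda$. Then there exist a family $(b_i)_{i\in\mathbb{N}}$ of random variables in a $C^*$-probability space $(\mathcal{A},\varphi)$ and a sequence $(n_k)_{k\in\mathbb{N}}$ of natural numbers (with $n_k\ge\lambda$) such that $\lim_{k\to\infty}n_k=\infty$ and $(a_{1,n_k}^{(i)}+a_{2,n_k}^{(i)}+\cdots+a_{n_k,n_k}^{(i)})_{i\in\mathbb{N}}$ converges in distribution to $(b_i)_{i\in\mathbb{N}}$ as $k\to\infty$. Moreover, for all $n\in\mathbb{N}$ and $i_1,\dots,i_n\in\mathbb{N}$, $$\kappa_n(b_{i_1},b_{i_2},\dots,b_{i_n})=\alpha_{i_1}\alpha_{i_2}\cdots\alpha_{i_n}\lim_{k\to\infty}n_k\,\varphi_{n_k}\bigl(p_{1,n_k}^{(i_1)}p_{1,n_k}^{(i_2)}\cdots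 p_{1,n_k}^{(i_n)}\bigr).$$
   Context: A $C^*$-probability space $(\mathcal{A},\varphi)$ is a unital $C^*$-algebra $\mathcal{A}$ with a state $\varphi$; its elements are called random variables. A projection is a self-adjoint idempotent. Unital subalgebras $\{\mathcal{A}_i\}_{i\in I}$ are freely independent (free) if $\varphi(x_1\cdots x_n)=0$ whenever $x_k\in\mathcal{A}_{l(k)}$, $\varphi(x_k)=0$ for all $k$, and $l(k)\ne l(k+1)$ for $1\le k\le n-1$. Sequences of random variables are freely independent if the unital subalgebras they generate are free. Two sequences are identically distributed if they have the same joint moments, i.e. $\varphi(x_{i_1}\cdots x_{i_m})=\varphi(y_{i_1}\cdots y_{i_m})$ for all $m$ and $i_1,\dots,i_m$. Families $(x_{i,k})_{i\in I}$ in $(\mathcal{A}_k,\varphi_k)$ converge in distribution to $(b_i)_{i\in I}$ in $(\mathcal{B},\phi)$ as $k\to\infty$ if $\lim_{k}\varphi_k(x_{i_1,k}\cdots x_{i_m,k})=\phi(b_{i_1}\cdots b_{i_m})$ for all $m\in\mathbb{N}$ and $i_1,\dots,i_m\in I$. Free cumulants: $\kappa_n(x_1,\dots,x_n)=\sum_{\pi\in NC(n)}\varphi_\pi(x_1,\dots,x_n)\mu_n(\pi,1_n)$, where $NC(n)$ is the lattice of non-crossing partitions of $\{1,\dots,n\}$ ordered by refinement, $\mu_n$ its Möbius function, $1_n$ the one-block partition, and $\varphi_\pi(x_1,\dots,x_n)$ is the product over blocks $V=\{v_1<\dots<v_s\}$ of $\pi$ of $\varphi(x_{v_1}\cdots x_{v_s})$.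 *)

theory Defs
  imports
    Complex_Main
    "HOL-Algebra.Module"
    "HOL-Algebra.Subrings"
    "HOL-Library.Disjoint_Sets"
    "HOL-Library.Nonpos_Ints"
begin

section \<open>Unital C*-algebras and C*-probability spaces\<close>

text \<open>
  C*-algebras are carrier-based structures on top of the ring and module records, so that a
  sequence of (possibly different) algebras and an existential quantifier over algebras can be
  expressed. The record fields are only constrained on the carrier.
\<close>

definition complex_ring :: "complex ring" where
  "complex_ring = \<lparr>carrier = UNIV, mult = (*), one = 1, zero = 0, add = (+)\<rparr>"

record 'a cstar = "(complex, 'a) module" +
  star :: "'a \<Rightarrow> 'a"
  nrm :: "'a \<Rightarrow> real"

locale unital_cstar_algebra = ring A + module complex_ring A for A :: "'a cstar" (structure) +
  assumes smult_mult_left: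
      "\<lbrakk>x \<in> carrier A; y \<in> carrier A\<rbrakk> \<Longrightarrow> (c \<odot> x) \<otimes> y = c \<odot> (x \<otimes> y)"
    and smult_mult_right:
      "\<lbrakk>x \<in> carrier A; y \<in> carrier A\<rbrakk> \<Longrightarrow> x \<otimes> (c \<odot> y) = c \<odot> (x \<otimes> y)"
    and star_closed: "x \<in> carrier A \<Longrightarrow> star A x \<in> carrier A"
    and star_star: "x \<in> carrier A \<Longrightarrow> star A (star A x) = x"
    and star_add:
      "\<lbrakk>x \<in> carrier A; y \<in> carrier A\<rbrakk> \<Longrightarrow> star A (x \<oplus> y) = star A x \<oplus> star A y"
    and star_smult: "x \<in> carrier A \<Longrightarrow> star A (c \<odot> x) = cnj c \<odot> star A x"
    and star_mult:
      "\<lbrakk>x \<in> carrier A; y \<in> carrier A\<rbrakk> \<Longrightarrow> star A (x \<otimes> y) = star A y \<otimes> star A x"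
    and nrm_nonneg: "x \<in> carrier A \<Longrightarrow> 0 \<le> nrm A x"
    and nrm_eq_0: "x \<in> carrier A \<Longrightarrow> nrm A x = 0 \<longleftrightarrow> x = \<zero>"
    and nrm_triangle:
      "\<lbrakk>x \<in> carrier A; y \<in> carrier A\<rbrakk> \<Longrightarrow> nrm A (x \<oplus> y) \<le> nrm A x + nrm A y"
    and nrm_smult: "x \<in> carrier A \<Longrightarrow> nrm A (c \<odot> x) = cmod c * nrm A x"
    and nrm_mult:
      "\<lbrakk>x \<in> carrier A; y \<in> carrier A\<rbrakk> \<Longrightarrow> nrm A (x \<otimes> y) \<le> nrm A x * nrm A y"
    and cstar_identity: "x \<in> carrier A \<Longrightarrow> nrm A (star A x \<otimes> x) = (nrm A x)\<^sup>2"
    and complete: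
      "\<lbrakk>\<And>k. s k \<in> carrier A;
        \<And>e. e > 0 \<Longrightarrow> \<exists>M. \<forall>m\<ge>M. \<forall>n\<ge>M. nrm A (s m \<ominus> s n) < e\<rbrakk>
       \<Longrightarrow> \<exists>x\<in>carrier A. (\<lambda>k. nrm A (s k \<ominus> x)) \<longlonglongrightarrow> 0"

text \<open>A state is a positive linear functional with value 1 at the unit.\<close>

locale cstar_prob_space = unital_cstar_algebra A for A :: "'a cstar" (structure) +
  fixes \<phi> :: "'a \<Rightarrow> complex"
  assumes state_add: "\<lbrakk>x \<in> carrier A; y \<in> carrier A\<rbrakk> \<Longrightarrow> \<phi> (x \<oplus> y) = \<phi> x + \<phi> y"
    and state_smult: "x \<in> carrier A \<Longrightarrow> \<phi> (c \<odot> x) = c * \<phi> x"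
    and state_pos: "x \<in> carrier A \<Longrightarrow> \<phi> (star A x \<otimes> x) \<in> \<real>\<^sub>\<ge>\<^sub>0"
    and state_one: "\<phi> \<one> = 1"

definition projection :: "'a cstar \<Rightarrow> 'a \<Rightarrow> bool" where
  "projection A x \<longleftrightarrow> x \<in> carrier A \<and> star A x = x \<and> x \<otimes>\<^bsub>A\<^esub> x = x"

definition lprod :: "'a cstar \<Rightarrow> 'a list \<Rightarrow> 'a" where
  "lprod A xs = foldr (\<otimes>\<^bsub>A\<^esub>) xs \<one>\<^bsub>A\<^esub>"

section \<open>Freeness, identical distribution and convergence in distribution\<close>

definition unital_subalgebra :: "'a cstar \<Rightarrow> 'a set \<Rightarrow> bool" where
  "unital_subalgebra A B \<longleftrightarrow> subring B A \<and> (\<forall>c. \<forall>x\<in>B. c \<odot>\<^bsub>A\<^esub> x \<in> B)"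

definition free_subalgebras ::
    "'a cstar \<Rightarrow> ('a \<Rightarrow> complex) \<Rightarrow> 'i set \<Rightarrow> ('i \<Rightarrow> 'a set) \<Rightarrow> bool" where
  "free_subalgebras A \<phi> I B \<longleftrightarrow>
    (\<forall>n\<ge>1. \<forall>l x.
      (\<forall>k\<in>{1..n}. l k \<in> I \<and> x k \<in> B (l k) \<and> \<phi> (x k) = 0) \<longrightarrow>
      (\<forall>k\<in>{1..<n}. l k \<noteq> l (k + 1)) \<longrightarrow>
      \<phi> (lprod A (map x [1..<n + 1])) = 0)"

definition free_sequences ::
    "'a cstar \<Rightarrow> ('a \<Rightarrow> complex) \<Rightarrow> 'i set \<Rightarrow> ('i \<Rightarrow> nat \<Rightarrow> 'a) \<Rightarrow> bool" where
  "free_sequences A \<phi> I x \<longleftrightarrow>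
    free_subalgebras A \<phi> I (\<lambda>r. unital_subalgebra A hull range (x r))"

definition identically_distributed ::
    "'a cstar \<Rightarrow> ('a \<Rightarrow> complex) \<Rightarrow> (nat \<Rightarrow> 'a) \<Rightarrow> (nat \<Rightarrow> 'a) \<Rightarrow> bool" where
  "identically_distributed A \<phi> x y \<longleftrightarrow>
    (\<forall>js. \<phi> (lprod A (map x js)) = \<phi> (lprod A (map y js)))"

definition converges_in_distribution ::
    "(nat \<Rightarrow> 'a cstar) \<Rightarrow> (nat \<Rightarrow> 'a \<Rightarrow> complex) \<Rightarrow> (nat \<Rightarrow> 'i \<Rightarrow> 'a) \<Rightarrow>
     'b cstar \<Rightarrow> ('b \<Rightarrow> complex) \<Rightarrow> ('i \<Rightarrow> 'b) \<Rightarrow> bool" where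
  "converges_in_distribution A \<phi> x B \<psi> b \<longleftrightarrow>
    (\<forall>js. (\<lambda>k. \<phi> k (lprod (A k) (map (x k) js))) \<longlonglongrightarrow> \<psi> (lprod B (map b js)))"

section \<open>Free cumulants\<close>

definition finite_poset :: "'a set \<Rightarrow> ('a \<Rightarrow> 'a \<Rightarrow> bool) \<Rightarrow> bool" where
  "finite_poset P R \<longleftrightarrow> finite P \<and> reflp_on P R \<and> antisymp_on P R \<and> transp_on P R"

text \<open>
  The Moebius function of a finite partially ordered set \<open>(P, R)\<close>, by the usual recursion
  \<open>\<mu>(x, x) = 1\<close> and \<open>\<Sum>\<^bsub>x \<le> z \<le> y\<^esub> \<mu>(x, z) = 0\<close> for \<open>x < y\<close>. The guard only secures
  termination and makes the function total (value 0 off the order relation).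
\<close>

function moebius :: "'a set \<Rightarrow> ('a \<Rightarrow> 'a \<Rightarrow> bool) \<Rightarrow> 'a \<Rightarrow> 'a \<Rightarrow> int" where
  "moebius P R x y =
    (if finite_poset P R \<and> x \<in> P \<and> y \<in> P \<and> R x y
     then if x = y then 1
          else - (\<Sum>z\<in>{z \<in> P. R x z \<and> R z y \<and> z \<noteq> y}. moebius P R x z)
     else 0)"
  by pat_completeness auto
termination
proof (relation "measure (\<lambda>(P, R, x, y). card {w \<in> P. R w y})")
  fix P :: "'a set" and R x y z
  assume g: "finite_poset P R \<and> x \<in> P \<and> y \<in> P \<and> R x y"
    and z: "z \<in> {z \<in> P. R x z \<and> R z y \<and> z \<noteq> y}"
  have "\<not> R y z"
    using g z by (auto simp: finite_poset_def antisymp_on_def)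
  moreover have "R y y"
    using g by (auto simp: finite_poset_def reflp_on_def)
  moreover have "{w \<in> P. R w z} \<subseteq> {w \<in> P. R w y}"
    using g z by (auto simp: finite_poset_def transp_on_def)
  ultimately have "{w \<in> P. R w z} \<subset> {w \<in> P. R w y}"
    using g by auto
  then show "((P, R, x, z), P, R, x, y) \<in> measure (\<lambda>(P, R, x, y). card {w \<in> P. R w y})"
    using g by (auto simp: finite_poset_def intro!: psubset_card_mono)
qed simp

declare moebius.simps [simp del]

definition NC :: "nat \<Rightarrow> nat set set set" where
  "NC n = {\<pi>. partition_on {1..n} \<pi> \<and>
    (\<forall>V\<in>\<pi>. \<forall>W\<in>\<pi>. V \<noteq> W \<longrightarrow>
      \<not> (\<exists>a b c d. a < b \<and> b < c \<and> c < d \<and> a \<in> V \<and> c \<in> V \<and> b \<in> W \<and> d \<in> W))}"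

definition moment_part ::
    "'a cstar \<Rightarrow> ('a \<Rightarrow> complex) \<Rightarrow> nat set set \<Rightarrow> (nat \<Rightarrow> 'a) \<Rightarrow> complex" where
  "moment_part A \<phi> \<pi> x = (\<Prod>V\<in>\<pi>. \<phi> (lprod A (map x (sorted_list_of_set V))))"

text \<open>\<open>free_cumulant A \<phi> n x\<close> is \<open>\<kappa>\<^sub>n(x 1, \<dots>, x n)\<close>; other values of \<open>x\<close> are irrelevant.\<close>

definition free_cumulant ::
    "'a cstar \<Rightarrow> ('a \<Rightarrow> complex) \<Rightarrow> nat \<Rightarrow> (nat \<Rightarrow> 'a) \<Rightarrow> complex" where
  "free_cumulant A \<phi> n x =
    (\<Sum>\<pi>\<in>NC n. moment_part A \<phi> \<pi> x * of_int (moebius (NC n) (refines {1..n}) \<pi> {{1..n}}))"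

section \<open>A universe for the limit algebra\<close>

text \<open>
  HOL cannot quantify existentially over types, so the existence of a C*-probability space is
  stated for algebras whose carrier lies in a fixed type, here the type of maps on complex
  sequences. This is no restriction for countable families: replacing the space by the
  C*-subalgebra generated by the family and the unit changes no joint moment, and that subalgebra
  is separable, hence of at most the cardinality of the continuum, while this type is larger.
\<close>

type_synonym seq_map = "(nat \<Rightarrow> complex) \<Rightarrow> nat \<Rightarrow> complex"

end

theory Submission
  imports
    Defs
    "HOL-Library.FuncSet"
    "HOL-Library.Sublist"
    "HOL-Library.Nat_Bijection"
    "HOL-Library.Diagonal_Subsequence"
begin

text \<open>
  By the Cauchy-Schwarz inequality and because projections contract, \<open>\<phi>\<^sub>N(p\<^sub>i \<cdots> p\<^sub>j)\<close> is at most
  \<open>\<lambda> / N\<close> for a non-empty product of the projections of one row (\<open>state_projections_bound\<close>). So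
  \<open>N \<phi>\<^sub>N(p\<^sub>i \<cdots> p\<^sub>j)\<close> is bounded, and a diagonal argument over the countably many words gives a
  subsequence along which all these quantities converge. Multiplied by the coefficients \<open>\<alpha>\<close>, the limits
  are a functional \<open>L\<close> on words that is going to give the free cumulants.

  A moment of the row sums expands into expectations of words whose letters are coloured by row
  numbers. By freeness, identical distribution and the order \<open>1/N\<close> of all means, a word with \<open>m\<close>
  colours has expectation of order \<open>N\<^sup>-\<^sup>m\<close>, with leading coefficient the product of \<open>L\<close> over the
  colours if the colour pattern is non-crossing, and 0 otherwise (\<open>free_word_asymptotics\<close>). About
  \<open>N\<^sup>m\<close> colourings share a given pattern of \<open>m\<close> classes. Hence the moments converge to
  \<open>M(w) = \<Sum>\<^sub>\<pi> \<Prod>\<^sub>W L(w|W)\<close>, summed over non-crossing partitions (\<open>free_limit\<close>), and Moebius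
  inversion shows that the free cumulants belonging to \<open>M\<close> are the values of \<open>L\<close>
  (\<open>cumulant_of_moments\<close>).

  It remains to realise \<open>M\<close> in a C*-probability space. As a limit of moment functionals of
  self-adjoint elements \<open>M\<close> is positive, and it grows at most exponentially because there are at most
  \<open>4\<^sup>n\<close> non-crossing partitions of \<open>n\<close> points (\<open>card_NC_on_le\<close>). A positive functional of exponential
  growth is represented by bounded operators (\<open>moment_realization\<close>): the kernel \<open>M(u\<^sup>* w)\<close> on words
  is factored by a Cholesky decomposition into Gram vectors in the space of square-summable
  sequences, multiplication by a letter acts on these vectors as a bounded symmetric operator, and
  the C*-algebra is that of all bounded operators on this space with the vector state of the empty
  word.
\<close>

section \<open>Moebius inversion\<close>

lemma sum_moebius_left:
  assumes fp: "finite_poset P R" and xy: "x \<in> P" "y \<in> P"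
  shows "(\<Sum>z\<in>{z \<in> P. R x z \<and> R z y}. moebius P R x z) = (if x = y then 1 else 0)"
proof (cases "R x y")
  case True
  have fin: "finite P" and r: "R y y"
    using fp xy by (auto simp: finite_poset_def reflp_on_def)
  show ?thesis
  proof (cases "x = y")
    case True
    have "{z \<in> P. R x z \<and> R z y} = {x}"
      using fp xy True unfolding finite_poset_def antisymp_on_def reflp_on_def by blast
    then show ?thesis
      using fp xy True r by (simp, subst moebius.simps, simp)
  next
    case False
    have "{z \<in> P. R x z \<and> R z y} = insert y {z \<in> P. R x z \<and> R z y \<and> z \<noteq> y}"
      using xy r \<open>R x y\<close> by auto
    then have "(\<Sum>z\<in>{z \<in> P. R x z \<and> R z y}. moebius P R x z)
        = moebius P R x y + (\<Sum>z\<in>{z \<in> P. R x z \<and> R z y \<and> z \<noteq> y}. moebius P R x z)"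
      using fin by simp
    also have "\<dots> = 0"
      using fp xy False \<open>R x y\<close> by (subst moebius.simps) simp
    finally show ?thesis using False by simp
  qed
next
  case False
  then have "{z \<in> P. R x z \<and> R z y} = {}"
    using fp xy unfolding finite_poset_def transp_on_def by blast
  moreover have "x \<noteq> y"
    using False fp xy unfolding finite_poset_def reflp_on_def by blast
  ultimately show ?thesis by (simp only: sum.empty if_False)
qed

lemma moebius_neq_0: "moebius P R x y \<noteq> 0 \<Longrightarrow> R x y"
  by (subst (asm) moebius.simps) (auto split: if_splits)

lemma finite_poset_converse: "finite_poset P R \<Longrightarrow> finite_poset P (\<lambda>x y. R y x)"
  unfolding finite_poset_def reflp_on_def antisymp_on_def transp_on_def by blast

text \<open>The defining recursion says that the Moebius function is a left inverse of the zeta function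
  in the incidence algebra. The Moebius function of the opposite order is, read backwards, a right
  inverse, and a left inverse agrees with a right inverse.\<close>

lemma moebius_converse:
  assumes fp: "finite_poset P R" and xy: "x \<in> P" "y \<in> P"
  shows "moebius P (\<lambda>a b. R b a) y x = moebius P R x y"
proof -
  let ?\<mu> = "moebius P R" and ?\<nu> = "\<lambda>a b. moebius P (\<lambda>a b. R b a) b a"
  define Z where "Z a b = (if R a b then 1 else 0 :: int)" for a b
  have fin: "finite P" using fp by (simp add: finite_poset_def)
  have L: "(\<Sum>z\<in>P. ?\<mu> a z * Z z b) = (if a = b then 1 else 0)" if "a \<in> P" "b \<in> P" for a b
  proof -
    have "(\<Sum>z\<in>P. ?\<mu> a z * Z z b) = (\<Sum>z\<in>{z \<in> P. R a z \<and> R z b}. ?\<mu> a z)"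
      by (rule sum.mono_neutral_cong_right) (auto simp: fin Z_def dest: moebius_neq_0)
    then show ?thesis using sum_moebius_left[OF fp that] by simp
  qed
  have Rr: "(\<Sum>z\<in>P. Z a z * ?\<nu> z b) = (if a = b then 1 else 0)" if "a \<in> P" "b \<in> P" for a b
  proof -
    have "(\<Sum>z\<in>P. Z a z * ?\<nu> z b) = (\<Sum>z\<in>{z \<in> P. R z b \<and> R a z}. ?\<nu> z b)"
      by (rule sum.mono_neutral_cong_right) (auto simp: fin Z_def dest: moebius_neq_0)
    then show ?thesis
      using sum_moebius_left[OF finite_poset_converse[OF fp] that(2,1)] by auto
  qed
  have "?\<nu> x y = (\<Sum>w\<in>P. if w = x then ?\<nu> w y else 0)"
    using fin xy by simp
  also have "\<dots> = (\<Sum>w\<in>P. (if x = w then 1 else 0) * ?\<nu> w y)"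
    by (intro sum.cong) auto
  also have "\<dots> = (\<Sum>w\<in>P. (\<Sum>z\<in>P. ?\<mu> x z * Z z w) * ?\<nu> w y)"
    using L[OF xy(1)] by (intro sum.cong refl) simp
  also have "\<dots> = (\<Sum>w\<in>P. \<Sum>z\<in>P. ?\<mu> x z * (Z z w * ?\<nu> w y))"
    by (simp add: sum_distrib_right mult.assoc)
  also have "\<dots> = (\<Sum>z\<in>P. \<Sum>w\<in>P. ?\<mu> x z * (Z z w * ?\<nu> w y))"
    by (rule sum.swap)
  also have "\<dots> = (\<Sum>z\<in>P. ?\<mu> x z * (if z = y then 1 else 0))"
    using Rr[OF _ xy(2)] by (intro sum.cong refl) (simp flip: sum_distrib_left)
  also have "\<dots> = ?\<mu> x y"
    using fin xy by (simp add: if_distrib[of "(*) _"] cong: if_cong)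
  finally show ?thesis .
qed

lemma sum_moebius_right:
  assumes fp: "finite_poset P R" and xy: "x \<in> P" "y \<in> P"
  shows "(\<Sum>z\<in>{z \<in> P. R x z \<and> R z y}. moebius P R z y) = (if x = y then 1 else 0)"
proof -
  have "(\<Sum>z\<in>{z \<in> P. R x z \<and> R z y}. moebius P R z y)
      = (\<Sum>z\<in>{z \<in> P. R z y \<and> R x z}. moebius P (\<lambda>a b. R b a) y z)"
    using moebius_converse[OF fp _ xy(2)] by (intro sum.cong) auto
  then show ?thesis
    using sum_moebius_left[OF finite_poset_converse[OF fp] xy(2,1)] by auto
qed

lemma moebius_inversion_top:
  fixes g :: "'a \<Rightarrow> complex"
  assumes fp: "finite_poset P R" and t: "t \<in> P" and top: "\<And>x. x \<in> P \<Longrightarrow> R x t"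
  shows "(\<Sum>x\<in>P. (\<Sum>y\<in>{y \<in> P. R y x}. g y) * of_int (moebius P R x t)) = g t"
proof -
  have fin: "finite P" using fp by (simp add: finite_poset_def)
  have "(\<Sum>x\<in>P. (\<Sum>y\<in>{y \<in> P. R y x}. g y) * of_int (moebius P R x t))
      = (\<Sum>x\<in>P. \<Sum>y\<in>{y \<in> P. R y x}. g y * of_int (moebius P R x t))"
    by (simp add: sum_distrib_right)
  also have "\<dots> = (\<Sum>y\<in>P. \<Sum>x\<in>{x \<in> P. R y x}. g y * of_int (moebius P R x t))"
    using sum.swap_restrict[OF fin fin] by fast
  also have "\<dots> = (\<Sum>y\<in>P. g y * of_int (\<Sum>x\<in>{x \<in> P. R y x \<and> R x t}. moebius P R x t))"
    unfolding of_int_sum sum_distrib_left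
    by (intro sum.cong) (use top in auto)
  also have "\<dots> = (\<Sum>y\<in>P. g y * (if y = t then 1 else 0))"
    using sum_moebius_right[OF fp _ t] by (intro sum.cong) auto
  also have "\<dots> = g t"
    using fin t by (simp add: if_distrib[of "(*) _"] cong: if_cong)
  finally show ?thesis .
qed

section \<open>Non-crossing partitions of finite sets of positions\<close>

definition crosses :: "nat set \<Rightarrow> nat set \<Rightarrow> bool" where
  "crosses V W \<longleftrightarrow> (\<exists>a b c d. a < b \<and> b < c \<and> c < d \<and> a \<in> V \<and> c \<in> V \<and> b \<in> W \<and> d \<in> W)"

definition noncrossing :: "nat set set \<Rightarrow> bool" where
  "noncrossing \<pi> \<longleftrightarrow> (\<forall>V\<in>\<pi>. \<forall>W\<in>\<pi>. V \<noteq> W \<longrightarrow> \<not> crosses V W)"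

definition NC_on :: "nat set \<Rightarrow> nat set set set" where
  "NC_on V = {\<pi>. partition_on V \<pi> \<and> noncrossing \<pi>}"

lemma NC_eq_NC_on: "NC n = NC_on {1..n}"
  unfolding NC_def NC_on_def noncrossing_def crosses_def by (rule refl)

lemma crossesI:
  "\<lbrakk>a < b; b < c; c < d; a \<in> V; c \<in> V; b \<in> W; d \<in> W\<rbrakk> \<Longrightarrow> crosses V W"
  unfolding crosses_def by (intro exI[of _ a] exI[of _ b] exI[of _ c] exI[of _ d]) simp

lemma noncrossingD:
  "\<lbrakk>noncrossing \<pi>; V \<in> \<pi>; W \<in> \<pi>; a < b; b < c; c < d; a \<in> V; c \<in> V; b \<in> W; d \<in> W\<rbrakk> \<Longrightarrow> V = W"
  using crossesI[of a b c d V W] unfolding noncrossing_def by blast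

lemma noncrossing_subset: "noncrossing \<pi> \<Longrightarrow> \<sigma> \<subseteq> \<pi> \<Longrightarrow> noncrossing \<sigma>"
  unfolding noncrossing_def by blast

lemma finite_NC_on: "finite V \<Longrightarrow> finite (NC_on V)"
  by (rule finite_subset[OF _ finitely_many_partition_on]) (auto simp: NC_on_def)

lemma partition_on_block_eq:
  assumes "partition_on V \<pi>" "U \<in> \<pi>" "W \<in> \<pi>" "x \<in> U" "x \<in> W"
  shows "U = W"
  using assms partition_onD2[OF assms(1)] by (auto simp: disjoint_def)

lemma partition_on_block_subset: "partition_on V \<pi> \<Longrightarrow> W \<in> \<pi> \<Longrightarrow> W \<subseteq> V"
  by (auto simp: partition_on_def)

lemma partition_on_block_nonempty: "partition_on V \<pi> \<Longrightarrow> W \<in> \<pi> \<Longrightarrow> W \<noteq> {}"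
  by (auto simp: partition_on_def)

text \<open>Two crossing blocks of the union lie in the same block of \<open>\<pi>\<close>, since otherwise the blocks of \<open>\<pi>\<close>
  containing them would cross; but then they belong to one non-crossing partition.\<close>

lemma NC_on_UN:
  assumes \<pi>: "\<pi> \<in> NC_on V" and f: "\<And>W. W \<in> \<pi> \<Longrightarrow> f W \<in> NC_on W"
  shows "(\<Union>W\<in>\<pi>. f W) \<in> NC_on V" and "refines V (\<Union>W\<in>\<pi>. f W) \<pi>"
    and "W \<in> \<pi> \<Longrightarrow> {U \<in> \<Union>W\<in>\<pi>. f W. U \<subseteq> W} = f W"
proof -
  have p\<pi>: "partition_on V \<pi>" and n\<pi>: "noncrossing \<pi>"
    using \<pi> by (auto simp: NC_on_def)
  have pf: "partition_on W (f W)" and nf: "noncrossing (f W)" if "W \<in> \<pi>" for W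
    using f[OF that] by (auto simp: NC_on_def)
  have sub: "U \<subseteq> W" if "U \<in> f W" "W \<in> \<pi>" for U W
    using partition_on_block_subset[OF pf] that by blast
  have pV: "partition_on V (\<Union>W\<in>\<pi>. f W)"
  proof (rule partition_onI)
    show "\<Union> (\<Union>W\<in>\<pi>. f W) = V"
      using partition_onD1[OF p\<pi>] partition_onD1[OF pf] by blast
    fix U U' assume U: "U \<in> (\<Union>W\<in>\<pi>. f W)" "U' \<in> (\<Union>W\<in>\<pi>. f W)" "U \<noteq> U'"
    then obtain W W' where W: "W \<in> \<pi>" "W' \<in> \<pi>" "U \<in> f W" "U' \<in> f W'" by blast
    show "disjnt U U'"
    proof (rule ccontr)
      assume "\<not> disjnt U U'"
      then obtain x where x: "x \<in> U" "x \<in> U'" by (auto simp: disjnt_def)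
      then have "W = W'"
        using sub W partition_on_block_eq[OF p\<pi> W(1,2)] by blast
      then show False
        using partition_on_block_eq[OF pf[OF W(1)]] W x U(3) by blast
    qed
  next
    show "{} \<notin> (\<Union>W\<in>\<pi>. f W)" using partition_on_block_nonempty[OF pf] by blast
  qed
  have "noncrossing (\<Union>W\<in>\<pi>. f W)"
    unfolding noncrossing_def
  proof (intro ballI impI notI)
    fix U U'
    assume U: "U \<in> (\<Union>W\<in>\<pi>. f W)" "U' \<in> (\<Union>W\<in>\<pi>. f W)" "U \<noteq> U'" and "crosses U U'"
    then obtain a b c d where o: "a < b" "b < c" "c < d"
      and i: "a \<in> U" "c \<in> U" "b \<in> U'" "d \<in> U'" unfolding crosses_def by metis
    from U obtain W W' where W: "W \<in> \<pi>" "W' \<in> \<pi>" "U \<in> f W" "U' \<in> f W'" by blast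
    have "W = W'"
      using noncrossingD[OF n\<pi> W(1,2) o] sub W i by blast
    then show False
      using noncrossingD[OF nf[OF W(1)] _ _ o i] W U(3) by blast
  qed
  with pV show "(\<Union>W\<in>\<pi>. f W) \<in> NC_on V" by (simp add: NC_on_def)
  show "refines V (\<Union>W\<in>\<pi>. f W) \<pi>"
    using pV p\<pi> sub unfolding refines_def by blast
  show "{U \<in> \<Union>W\<in>\<pi>. f W. U \<subseteq> W} = f W" if W: "W \<in> \<pi>"
  proof -
    have "W' = W" if U: "U \<in> f W'" "W' \<in> \<pi>" "U \<subseteq> W" for W' U
    proof -
      obtain x where "x \<in> U" using partition_on_block_nonempty[OF pf U(1)] U by blast
      then show ?thesis
        using partition_on_block_eq[OF p\<pi> U(2) W, of x] U sub by blast
    qed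
    then show ?thesis using W sub by blast
  qed
qed

text \<open>A refinement of a non-crossing partition is chosen by refining its blocks independently.\<close>

lemma prod_sum_NC_on_refine:
  fixes l :: "nat set \<Rightarrow> complex"
  assumes V: "finite V" and \<pi>: "\<pi> \<in> NC_on V"
  shows "(\<Prod>W\<in>\<pi>. \<Sum>\<sigma>\<in>NC_on W. \<Prod>U\<in>\<sigma>. l U)
    = (\<Sum>\<sigma>\<in>{\<sigma> \<in> NC_on V. refines V \<sigma> \<pi>}. \<Prod>U\<in>\<sigma>. l U)"
proof -
  have p\<pi>: "partition_on V \<pi>" using \<pi> by (auto simp: NC_on_def)
  have fin\<pi>: "finite \<pi>" using finite_elements[OF V p\<pi>] .
  have finW: "finite W" if "W \<in> \<pi>" for W
    using finite_subset[OF partition_on_block_subset[OF p\<pi> that] V] .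
  have "(\<Prod>W\<in>\<pi>. \<Sum>\<sigma>\<in>NC_on W. \<Prod>U\<in>\<sigma>. l U)
      = (\<Sum>f\<in>Pi\<^sub>E \<pi> NC_on. \<Prod>W\<in>\<pi>. \<Prod>U\<in>f W. l U)"
    using fin\<pi> finW by (intro prod_sum_PiE) (auto intro: finite_NC_on)
  also have "\<dots> = (\<Sum>\<sigma>\<in>{\<sigma> \<in> NC_on V. refines V \<sigma> \<pi>}. \<Prod>U\<in>\<sigma>. l U)"
  proof (rule sum.reindex_bij_witness[where
        j = "\<lambda>f. \<Union>W\<in>\<pi>. f W" and i = "\<lambda>\<sigma>. \<lambda>W\<in>\<pi>. {U \<in> \<sigma>. U \<subseteq> W}"])
    fix f assume f: "f \<in> Pi\<^sub>E \<pi> NC_on"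
    then have fW: "f W \<in> NC_on W" if "W \<in> \<pi>" for W using that by auto
    show "(\<lambda>W\<in>\<pi>. {U \<in> \<Union>W\<in>\<pi>. f W. U \<subseteq> W}) = f"
    proof (rule PiE_ext[OF _ f])
      show "(\<lambda>W\<in>\<pi>. {U \<in> \<Union>W\<in>\<pi>. f W. U \<subseteq> W}) \<in> Pi\<^sub>E \<pi> NC_on"
        using NC_on_UN(3)[OF \<pi> fW] fW by auto
      show "(\<lambda>W\<in>\<pi>. {U \<in> \<Union>W\<in>\<pi>. f W. U \<subseteq> W}) W = f W" if "W \<in> \<pi>" for W
        using NC_on_UN(3)[OF \<pi> fW that] that by simp
    qed
    show "(\<Union>W\<in>\<pi>. f W) \<in> {\<sigma> \<in> NC_on V. refines V \<sigma> \<pi>}"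
      using NC_on_UN(1,2)[OF \<pi> fW] by blast
    have disj: "f W \<inter> f W' = {}" if "W \<in> \<pi>" "W' \<in> \<pi>" "W \<noteq> W'" for W W'
    proof (rule ccontr)
      assume "f W \<inter> f W' \<noteq> {}"
      then obtain U where U: "U \<in> f W" "U \<in> f W'" by blast
      have "U \<noteq> {}" "U \<subseteq> W" "U \<subseteq> W'"
        using fW[OF that(1)] fW[OF that(2)] U unfolding NC_on_def
        by (auto dest: partition_on_block_nonempty partition_on_block_subset)
      then show False using partition_on_block_eq[OF p\<pi> that(1,2)] that(3) by blast
    qed
    show "(\<Prod>U\<in>(\<Union>W\<in>\<pi>. f W). l U) = (\<Prod>W\<in>\<pi>. \<Prod>U\<in>f W. l U)"
    proof (rule prod.UNION_disjoint[OF fin\<pi>])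
      show "\<forall>W\<in>\<pi>. finite (f W)"
        using fW finW unfolding NC_on_def by (auto intro: finite_elements)
    qed (use disj in blast)
  next
    fix \<sigma> assume \<sigma>: "\<sigma> \<in> {\<sigma> \<in> NC_on V. refines V \<sigma> \<pi>}"
    then have r: "refines V \<sigma> \<pi>" and n: "noncrossing \<sigma>" by (auto simp: NC_on_def)
    show "(\<lambda>W\<in>\<pi>. {U \<in> \<sigma>. U \<subseteq> W}) \<in> Pi\<^sub>E \<pi> NC_on"
      using refines_obtains_subset[OF r] noncrossing_subset[OF n] by (auto simp: NC_on_def)
    show "(\<Union>W\<in>\<pi>. (\<lambda>W\<in>\<pi>. {U \<in> \<sigma>. U \<subseteq> W}) W) = \<sigma>"
      using r by (auto simp: refines_def)
  qed
  finally show ?thesis .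
qed

text \<open>A product of the \<open>m W\<close> over the blocks of \<open>\<pi>\<close> is a sum over the refinements of \<open>\<pi>\<close>, so that
  Moebius inversion at the one-block partition isolates a single term.\<close>

theorem cumulant_of_moments:
  fixes l m :: "nat set \<Rightarrow> complex"
  assumes n: "n \<ge> 1"
    and m: "\<And>W. W \<subseteq> {1..n} \<Longrightarrow> m W = (\<Sum>\<sigma>\<in>NC_on W. \<Prod>U\<in>\<sigma>. l U)"
  shows "(\<Sum>\<pi>\<in>NC n. (\<Prod>W\<in>\<pi>. m W) * of_int (moebius (NC n) (refines {1..n}) \<pi> {{1..n}})) = l {1..n}"
proof -
  let ?P = "NC n" and ?R = "refines {1..n}"
  have part: "partition_on {1..n} \<pi>" if "\<pi> \<in> ?P" for \<pi>
    using that by (simp add: NC_eq_NC_on NC_on_def)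
  have fp: "finite_poset ?P ?R"
    unfolding finite_poset_def
  proof (intro conjI)
    show "finite ?P" by (simp add: NC_eq_NC_on finite_NC_on)
    show "reflp_on ?P ?R" using refines_refl[OF part] by (auto intro: reflp_onI)
    show "antisymp_on ?P ?R" by (auto intro!: antisymp_onI refines_asym)
    show "transp_on ?P ?R" by (rule transp_onI) (rule refines_trans)
  qed
  have p1: "partition_on {1..n} {{1..n}}"
    using n by (intro partition_on_space) auto
  then have t: "{{1..n}} \<in> ?P"
    unfolding NC_eq_NC_on NC_on_def noncrossing_def by blast
  have top: "?R \<pi> {{1..n}}" if "\<pi> \<in> ?P" for \<pi>
    using part[OF that] p1 partition_on_block_subset[OF part[OF that]] unfolding refines_def by blast
  have "(\<Prod>W\<in>\<pi>. m W) = (\<Sum>\<sigma>\<in>{\<sigma> \<in> ?P. ?R \<sigma> \<pi>}. \<Prod>U\<in>\<sigma>. l U)" if "\<pi> \<in> ?P" for \<pi>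
  proof -
    have "(\<Prod>W\<in>\<pi>. m W) = (\<Prod>W\<in>\<pi>. \<Sum>\<sigma>\<in>NC_on W. \<Prod>U\<in>\<sigma>. l U)"
      using partition_on_block_subset[OF part[OF that]] by (intro prod.cong m) auto
    then show ?thesis
      using prod_sum_NC_on_refine[of "{1..n}" \<pi> l] that by (simp add: NC_eq_NC_on)
  qed
  then have "(\<Sum>\<pi>\<in>?P. (\<Prod>W\<in>\<pi>. m W) * of_int (moebius ?P ?R \<pi> {{1..n}}))
      = (\<Sum>\<pi>\<in>?P. (\<Sum>\<sigma>\<in>{\<sigma> \<in> ?P. ?R \<sigma> \<pi>}. \<Prod>U\<in>\<sigma>. l U) * of_int (moebius ?P ?R \<pi> {{1..n}}))"
    by (intro sum.cong) auto
  also have "\<dots> = l {1..n}"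
    using moebius_inversion_top[OF fp t top, of "\<lambda>\<sigma>. \<Prod>U\<in>\<sigma>. l U"] by simp
  finally show ?thesis .
qed

subsection \<open>An exponential bound on the number of non-crossing partitions\<close>

text \<open>Let \<open>B\<close> be the block that ends first. Another block meeting the interval spanned by \<open>B\<close> ends after \<open>B\<close>
  and would cross it; so \<open>B\<close> fills the interval, and no other block starts there.\<close>

lemma first_closing_block:
  assumes X: "finite X" "X \<noteq> {}" and \<pi>: "\<pi> \<in> NC_on X"
  defines "q \<equiv> Min (Max ` \<pi>)"
  shows "\<exists>B\<in>\<pi>. Max B = q \<and> Min B = Max {x \<in> Min ` \<pi>. x \<le> q} \<and>
    B = {x \<in> X. Max {x \<in> Min ` \<pi>. x \<le> q} \<le> x \<and> x \<le> q}"
proof -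
  have p: "partition_on X \<pi>" and nc: "noncrossing \<pi>" using \<pi> by (auto simp: NC_on_def)
  have fin: "finite \<pi>" and ne: "\<pi> \<noteq> {}"
    using finite_elements[OF X(1) p] X(2) partition_onD1[OF p] by auto
  have W: "finite W" "W \<noteq> {}" "W \<subseteq> X" if "W \<in> \<pi>" for W
    using partition_on_block_subset[OF p that] partition_on_block_nonempty[OF p that] X(1)
    by (auto dest: finite_subset)
  have "q \<in> Max ` \<pi>" unfolding q_def using fin ne by (intro Min_in) auto
  then obtain B where B: "B \<in> \<pi>" "Max B = q" by auto
  have qle: "q \<le> Max W" if "W \<in> \<pi>" for W
    unfolding q_def using fin that by auto
  have Bint: "x \<in> B" if x: "x \<in> X" "Min B \<le> x" "x \<le> q" for x
  proof (rule ccontr)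
    assume xB: "x \<notin> B"
    obtain W where W': "W \<in> \<pi>" "x \<in> W" using x(1) partition_onD1[OF p] by blast
    have mB: "Min B \<in> B" "q \<in> B"
      using Min_in[OF W(1,2)[OF B(1)]] Max_in[OF W(1,2)[OF B(1)]] B(2) by auto
    have "Max W \<in> W" using W[OF W'(1)] by simp
    then have "Max W \<noteq> q"
      using partition_on_block_eq[OF p B(1) W'(1)] mB W' xB by metis
    then have "q < Max W" using qle[OF W'(1)] by simp
    moreover have "Min B < x" "x < q" using x xB mB by (metis le_neq_implies_less)+
    ultimately have "B = W"
      using noncrossingD[OF nc B(1) W'(1), of "Min B" x q "Max W"] mB W'(2) \<open>Max W \<in> W\<close> by blast
    then show False using W'(2) xB by blast
  qed
  have o: "Max {x \<in> Min ` \<pi>. x \<le> q} = Min B"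
  proof (rule Max_eqI)
    show "finite {x \<in> Min ` \<pi>. x \<le> q}" using fin by auto
    show "Min B \<in> {x \<in> Min ` \<pi>. x \<le> q}"
      using B Max_in[OF W(1,2)[OF B(1)]] W(1)[OF B(1)] by auto
    fix y assume "y \<in> {x \<in> Min ` \<pi>. x \<le> q}"
    then obtain W' where W': "W' \<in> \<pi>" "y = Min W'" "y \<le> q" by auto
    show "y \<le> Min B"
    proof (rule ccontr)
      assume "\<not> y \<le> Min B"
      moreover have y: "y \<in> W'" using Min_in[OF W(1,2)[OF W'(1)]] W'(2) by simp
      ultimately have "y \<in> B" using Bint[of y] W'(3) W(3)[OF W'(1)] by auto
      then have "W' = B"
        using partition_on_block_eq[OF p W'(1) B(1) y] by simp
      then show False using W' \<open>\<not> y \<le> Min B\<close> by simp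
    qed
  qed
  have "B = {x \<in> X. Min B \<le> x \<and> x \<le> q}"
    using Bint W[OF B(1)] B(2) by auto
  then show ?thesis using B o by (intro bexI[of _ B]) auto
qed

lemma NC_on_remove_block:
  assumes X: "finite X" and \<pi>: "\<pi> \<in> NC_on X" and B: "B \<in> \<pi>"
  shows "\<pi> - {B} \<in> NC_on (X - B)"
    and "Min ` (\<pi> - {B}) = Min ` \<pi> - {Min B}" and "Max ` (\<pi> - {B}) = Max ` \<pi> - {Max B}"
proof -
  have p: "partition_on X \<pi>" and nc: "noncrossing \<pi>" using \<pi> by (auto simp: NC_on_def)
  have W: "finite W" "W \<noteq> {}" "W \<subseteq> X" if "W \<in> \<pi>" for W
    using partition_on_block_subset[OF p that] partition_on_block_nonempty[OF p that] X
    by (auto dest: finite_subset)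
  have "partition_on (X - B) (\<pi> - {B})"
  proof (rule partition_onI)
    show "\<Union> (\<pi> - {B}) = X - B"
      using partition_onD1[OF p] partition_on_block_eq[OF p B] by blast
    show "disjnt U U'" if "U \<in> \<pi> - {B}" "U' \<in> \<pi> - {B}" "U \<noteq> U'" for U U'
      using partition_on_block_eq[OF p, of U U'] that by (auto simp: disjnt_def)
  qed (use W in auto)
  then show "\<pi> - {B} \<in> NC_on (X - B)"
    using noncrossing_subset[OF nc] by (auto simp: NC_on_def)
  have "Min W \<noteq> Min B" "Max W \<noteq> Max B" if "W \<in> \<pi>" "W \<noteq> B" for W
    using partition_on_block_eq[OF p that(1) B] that(2)
      Min_in[OF W(1,2)[OF that(1)]] Max_in[OF W(1,2)[OF that(1)]]
      Min_in[OF W(1,2)[OF B]] Max_in[OF W(1,2)[OF B]] by metis+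
  then show "Min ` (\<pi> - {B}) = Min ` \<pi> - {Min B}" "Max ` (\<pi> - {B}) = Max ` \<pi> - {Max B}"
    by auto
qed

text \<open>A non-crossing partition is determined by the sets of first and of last elements of its blocks,
  as a bracketing is determined by its opening and closing brackets: the first closing bracket
  belongs to the nearest opening bracket before it, and the block between them can be removed.\<close>

lemma NC_on_eqI:
  assumes "finite X" "\<pi> \<in> NC_on X" "\<pi>' \<in> NC_on X" "Min ` \<pi> = Min ` \<pi>'" "Max ` \<pi> = Max ` \<pi>'"
  shows "\<pi> = \<pi>'"
  using assms
proof (induction X arbitrary: \<pi> \<pi>' rule: finite_psubset_induct)
  case (psubset X)
  show ?case
  proof (cases "X = {}")
    case True
    then show ?thesis using psubset.prems by (simp add: NC_on_def partition_on_empty)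
  next
    case False
    define q where "q = Min (Max ` \<pi>)"
    define C where "C = {x \<in> X. Max {x \<in> Min ` \<pi>. x \<le> q} \<le> x \<and> x \<le> q}"
    have B: "C \<in> \<pi>"
      using first_closing_block[OF psubset.hyps False psubset.prems(1)]
      unfolding q_def[symmetric] C_def[symmetric] by (elim bexE conjE) simp
    have "q = Min (Max ` \<pi>')" "C = {x \<in> X. Max {x \<in> Min ` \<pi>'. x \<le> q} \<le> x \<and> x \<le> q}"
      unfolding q_def C_def psubset.prems(3,4) by (rule refl)+
    then have B': "C \<in> \<pi>'"
      using first_closing_block[OF psubset.hyps False psubset.prems(2)] by (elim bexE conjE) simp
    have CX: "C \<subseteq> X" "C \<noteq> {}"
      using B psubset.prems(1) partition_on_block_subset[of X \<pi> C] partition_on_block_nonempty[of X \<pi> C]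
      unfolding NC_on_def by blast+
    have "\<pi> - {C} = \<pi>' - {C}"
    proof (rule psubset.IH)
      show "X - C \<subset> X" using CX by blast
      show "\<pi> - {C} \<in> NC_on (X - C)" "\<pi>' - {C} \<in> NC_on (X - C)"
        using NC_on_remove_block(1)[OF psubset.hyps psubset.prems(1)]
          NC_on_remove_block(1)[OF psubset.hyps psubset.prems(2)] B B' by simp_all
      show "Min ` (\<pi> - {C}) = Min ` (\<pi>' - {C})" "Max ` (\<pi> - {C}) = Max ` (\<pi>' - {C})"
        using NC_on_remove_block(2,3)[OF psubset.hyps psubset.prems(1)]
          NC_on_remove_block(2,3)[OF psubset.hyps psubset.prems(2)] B B' psubset.prems(3,4)
        by simp_all
    qed
    then show ?thesis using B B' by blast
  qed
qed

lemma card_NC_on_le: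
  assumes X: "finite X"
  shows "card (NC_on X) \<le> 4 ^ card X"
proof -
  let ?f = "\<lambda>\<pi>. (Min ` \<pi>, Max ` \<pi>)"
  have "inj_on ?f (NC_on X)"
    by (intro inj_onI NC_on_eqI[OF X]) auto
  moreover have "?f ` NC_on X \<subseteq> Pow X \<times> Pow X"
  proof -
    have "Min W \<in> X" "Max W \<in> X" if "\<pi> \<in> NC_on X" "W \<in> \<pi>" for \<pi> W
    proof -
      have "W \<subseteq> X" "W \<noteq> {}" "finite W"
        using partition_on_block_subset[of X \<pi> W] partition_on_block_nonempty[of X \<pi> W] that
          finite_subset[OF _ X, of W] by (auto simp: NC_on_def)
      then show "Min W \<in> X" "Max W \<in> X" using Min_in[of W] Max_in[of W] by blast+
    qed
    then show ?thesis by blast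
  qed
  ultimately have "card (NC_on X) \<le> card (Pow X \<times> Pow X)"
    using X by (intro card_inj_on_le) auto
  also have "\<dots> = 4 ^ card X"
    using X by (simp add: card_cartesian_product card_Pow flip: power_mult_distrib)
  finally show ?thesis .
qed

section \<open>Colour patterns of words\<close>

definition crossing_word :: "'c list \<Rightarrow> bool" where
  "crossing_word cs \<longleftrightarrow> (\<exists>x y. x \<noteq> y \<and> subseq [x, y, x, y] cs)"

text \<open>A list without equal neighbours can use only one of two equal neighbours.\<close>

lemma subseq_duplicate:
  "distinct_adj L \<Longrightarrow> subseq L (us @ c # c # vs) \<longleftrightarrow> subseq L (us @ c # vs)"
proof (induction us arbitrary: L)
  case Nil
  show ?case
  proof (cases L)
    case (Cons l L')
    have "subseq L' (c # vs) \<longleftrightarrow> subseq L' vs" if "l = c"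
      using Nil Cons that by (cases L') auto
    then show ?thesis using Cons by auto
  qed simp
next
  case (Cons u us)
  show ?case
  proof (cases L)
    case (Cons l L')
    then have "distinct_adj L'" using Cons.prems by (cases L') auto
    then show ?thesis using Cons Cons.IH[of L'] Cons.IH[of L] Cons.prems by auto
  qed simp
qed

lemma crossing_word_duplicate:
  "crossing_word (us @ c # c # vs) \<longleftrightarrow> crossing_word (us @ c # vs)"
proof -
  have "subseq [x, y, x, y] (us @ c # c # vs) \<longleftrightarrow> subseq [x, y, x, y] (us @ c # vs)" if "x \<noteq> y" for x y
    using that by (intro subseq_duplicate) auto
  then show ?thesis unfolding crossing_word_def by blast
qed

lemma subseq_remove_letter:
  "c \<notin> set L \<Longrightarrow> subseq L (us @ c # vs) \<longleftrightarrow> subseq L (us @ vs)"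
proof (induction us arbitrary: L)
  case Nil
  then show ?case by (cases L) auto
next
  case (Cons u us)
  then show ?case by (cases L) auto
qed

lemma crossing_word_remove_unique:
  assumes "c \<notin> set us" "c \<notin> set vs"
  shows "crossing_word (us @ c # vs) \<longleftrightarrow> crossing_word (us @ vs)"
proof -
  have "c \<notin> {x, y}" if "subseq [x, y, x, y] (us @ c # vs)" for x y
  proof -
    have "filter ((=) c) us = []" "filter ((=) c) vs = []"
      using assms by (auto simp: filter_empty_conv)
    then have "length (filter ((=) c) [x, y, x, y]) \<le> 1"
      using list_emb_length[OF subseq_filter[OF that, of "(=) c"]] by simp
    then show ?thesis by (auto split: if_splits)
  qed
  moreover have "c \<notin> {x, y}" if "subseq [x, y, x, y] (us @ vs)" for x y
    using assms list_emb_set[OF that] by (metis Un_iff insertE list.set_intros set_append singletonD)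
  moreover have "subseq [x, y, x, y] (us @ c # vs) \<longleftrightarrow> subseq [x, y, x, y] (us @ vs)"
    if "c \<notin> {x, y}" for x y
    using that by (intro subseq_remove_letter) auto
  ultimately show ?thesis unfolding crossing_word_def by metis
qed

text \<open>Take a repetition \<open>c, ys, c\<close> of some colour at minimal distance. The colour following the first
  \<open>c\<close> cannot occur again before the second \<open>c\<close> by minimality, nor outside without crossing.\<close>

lemma noncrossing_word_unique_letter:
  assumes "cs \<noteq> []" "distinct_adj cs" "\<not> crossing_word cs"
  shows "\<exists>us c vs. cs = us @ c # vs \<and> c \<notin> set us \<and> c \<notin> set vs"
proof (cases "distinct cs")
  case True
  then show ?thesis using assms(1) by (cases cs) (auto intro!: exI[of _ "[]"])
next
  case False
  let ?P = "\<lambda>n. \<exists>xs c ys zs. cs = xs @ [c] @ ys @ [c] @ zs \<and> length ys = n"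
  obtain n where n: "?P n" and min: "\<And>m. ?P m \<Longrightarrow> n \<le> m"
    using not_distinct_decomp[OF False] exists_least_iff[of ?P] by (metis not_le_imp_less)
  obtain xs c ys zs where cs: "cs = xs @ [c] @ ys @ [c] @ zs" and ly: "length ys = n"
    using n by blast
  obtain d ys' where ys: "ys = d # ys'"
    using assms(2) cs by (cases ys) (auto simp: distinct_adj_append_iff)
  have dc: "d \<noteq> c" using assms(2) cs ys by (auto simp: distinct_adj_append_iff)
  have "d \<notin> set ys'"
  proof
    assume "d \<in> set ys'"
    then obtain as bs where "ys' = as @ d # bs" by (meson split_list)
    then have "?P (length as)"
      using cs ys by (intro exI[of _ "xs @ [c]"] exI[of _ d] exI[of _ as] exI[of _ "bs @ [c] @ zs"]) auto
    then show False using min[of "length as"] ly ys \<open>ys' = as @ d # bs\<close> by simp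
  qed
  moreover have "d \<notin> set xs"
  proof
    assume "d \<in> set xs"
    then have "subseq ([d] @ [c] @ [d] @ [c]) (xs @ [c] @ ys @ [c] @ zs)"
      using ys by (intro list_emb_append_mono) (auto simp: subseq_singleton_left intro: list_emb_append_mono)
    then show False using assms(3) dc cs unfolding crossing_word_def by auto
  qed
  moreover have "d \<notin> set zs"
  proof
    assume "d \<in> set zs"
    then have "subseq ([] @ [c] @ [d] @ [c] @ [d]) (xs @ [c] @ ys @ [c] @ zs)"
      using ys by (intro list_emb_append_mono) (auto simp: subseq_singleton_left)
    then show False using assms(3) dc cs unfolding crossing_word_def by (auto simp: eq_commute)
  qed
  ultimately show ?thesis
    using cs ys dc by (intro exI[of _ "xs @ [c]"] exI[of _ d] exI[of _ "ys' @ [c] @ zs"]) auto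
qed

section \<open>Asymptotics of words in free variables\<close>

text \<open>A letter \<open>(c, u, f)\<close> stands for the product of the variables of colour \<open>c\<close> with indices \<open>u\<close>,
  centred to have expectation 0 if \<open>f\<close> holds.\<close>

type_synonym ('c, 'i) letter = "'c \<times> 'i list \<times> bool"

definition colours :: "('c, 'i) letter list \<Rightarrow> 'c list" where
  "colours w = map fst w"

definition block_word :: "'c \<Rightarrow> ('c, 'i) letter list \<Rightarrow> 'i list" where
  "block_word c w = concat (map (\<lambda>(_, u, _). u) (filter (\<lambda>l. fst l = c) w))"

text \<open>A centred letter whose colour occurs only once makes the expectation vanish.\<close>

definition isolated_centred :: "('c, 'i) letter list \<Rightarrow> bool" where
  "isolated_centred w \<longleftrightarrow> (\<exists>c u. (c, u, True) \<in> set w \<and> count_list (colours w) c = 1)"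

text \<open>The coefficient of \<open>N\<^sup>-\<^sup>m\<close> in the expectation of a word with \<open>m\<close> colours, if \<open>L\<close> gives the
  coefficients of \<open>N\<^sup>-\<^sup>1\<close> for words of one colour.\<close>

definition leading_coeff :: "('i list \<Rightarrow> complex) \<Rightarrow> ('c, 'i) letter list \<Rightarrow> complex" where
  "leading_coeff L w = (if crossing_word (colours w) \<or> isolated_centred w then 0
     else \<Prod>c\<in>set (colours w). L (block_word c w))"

lemma leading_coeff_merge:
  "leading_coeff L (p @ (c, u, f) # (c, v, g) # q) = leading_coeff L (p @ (c, u @ v, False) # q)"
proof -
  let ?w = "p @ (c, u, f) # (c, v, g) # q" and ?w' = "p @ (c, u @ v, False) # q"
  have 1: "crossing_word (colours ?w) = crossing_word (colours ?w')"
    by (simp add: colours_def crossing_word_duplicate)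
  have cnt: "count_list (colours ?w) d = (if d = c then Suc (count_list (colours ?w') d) else count_list (colours ?w') d)" for d
    by (simp add: colours_def)
  have two: "count_list (colours ?w') c \<ge> 2" if "(c, x) \<in> set p \<union> set q" for x
  proof -
    have "c \<in> set (map fst (p @ q))" using that by force
    then have "count_list (map fst (p @ q)) c \<noteq> 0" unfolding count_list_0_iff by blast
    then show ?thesis by (auto simp: colours_def)
  qed
  have pos: "count_list (colours ?w') c \<noteq> 0" unfolding count_list_0_iff by (simp add: colours_def)
  have "isolated_centred ?w \<longleftrightarrow>
      (\<exists>d x. (d, x, True) \<in> set p \<union> set q \<and> d \<noteq> c \<and> count_list (colours ?w') d = 1)"
  proof -
    have "(d, x, True) \<in> set ?w \<and> count_list (colours ?w) d = 1 \<longleftrightarrow>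
        (d, x, True) \<in> set p \<union> set q \<and> d \<noteq> c \<and> count_list (colours ?w') d = 1" for d x
      using pos unfolding cnt by (cases "d = c") auto
    then show ?thesis unfolding isolated_centred_def by simp
  qed
  moreover have "isolated_centred ?w' \<longleftrightarrow>
      (\<exists>d x. (d, x, True) \<in> set p \<union> set q \<and> d \<noteq> c \<and> count_list (colours ?w') d = 1)"
  proof -
    have "(d, x, True) \<in> set ?w' \<and> count_list (colours ?w') d = 1 \<longleftrightarrow>
        (d, x, True) \<in> set p \<union> set q \<and> d \<noteq> c \<and> count_list (colours ?w') d = 1" for d x
      using two[of "(x, True)"] by (cases "d = c") auto
    then show ?thesis unfolding isolated_centred_def by simp
  qed
  ultimately have 2: "isolated_centred ?w = isolated_centred ?w'" by simp
  have "block_word d ?w = block_word d ?w'" for d by (simp add: block_word_def)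
  moreover have "set (colours ?w) = set (colours ?w')" by (auto simp: colours_def)
  ultimately show ?thesis unfolding leading_coeff_def 1 2 by simp
qed

text \<open>If the colour of a letter occurs elsewhere, centring the letter subtracts a mean of order \<open>1/N\<close>
  times a word with the same number of colours, a term of lower order.\<close>

lemma leading_coeff_centre:
  assumes "c \<in> set (colours (p @ q))"
  shows "leading_coeff L (p @ (c, u, True) # q) = leading_coeff L (p @ (c, u, False) # q)"
proof -
  have "count_list (colours (p @ q)) c \<noteq> 0" using assms count_list_0_iff by metis
  then have "count_list (colours (p @ (c, u, f) # q)) c \<noteq> 1" for f
    by (simp add: colours_def)
  then have "isolated_centred (p @ (c, u, True) # q) = isolated_centred (p @ (c, u, False) # q)"
    by (auto simp: isolated_centred_def colours_def)
  moreover have "block_word d (p @ (c, u, True) # q) = block_word d (p @ (c, u, False) # q)" for d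
    by (simp add: block_word_def)
  moreover have "colours (p @ (c, u, True) # q) = colours (p @ (c, u, False) # q)"
    by (simp add: colours_def)
  ultimately show ?thesis unfolding leading_coeff_def by simp
qed

text \<open>A letter whose colour occurs nowhere else is free from the rest and factors out.\<close>

lemma leading_coeff_isolated:
  assumes c: "c \<notin> set (colours (p @ q))"
  shows "leading_coeff L (p @ (c, u, True) # q) = 0"
    and "leading_coeff L (p @ (c, u, False) # q) = L u * leading_coeff L (p @ q)"
proof -
  have c': "c \<notin> set (map fst p)" "c \<notin> set (map fst q)" using c by (auto simp: colours_def)
  have cnt: "count_list (map fst p) c = 0" "count_list (map fst q) c = 0" using c' by simp_all
  then have "isolated_centred (p @ (c, u, True) # q)"
    by (auto simp: isolated_centred_def colours_def)
  then show "leading_coeff L (p @ (c, u, True) # q) = 0" by (simp add: leading_coeff_def)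
  have 1: "crossing_word (colours (p @ (c, u, False) # q)) = crossing_word (colours (p @ q))"
    using crossing_word_remove_unique[OF c'] by (simp add: colours_def)
  have 2: "isolated_centred (p @ (c, u, False) # q) = isolated_centred (p @ q)"
  proof -
    have "d \<noteq> c" if "(d, x) \<in> set p \<union> set q" for d x using c' that by force
    then have "count_list (colours (p @ (c, u, False) # q)) d = count_list (colours (p @ q)) d"
      if "(d, x) \<in> set p \<union> set q" for d x using that by (simp add: colours_def) blast
    then show ?thesis unfolding isolated_centred_def by fastforce
  qed
  have "block_word d (p @ (c, u, False) # q) = block_word d (p @ q)" if "d \<noteq> c" for d
    using that by (simp add: block_word_def)
  moreover have "block_word c (p @ (c, u, False) # q) = u"
  proof -
    have "filter (\<lambda>l. fst l = c) p = []" "filter (\<lambda>l. fst l = c) q = []"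
      using c' by (auto simp: filter_empty_conv)
    then show ?thesis by (simp add: block_word_def)
  qed
  moreover have "set (colours (p @ (c, u, False) # q)) = insert c (set (colours (p @ q)))"
    by (auto simp: colours_def)
  moreover have "(\<Prod>d\<in>set (colours (p @ q)). L (block_word d (p @ (c, u, False) # q)))
      = (\<Prod>d\<in>set (colours (p @ q)). L (block_word d (p @ q)))"
    using c calculation(1) by (intro prod.cong refl) metis
  ultimately have "(\<Prod>d\<in>set (colours (p @ (c, u, False) # q)). L (block_word d (p @ (c, u, False) # q)))
      = L u * (\<Prod>d\<in>set (colours (p @ q)). L (block_word d (p @ q)))"
    using c by simp
  then show "leading_coeff L (p @ (c, u, False) # q) = L u * leading_coeff L (p @ q)"
    unfolding leading_coeff_def 1 2 by simp
qed

lemma leading_coeff_all_centred: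
  assumes "w \<noteq> []" "distinct_adj (colours w)" "\<forall>(c, u, f)\<in>set w. f"
  shows "leading_coeff L w = 0"
proof (cases "crossing_word (colours w)")
  case False
  obtain us c vs where c: "colours w = us @ c # vs" "c \<notin> set us" "c \<notin> set vs"
    using noncrossing_word_unique_letter[OF _ assms(2) False] assms(1) by (auto simp: colours_def)
  then have "count_list (colours w) c = 1" by simp
  moreover have "c \<in> set (colours w)" using c by simp
  then obtain u f where "(c, u, f) \<in> set w" by (auto simp: colours_def)
  ultimately have "isolated_centred w"
    using assms(3) unfolding isolated_centred_def by (intro exI[of _ c] exI[of _ u]) auto
  then show ?thesis by (simp add: leading_coeff_def)
qed (simp add: leading_coeff_def)

lemma adjacent_or_raw_or_centred:
  fixes w :: "('c, 'i) letter list"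
  obtains (adjacent) p c u f v g q where "w = p @ (c, u, f) # (c, v, g) # q"
  | (raw) p c u q where "distinct_adj (colours w)" "w = p @ (c, u, False) # q"
  | (centred) "distinct_adj (colours w)" "\<forall>(c, u, f)\<in>set w. f"
proof (cases "distinct_adj (colours w)")
  case False
  then have "\<exists>p c u f v g q. w = p @ (c, u, f) # (c, v, g) # q"
  proof (induction w)
    case (Cons l w)
    show ?case
    proof (cases "distinct_adj (colours w)")
      case True
      then obtain l' w' where w: "w = l' # w'" "fst l = fst l'"
        using Cons.prems by (cases w) (auto simp: colours_def)
      then show ?thesis by (intro exI[of _ "[]"]) (metis append_Nil prod.collapse)
    next
      case False
      then obtain p c u f v g q where "w = p @ (c, u, f) # (c, v, g) # q" using Cons.IH by blast
      then show ?thesis by (metis append_Cons)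
    qed
  qed (simp add: colours_def)
  then show ?thesis using adjacent by blast
next
  case True
  show ?thesis
  proof (cases "\<forall>(c, u, f)\<in>set w. f")
    case False
    then obtain c u where "(c, u, False) \<in> set w" by auto
    then show ?thesis using raw[OF True] by (meson split_list)
  qed (use centred True in blast)
qed

text \<open>
  Merging neighbours of equal colour and splitting a letter into its centred part and its mean
  reduces every word to alternating centred words, on which a free state vanishes. Each mean is of
  order \<open>1/N\<close> and replaces a letter, that is, it removes at most one colour; so a word with \<open>m\<close>
  colours has order \<open>N\<^sup>-\<^sup>m\<close>, and only the removal of complete colours contributes to the leading term.
\<close>

lemma free_word_asymptotics:
  fixes E :: "nat \<Rightarrow> ('c, 'i) letter list \<Rightarrow> complex" and t :: "nat \<Rightarrow> 'c \<Rightarrow> 'i list \<Rightarrow> complex"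
    and N :: "nat \<Rightarrow> nat" and L :: "'i list \<Rightarrow> complex"
  assumes N: "filterlim N at_top sequentially"
    and t: "\<And>c u. c \<in> C \<Longrightarrow> u \<noteq> [] \<Longrightarrow> (\<lambda>k. of_nat (N k) * t k c u) \<longlonglongrightarrow> L u"
    and E_Nil: "\<And>k. E k [] = 1"
    and E_centre: "\<And>k p c u q. E k (p @ (c, u, False) # q) = E k (p @ (c, u, True) # q) + t k c u * E k (p @ q)"
    and E_merge: "\<And>k p c u v q. E k (p @ (c, u, False) # (c, v, False) # q) = E k (p @ (c, u @ v, False) # q)"
    and E_free: "\<And>k w. w \<noteq> [] \<Longrightarrow> fst ` set w \<subseteq> C \<Longrightarrow> distinct_adj (colours w) \<Longrightarrow>
      \<forall>(c, u, f)\<in>set w. f \<Longrightarrow> E k w = 0"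
    and w: "fst ` set w \<subseteq> C" "\<forall>(c, u, f)\<in>set w. u \<noteq> []"
  shows "(\<lambda>k. of_nat (N k) ^ card (set (colours w)) * E k w) \<longlonglongrightarrow> leading_coeff L w"
  using w
proof (induction w rule: measure_induct_rule[where
      f = "\<lambda>w. 2 * length w + length (filter (\<lambda>(c, u, f). \<not> f) w)"])
  case (less w)
  have t0: "(\<lambda>k. t k c u) \<longlonglongrightarrow> 0" if "c \<in> C" "u \<noteq> []" for c u
  proof -
    have inv: "(\<lambda>k. inverse (of_nat (N k)) :: complex) \<longlonglongrightarrow> 0"
      by (rule filterlim_compose[OF tendsto_inverse_0 filterlim_compose[OF tendsto_of_nat N]])
    have "(\<lambda>k. inverse (of_nat (N k)) * (of_nat (N k) * t k c u)) \<longlonglongrightarrow> 0 * L u"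
      by (intro tendsto_mult inv t that)
    moreover have "\<forall>\<^sub>F k in sequentially. inverse (of_nat (N k)) * (of_nat (N k) * t k c u) = t k c u"
      using N[unfolded filterlim_at_top, rule_format, of 1] by eventually_elim simp
    ultimately show ?thesis using Lim_transform_eventually by fastforce
  qed
  show ?case
  proof (cases w rule: adjacent_or_raw_or_centred)
    case (adjacent p c u f v g q)
    let ?m = "p @ (c, u @ v, False) # q" and ?a = "p @ (c, u, False) # q" and ?b = "p @ (c, v, g) # q"
    define n where "n = card (set (colours w))"
    have n: "card (set (colours ?m)) = n" "card (set (colours ?a)) = n" "card (set (colours ?b)) = n"
      by (simp_all add: n_def adjacent colours_def)
    have c: "c \<in> C" "u \<noteq> []" "v \<noteq> []" using less.prems adjacent by auto
    have E: "E k w = E k ?m - (if g then t k c v else 0) * E k ?a - (if f then t k c u else 0) * E k ?b" for k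
      using E_centre[of k p c u "(c, v, g) # q"] E_centre[of k "p @ [(c, u, False)]" c v q]
        E_merge[of k p c u v q] adjacent by auto
    have IH: "(\<lambda>k. of_nat (N k) ^ n * E k x) \<longlonglongrightarrow> leading_coeff L x"
      if "x = ?m \<or> x = ?a \<or> x = ?b" for x
    proof -
      have "card (set (colours x)) = n" using n that by metis
      moreover have "(\<lambda>k. of_nat (N k) ^ card (set (colours x)) * E k x) \<longlonglongrightarrow> leading_coeff L x"
        using that less.prems adjacent by (intro less.IH) (elim disjE; simp)+
      ultimately show ?thesis by simp
    qed
    have lim: "(\<lambda>k. of_nat (N k) ^ n * E k ?m) \<longlonglongrightarrow> leading_coeff L ?m"
      "(\<lambda>k. of_nat (N k) ^ n * E k ?a) \<longlonglongrightarrow> leading_coeff L ?a"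
      "(\<lambda>k. of_nat (N k) ^ n * E k ?b) \<longlonglongrightarrow> leading_coeff L ?b"
      by (intro IH; simp)+
    have g0: "(\<lambda>k. if h then t k c x else 0) \<longlonglongrightarrow> 0" if "x \<noteq> []" for h x
      using t0[OF c(1) that] by (cases h) auto
    have "(\<lambda>k. of_nat (N k) ^ n * E k ?m - (if g then t k c v else 0) * (of_nat (N k) ^ n * E k ?a)
        - (if f then t k c u else 0) * (of_nat (N k) ^ n * E k ?b))
      \<longlonglongrightarrow> leading_coeff L ?m - 0 * leading_coeff L ?a - 0 * leading_coeff L ?b"
      by (intro tendsto_diff tendsto_mult lim g0 c)
    then show ?thesis
      using leading_coeff_merge[of L p c u f v g q] unfolding E n_def[symmetric] adjacent[symmetric]
      by (simp add: algebra_simps)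
  next
    case (raw p c u q)
    let ?x = "p @ (c, u, True) # q" and ?y = "p @ q"
    define n where "n = card (set (colours w))"
    have c: "c \<in> C" "u \<noteq> []" using less.prems raw by auto
    have E: "E k w = E k ?x + t k c u * E k ?y" for k
      using E_centre[of k p c u q] raw(2) by simp
    have nx: "card (set (colours ?x)) = n" by (simp add: n_def raw(2) colours_def)
    have limx: "(\<lambda>k. of_nat (N k) ^ card (set (colours ?x)) * E k ?x) \<longlonglongrightarrow> leading_coeff L ?x"
      using less.prems by (intro less.IH) (auto simp: raw(2))
    have limy: "(\<lambda>k. of_nat (N k) ^ card (set (colours ?y)) * E k ?y) \<longlonglongrightarrow> leading_coeff L ?y"
      using less.prems by (intro less.IH) (auto simp: raw(2))
    show ?thesis
    proof (cases "c \<in> set (colours ?y)")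
      case True
      then have "set (colours w) = set (colours ?y)" by (auto simp: raw(2) colours_def)
      then have ny: "card (set (colours ?y)) = n" by (simp add: n_def)
      have "(\<lambda>k. of_nat (N k) ^ n * E k ?x + t k c u * (of_nat (N k) ^ n * E k ?y))
        \<longlonglongrightarrow> leading_coeff L ?x + 0 * leading_coeff L ?y"
        using limx limy unfolding nx ny by (intro tendsto_add tendsto_mult t0 c)
      then show ?thesis
        using leading_coeff_centre[OF True, of L u] unfolding E n_def[symmetric] raw(2)[symmetric]
        by (simp add: algebra_simps)
    next
      case False
      have "set (colours w) = insert c (set (colours ?y))" by (auto simp: raw(2) colours_def)
      then have ny: "n = Suc (card (set (colours ?y)))" using False by (simp add: n_def)
      have "(\<lambda>k. of_nat (N k) ^ n * E k ?x
          + (of_nat (N k) * t k c u) * (of_nat (N k) ^ card (set (colours ?y)) * E k ?y))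
        \<longlonglongrightarrow> leading_coeff L ?x + L u * leading_coeff L ?y"
        using limx limy unfolding nx by (intro tendsto_add tendsto_mult t c)
      then show ?thesis
        using leading_coeff_isolated[OF False, of L u] unfolding E n_def[symmetric] raw(2)[symmetric] ny
        by (simp add: algebra_simps)
    qed
  next
    case centred
    show ?thesis
    proof (cases "w = []")
      case True
      have "leading_coeff L w = 1"
        by (simp add: True leading_coeff_def colours_def crossing_word_def isolated_centred_def)
      then show ?thesis using E_Nil by (simp add: True colours_def)
    next
      case False
      then show ?thesis
        using leading_coeff_all_centred[OF False centred] E_free[OF False less.prems(1) centred] by simp
    qed
  qed
qed

section \<open>Products and states\<close>

context cstar_prob_space
begin

text \<open>The facts about the ring of scalars have the same names as those about the algebra and hide
  them; these are the facts about the algebra.\<close>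

lemma semiring_alg: "semiring A" and monoid_alg: "monoid A" and abelian_monoid_alg: "abelian_monoid A"
  by unfold_locales

lemmas alg_assoc = monoid.m_assoc[OF monoid_alg]
lemmas alg_l_distr = semiring.l_distr[OF semiring_alg]
lemmas alg_r_distr = semiring.r_distr[OF semiring_alg]
lemmas alg_finsum_closed = abelian_monoid.finsum_closed[OF abelian_monoid_alg]
lemmas alg_finsum_insert = abelian_monoid.finsum_insert[OF abelian_monoid_alg]
lemmas alg_finsum_ldistr = semiring.finsum_ldistr[OF semiring_alg]
lemmas alg_finsum_rdistr = semiring.finsum_rdistr[OF semiring_alg]

lemma lprod_Nil [simp]: "lprod A [] = \<one>" by (simp add: lprod_def)

lemma lprod_Cons [simp]: "lprod A (x # xs) = x \<otimes> lprod A xs" by (simp add: lprod_def)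

lemma lprod_closed [simp, intro]: "set xs \<subseteq> carrier A \<Longrightarrow> lprod A xs \<in> carrier A"
  by (induction xs) auto

lemma lprod_map_closed [simp, intro]: "(\<And>k. k \<in> set ks \<Longrightarrow> f k \<in> carrier A) \<Longrightarrow> lprod A (map f ks) \<in> carrier A"
  by (rule lprod_closed) auto

lemma lprod_append:
  "set xs \<subseteq> carrier A \<Longrightarrow> set ys \<subseteq> carrier A \<Longrightarrow> lprod A (xs @ ys) = lprod A xs \<otimes> lprod A ys"
  by (induction xs) (auto simp: alg_assoc lprod_closed)

lemma smult_closed' [simp, intro]: "x \<in> carrier A \<Longrightarrow> c \<odot> x \<in> carrier A"
  by (simp add: complex_ring_def)

lemma smult_smult: "x \<in> carrier A \<Longrightarrow> c \<odot> (d \<odot> x) = (c * d) \<odot> x"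
  using smult_assoc1[of c d x] by (simp add: complex_ring_def)

lemma lprod_smult:
  "x ` set ks \<subseteq> carrier A \<Longrightarrow>
    lprod A (map (\<lambda>k. c k \<odot> x k) ks) = (\<Prod>k\<leftarrow>ks. c k) \<odot> lprod A (map x ks)"
proof (induction ks)
  case Nil
  then show ?case using smult_one[of \<one>] by (simp add: complex_ring_def)
next
  case (Cons k ks)
  have "x k \<in> carrier A" "lprod A (map x ks) \<in> carrier A" using Cons.prems by auto
  then show ?case
    using Cons by (simp add: smult_mult_left smult_mult_right smult_smult mult.commute)
qed

lemma state_finsum:
  "finite J \<Longrightarrow> f \<in> J \<rightarrow> carrier A \<Longrightarrow> \<phi> (\<Oplus>j\<in>J. f j) = (\<Sum>j\<in>J. \<phi> (f j))"
proof (induction J rule: finite_induct)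
  case empty
  have "\<phi> \<zero> = \<phi> \<zero> + \<phi> \<zero>" using state_add[of \<zero> \<zero>] by simp
  then show ?case by simp
next
  case (insert j J)
  then show ?case by (simp add: Pi_def state_add alg_finsum_insert)
qed

text \<open>The left factor \<open>y\<close> collects the factors that have already been expanded.\<close>

lemma state_lprod_finsum:
  assumes "finite J" "distinct ks" "y \<in> carrier A" "\<And>r k. r \<in> J \<Longrightarrow> k \<in> set ks \<Longrightarrow> x r k \<in> carrier A"
  shows "\<phi> (y \<otimes> lprod A (map (\<lambda>k. \<Oplus>r\<in>J. x r k) ks))
    = (\<Sum>\<rho>\<in>set ks \<rightarrow>\<^sub>E J. \<phi> (y \<otimes> lprod A (map (\<lambda>k. x (\<rho> k) k) ks)))"
  using assms(2-4)
proof (induction ks arbitrary: y)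
  case Nil
  then show ?case by simp
next
  case (Cons k ks)
  let ?S = "\<lambda>k. \<Oplus>r\<in>J. x r k" and ?F = "set ks \<rightarrow>\<^sub>E J"
  let ?P = "\<lambda>\<rho>. lprod A (map (\<lambda>k. x (\<rho> k) k) ks)"
  have k: "k \<notin> set ks" "distinct ks" using Cons.prems by auto
  have S: "?S j \<in> carrier A" if "j \<in> set (k # ks)" for j
    using Cons.prems(3) that by (intro alg_finsum_closed) auto
  have xk: "x r k \<in> carrier A" if "r \<in> J" for r using Cons.prems(3) that by simp
  have L: "lprod A (map ?S ks) \<in> carrier A" using S by auto
  have P: "?P \<rho> \<in> carrier A" if "\<rho> \<in> ?F" for \<rho>
    using Cons.prems(3) that by (intro lprod_closed) (auto simp: PiE_def Pi_def)
  have "\<phi> (y \<otimes> lprod A (map ?S (k # ks))) = \<phi> ((y \<otimes> ?S k) \<otimes> lprod A (map ?S ks))"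
    using Cons.prems(2) S L by (simp add: alg_assoc)
  also have "\<dots> = (\<Sum>\<rho>\<in>?F. \<phi> ((y \<otimes> ?S k) \<otimes> ?P \<rho>))"
    using Cons.prems S k by (intro Cons.IH) auto
  also have "\<dots> = (\<Sum>\<rho>\<in>?F. \<Sum>r\<in>J. \<phi> (y \<otimes> (x r k \<otimes> ?P \<rho>)))"
  proof (intro sum.cong refl)
    fix \<rho> assume \<rho>: "\<rho> \<in> ?F"
    have "(y \<otimes> ?S k) \<otimes> ?P \<rho> = y \<otimes> (\<Oplus>r\<in>J. x r k \<otimes> ?P \<rho>)"
      using Cons.prems(2) S[of k] P[OF \<rho>] xk
      by (simp add: alg_assoc alg_finsum_ldistr[OF assms(1)] Pi_def)
    also have "\<dots> = (\<Oplus>r\<in>J. y \<otimes> (x r k \<otimes> ?P \<rho>))"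
      using Cons.prems(2) P[OF \<rho>] xk by (intro alg_finsum_rdistr[OF assms(1)]) auto
    finally show "\<phi> ((y \<otimes> ?S k) \<otimes> ?P \<rho>) = (\<Sum>r\<in>J. \<phi> (y \<otimes> (x r k \<otimes> ?P \<rho>)))"
      using Cons.prems(2) P[OF \<rho>] xk by (simp add: state_finsum[OF assms(1)] Pi_def)
  qed
  also have "\<dots> = (\<Sum>(r, \<rho>)\<in>J \<times> ?F. \<phi> (y \<otimes> (x r k \<otimes> ?P \<rho>)))"
    by (subst sum.swap) (simp add: sum.cartesian_product)
  also have "\<dots> = (\<Sum>(r, \<rho>)\<in>J \<times> ?F. \<phi> (y \<otimes> lprod A (map (\<lambda>j. x ((\<rho>(k := r)) j) j) (k # ks))))"
  proof (intro sum.cong refl, clarify)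
    fix r \<rho>
    have "map (\<lambda>j. x ((\<rho>(k := r)) j) j) ks = map (\<lambda>j. x (\<rho> j) j) ks"
      using k by (intro map_cong) auto
    then show "\<phi> (y \<otimes> (x r k \<otimes> ?P \<rho>)) = \<phi> (y \<otimes> lprod A (map (\<lambda>j. x ((\<rho>(k := r)) j) j) (k # ks)))"
      by (simp del: map_eq_conv fun_upd_apply) simp
  qed
  also have "\<dots> = (\<Sum>\<rho>\<in>(\<lambda>(r, \<rho>). \<rho>(k := r)) ` (J \<times> ?F). \<phi> (y \<otimes> lprod A (map (\<lambda>j. x (\<rho> j) j) (k # ks))))"
    using inj_combinator[OF k(1), of "\<lambda>_. J"] by (subst sum.reindex) (simp_all add: case_prod_unfold)
  also have "(\<lambda>(r, \<rho>). \<rho>(k := r)) ` (J \<times> ?F) = set (k # ks) \<rightarrow>\<^sub>E J"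
    using PiE_insert_eq[of k "set ks" "\<lambda>_. J"] by simp
  finally show ?case .
qed

end

subsection \<open>Words in free subalgebras\<close>

definition letter_value :: "'a cstar \<Rightarrow> ('a \<Rightarrow> complex) \<Rightarrow> ('c \<Rightarrow> 'i \<Rightarrow> 'a) \<Rightarrow> ('c, 'i) letter \<Rightarrow> 'a" where
  "letter_value A \<phi> a = (\<lambda>(c, u, f). let x = lprod A (map (a c) u) in
     if f then x \<oplus>\<^bsub>A\<^esub> (- \<phi> x) \<odot>\<^bsub>A\<^esub> \<one>\<^bsub>A\<^esub> else x)"

definition word_moment :: "'a cstar \<Rightarrow> ('a \<Rightarrow> complex) \<Rightarrow> ('c \<Rightarrow> 'i \<Rightarrow> 'a) \<Rightarrow> ('c, 'i) letter list \<Rightarrow> complex" where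
  "word_moment A \<phi> a w = \<phi> (lprod A (map (letter_value A \<phi> a) w))"

context cstar_prob_space
begin

lemma letter_value_closed:
  assumes "\<And>c i. a c i \<in> carrier A"
  shows "letter_value A \<phi> a l \<in> carrier A"
proof -
  have "lprod A (map (a c) u) \<in> carrier A" for c u using assms by auto
  then show ?thesis by (auto simp: letter_value_def Let_def split: prod.split)
qed

lemma word_moment_centre:
  assumes a: "\<And>c i. a c i \<in> carrier A"
  shows "word_moment A \<phi> a (p @ (c, u, False) # q) =
    word_moment A \<phi> a (p @ (c, u, True) # q) + \<phi> (lprod A (map (a c) u)) * word_moment A \<phi> a (p @ q)"
proof -
  let ?v = "letter_value A \<phi> a"
  define x P Q where "x = lprod A (map (a c) u)" and "P = lprod A (map ?v p)" and "Q = lprod A (map ?v q)"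
  have vc: "?v ` S \<subseteq> carrier A" for S using letter_value_closed[OF a] by auto
  have cl: "x \<in> carrier A" "P \<in> carrier A" "Q \<in> carrier A"
    unfolding x_def P_def Q_def using a vc by auto
  have split: "lprod A (map ?v (p @ l # q)) = P \<otimes> (?v l \<otimes> Q)" for l
    unfolding P_def Q_def using lprod_append[of "map ?v p" "map ?v (l # q)"] vc by auto
  have "P \<otimes> (?v (c, u, True) \<otimes> Q) = P \<otimes> ((x \<oplus> (- \<phi> x) \<odot> \<one>) \<otimes> Q)"
    by (simp add: letter_value_def x_def Let_def)
  also have "\<dots> = P \<otimes> (x \<otimes> Q) \<oplus> (- \<phi> x) \<odot> (P \<otimes> Q)"
    using cl by (simp add: alg_l_distr alg_r_distr smult_mult_left smult_mult_right)
  finally have "\<phi> (P \<otimes> (?v (c, u, True) \<otimes> Q)) = \<phi> (P \<otimes> (x \<otimes> Q)) - \<phi> x * \<phi> (P \<otimes> Q)"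
    using cl by (simp add: state_add state_smult)
  moreover have "?v (c, u, False) = x" by (simp add: letter_value_def x_def)
  moreover have "lprod A (map ?v (p @ q)) = P \<otimes> Q"
    unfolding P_def Q_def using lprod_append[of "map ?v p" "map ?v q"] vc by auto
  ultimately show ?thesis unfolding word_moment_def split x_def[symmetric] by simp
qed

lemma word_moment_merge:
  assumes a: "\<And>c i. a c i \<in> carrier A"
  shows "word_moment A \<phi> a (p @ (c, u, False) # (c, v, False) # q) = word_moment A \<phi> a (p @ (c, u @ v, False) # q)"
proof -
  let ?v = "letter_value A \<phi> a"
  have vc: "?v ` S \<subseteq> carrier A" for S using letter_value_closed[OF a] by auto
  have ac: "a c ` S \<subseteq> carrier A" for S using a by auto
  have "?v (c, u @ v, False) = ?v (c, u, False) \<otimes> ?v (c, v, False)"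
    using ac lprod_append[of "map (a c) u" "map (a c) v"] by (simp add: letter_value_def)
  then show ?thesis
    using lprod_append[of "map ?v p" "map ?v ((c, u, False) # (c, v, False) # q)"]
      lprod_append[of "map ?v p" "map ?v ((c, u @ v, False) # q)"] vc letter_value_closed[of a, OF a]
    by (simp add: word_moment_def alg_assoc image_subset_iff)
qed

lemma word_moment_free:
  assumes free: "free_subalgebras A \<phi> I B"
    and a: "\<And>c i. a c i \<in> carrier A"
    and B: "\<And>c u. c \<in> C \<Longrightarrow> letter_value A \<phi> a (c, u, True) \<in> B (\<rho> c)"
    and \<rho>: "inj_on \<rho> C" "\<rho> ` C \<subseteq> I"
    and w: "w \<noteq> []" "fst ` set w \<subseteq> C" "distinct_adj (colours w)" "\<forall>(c, u, f)\<in>set w. f"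
  shows "word_moment A \<phi> a w = 0"
proof -
  let ?v = "letter_value A \<phi> a"
  define n where "n = length w"
  define l x where "l k = \<rho> (fst (w ! (k - 1)))" and "x k = ?v (w ! (k - 1))" for k
  have mem: "w ! (k - 1) \<in> set w" if "k \<in> {1..n}" for k
    using that by (intro nth_mem) (auto simp: n_def)
  have "l k \<in> I \<and> x k \<in> B (l k) \<and> \<phi> (x k) = 0" if k: "k \<in> {1..n}" for k
  proof -
    obtain c u where cu: "w ! (k - 1) = (c, u, True)"
      using bspec[OF w(4) mem[OF k]] by (cases "w ! (k - 1)") auto
    have c: "c \<in> C" using mem[OF k] w(2) cu by force
    have "lprod A (map (a c) u) \<in> carrier A" using a by auto
    then have "\<phi> (x k) = 0"
      unfolding x_def cu by (simp add: letter_value_def Let_def state_add state_smult state_one)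
    then show ?thesis using B[OF c, of u] \<rho>(2) c by (simp add: l_def x_def cu[unfolded One_nat_def] image_subset_iff)
  qed
  moreover have "l k \<noteq> l (k + 1)" if k: "k \<in> {1..<n}" for k
  proof -
    have "colours w ! (k - 1) \<noteq> colours w ! Suc (k - 1)"
      using w(3) k by (intro distinct_adj_conv_nth[THEN iffD1, rule_format]) (auto simp: colours_def n_def)
    then have "fst (w ! (k - 1)) \<noteq> fst (w ! k)"
      using k nth_map[of "k - 1" w fst] by (simp add: colours_def n_def less_imp_diff_less)
    moreover have "fst (w ! (k - 1)) \<in> C" "fst (w ! k) \<in> C"
      using mem[of k] mem[of "k + 1"] k w(2) by auto
    ultimately show ?thesis using \<rho>(1) by (auto simp: l_def inj_on_def)
  qed
  ultimately have "\<phi> (lprod A (map x [1..<n + 1])) = 0"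
    using w(1) by (intro free[unfolded free_subalgebras_def, rule_format, of n l x])
      (simp_all add: n_def Suc_le_eq)
  moreover have "map x [1..<n + 1] = map ?v w"
    by (rule nth_equalityI) (auto simp: x_def n_def simp del: upt_Suc)
  ultimately show ?thesis by (simp add: word_moment_def)
qed

end

subsection \<open>Colourings and partitions\<close>

definition block_of :: "'a set set \<Rightarrow> 'a \<Rightarrow> 'a set" where
  "block_of \<pi> k = (THE W. W \<in> \<pi> \<and> k \<in> W)"

lemma block_of_eq: "partition_on V \<pi> \<Longrightarrow> W \<in> \<pi> \<Longrightarrow> k \<in> W \<Longrightarrow> block_of \<pi> k = W"
  unfolding block_of_def by (rule the_equality) (auto simp: partition_on_def disjoint_def)

lemma block_of_mem: "partition_on V \<pi> \<Longrightarrow> k \<in> V \<Longrightarrow> block_of \<pi> k \<in> \<pi> \<and> k \<in> block_of \<pi> k"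
  using block_of_eq[of V \<pi>] partition_onD1[of V \<pi>] by (metis UnionE)

text \<open>A function is the same as a partition of its domain into fibres and an injective function
  on the fibres.\<close>

lemma sum_PiE_fibres:
  fixes h :: "('a \<Rightarrow> 'b) \<Rightarrow> complex"
  assumes V: "finite V" and J: "finite J"
  shows "(\<Sum>\<rho>\<in>V \<rightarrow>\<^sub>E J. h \<rho>)
    = (\<Sum>\<pi>\<in>{\<pi>. partition_on V \<pi>}. \<Sum>g\<in>{g \<in> \<pi> \<rightarrow>\<^sub>E J. inj_on g \<pi>}. h (\<lambda>k\<in>V. g (block_of \<pi> k)))"
proof -
  let ?P = "{\<pi>. partition_on V \<pi>}" and ?G = "\<lambda>\<pi>. {g \<in> \<pi> \<rightarrow>\<^sub>E J. inj_on g \<pi>}"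
  define ker where "ker \<rho> = (\<lambda>k. {j \<in> V. \<rho> j = \<rho> k}) ` V" for \<rho> :: "'a \<Rightarrow> 'b"
  define ind where "ind \<rho> = (\<lambda>W\<in>ker \<rho>. \<rho> (SOME k. k \<in> W))" for \<rho> :: "'a \<Rightarrow> 'b"
  have finP: "finite ?P" using finitely_many_partition_on[OF V] .
  have finG: "finite (?G \<pi>)" if "\<pi> \<in> ?P" for \<pi>
    using finite_PiE[of \<pi> "\<lambda>_. J"] finite_elements[OF V, of \<pi>] that J by simp
  have ker_part: "partition_on V (ker \<rho>)" for \<rho>
    by (rule partition_onI) (auto simp: ker_def disjnt_def)
  have ind: "ind \<rho> {j \<in> V. \<rho> j = \<rho> k} = \<rho> k" if "k \<in> V" for \<rho> k
  proof -
    have "\<rho> (SOME j. j \<in> {j \<in> V. \<rho> j = \<rho> k}) = \<rho> k"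
      by (rule someI2[of _ k]) (use that in auto)
    then show ?thesis using that by (simp add: ind_def ker_def)
  qed
  have "(\<Sum>\<rho>\<in>V \<rightarrow>\<^sub>E J. h \<rho>) = (\<Sum>(\<pi>, g)\<in>Sigma ?P ?G. h (\<lambda>k\<in>V. g (block_of \<pi> k)))"
  proof (rule sum.reindex_bij_witness[where i = "\<lambda>(\<pi>, g). \<lambda>k\<in>V. g (block_of \<pi> k)" and j = "\<lambda>\<rho>. (ker \<rho>, ind \<rho>)"])
    fix \<rho> assume \<rho>: "\<rho> \<in> V \<rightarrow>\<^sub>E J"
    have blk: "block_of (ker \<rho>) k = {j \<in> V. \<rho> j = \<rho> k}" if "k \<in> V" for k
      using that by (intro block_of_eq[OF ker_part]) (auto simp: ker_def)
    show eq: "(case (ker \<rho>, ind \<rho>) of (\<pi>, g) \<Rightarrow> \<lambda>k\<in>V. g (block_of \<pi> k)) = \<rho>"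
      using \<rho> blk ind by (auto simp: PiE_def extensional_def fun_eq_iff)
    have "ind \<rho> \<in> ker \<rho> \<rightarrow>\<^sub>E J"
    proof (rule PiE_I)
      fix W assume "W \<in> ker \<rho>"
      then show "ind \<rho> W \<in> J" using ind \<rho> by (auto simp: ker_def)
    qed (simp add: ind_def)
    moreover have "inj_on (ind \<rho>) (ker \<rho>)"
      using ind by (auto simp: inj_on_def ker_def)
    ultimately show "(ker \<rho>, ind \<rho>) \<in> Sigma ?P ?G" using ker_part by simp
    show "(case (ker \<rho>, ind \<rho>) of (\<pi>, g) \<Rightarrow> h (\<lambda>k\<in>V. g (block_of \<pi> k))) = h \<rho>"
      using eq by simp
  next
    fix \<pi>g assume "\<pi>g \<in> Sigma ?P ?G"
    then obtain \<pi> g where \<pi>g: "\<pi>g = (\<pi>, g)" "partition_on V \<pi>" "g \<in> \<pi> \<rightarrow>\<^sub>E J" "inj_on g \<pi>" by auto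
    define \<rho> where "\<rho> = (\<lambda>k\<in>V. g (block_of \<pi> k))"
    have mem: "block_of \<pi> k \<in> \<pi>" "k \<in> block_of \<pi> k" if "k \<in> V" for k
      using block_of_mem[OF \<pi>g(2) that] by auto
    have fib: "{j \<in> V. \<rho> j = \<rho> k} = block_of \<pi> k" if k: "k \<in> V" for k
    proof -
      have "\<rho> j = \<rho> k \<longleftrightarrow> block_of \<pi> j = block_of \<pi> k" if "j \<in> V" for j
        using inj_on_eq_iff[OF \<pi>g(4) mem(1)[OF that] mem(1)[OF k]] that k by (simp add: \<rho>_def)
      moreover have "j \<in> V" if "j \<in> block_of \<pi> k" for j
        using partition_onD1[OF \<pi>g(2)] mem(1)[OF k] that by blast
      ultimately show ?thesis using mem k block_of_eq[OF \<pi>g(2) mem(1)[OF k]] by blast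
    qed
    have "ker \<rho> = \<pi>"
    proof
      show "ker \<rho> \<subseteq> \<pi>" using fib mem(1) unfolding ker_def by auto
      show "\<pi> \<subseteq> ker \<rho>"
      proof
        fix W assume W: "W \<in> \<pi>"
        then obtain k where k: "k \<in> W" using partition_onD3[OF \<pi>g(2)] by (metis all_not_in_conv)
        then have "k \<in> V" using partition_onD1[OF \<pi>g(2)] W by blast
        then show "W \<in> ker \<rho>" using fib[of k] block_of_eq[OF \<pi>g(2) W k] unfolding ker_def by auto
      qed
    qed
    moreover have "ind \<rho> = g"
    proof (rule PiE_ext[OF _ \<pi>g(3)])
      have val: "ind \<rho> W = g W" if W: "W \<in> \<pi>" for W
      proof -
        obtain k where k: "k \<in> W" using partition_onD3[OF \<pi>g(2)] W by (metis all_not_in_conv)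
        then have "k \<in> V" using partition_onD1[OF \<pi>g(2)] W by blast
        then show ?thesis
          using ind[of k \<rho>] fib[of k] block_of_eq[OF \<pi>g(2) W k] by (simp add: \<rho>_def)
      qed
      then show "ind \<rho> W = g W" if "W \<in> \<pi>" for W using that .
      show "ind \<rho> \<in> \<pi> \<rightarrow>\<^sub>E J"
        using val \<pi>g(3) \<open>ker \<rho> = \<pi>\<close> by (intro PiE_I) (auto simp: ind_def)
    qed
    ultimately show "(case \<pi>g of (\<pi>, g) \<Rightarrow> \<lambda>k\<in>V. g (block_of \<pi> k)) \<in> V \<rightarrow>\<^sub>E J"
      "(ker (case \<pi>g of (\<pi>, g) \<Rightarrow> \<lambda>k\<in>V. g (block_of \<pi> k)), ind (case \<pi>g of (\<pi>, g) \<Rightarrow> \<lambda>k\<in>V. g (block_of \<pi> k))) = \<pi>g"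
      using \<pi>g mem by (auto simp: \<rho>_def)
  qed
  also have "\<dots> = (\<Sum>\<pi>\<in>?P. \<Sum>g\<in>?G \<pi>. h (\<lambda>k\<in>V. g (block_of \<pi> k)))"
    using finP finG by (intro sum.Sigma[symmetric]) auto
  finally show ?thesis .
qed

lemma card_inj_PiE:
  assumes "finite S" "finite J"
  shows "card {g \<in> S \<rightarrow>\<^sub>E J. inj_on g S} = (\<Prod>i<card S. card J - i)"
  using assms(1)
proof (induction S rule: finite_induct)
  case empty
  show ?case by simp
next
  case (insert s S)
  let ?G = "\<lambda>S. {g \<in> S \<rightarrow>\<^sub>E J. inj_on g S}"
  let ?c = "\<lambda>(g, y). g(s := y)"
  have "bij_betw ?c (SIGMA g:?G S. J - g ` S) (?G (insert s S))"
    unfolding bij_betw_def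
  proof
    show "inj_on ?c (SIGMA g:?G S. J - g ` S)"
    proof (rule inj_onI, clarify)
      fix g y g' y'
      assume "g \<in> S \<rightarrow>\<^sub>E J" "y \<in> J" "g' \<in> S \<rightarrow>\<^sub>E J" "y' \<in> J" "g(s := y) = g'(s := y')"
      then show "g = g' \<and> y = y'"
        using inj_onD[OF inj_combinator[OF insert.hyps(2), of "\<lambda>_. J"], of "(y, g)" "(y', g')"] by simp
    qed
    show "?c ` (SIGMA g:?G S. J - g ` S) = ?G (insert s S)"
    proof
      show "?c ` (SIGMA g:?G S. J - g ` S) \<subseteq> ?G (insert s S)"
      proof clarify
        fix g y assume g: "g \<in> S \<rightarrow>\<^sub>E J" "inj_on g S" "y \<in> J" "y \<notin> g ` S"
        have "(g(s := y)) ` S = g ` S" "insert s S - {s} = S" using insert.hyps(2) by auto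
        then have "inj_on (g(s := y)) (insert s S)"
          using g(4) inj_on_fun_updI[OF g(2,4), of s] by (simp add: inj_on_insert)
        then show "g(s := y) \<in> insert s S \<rightarrow>\<^sub>E J \<and> inj_on (g(s := y)) (insert s S)"
          using PiE_fun_upd[of y "\<lambda>_. J" s g S] g(3) g(1) by simp
      qed
      show "?G (insert s S) \<subseteq> ?c ` (SIGMA g:?G S. J - g ` S)"
      proof
        fix g assume g: "g \<in> ?G (insert s S)"
        then have "g \<in> (\<lambda>(y, g). g(s := y)) ` (J \<times> (S \<rightarrow>\<^sub>E J))" by (simp add: PiE_insert_eq)
        then obtain z where z: "g = (\<lambda>(y, g). g(s := y)) z" "z \<in> J \<times> (S \<rightarrow>\<^sub>E J)" by (rule imageE)
        obtain y g' where "z = (y, g')" by (cases z)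
        with z have yg: "y \<in> J" "g' \<in> S \<rightarrow>\<^sub>E J" "g = g'(s := y)" by simp_all
        have eq: "g j = g' j" if "j \<in> S" for j using yg(3) insert.hyps(2) that by auto
        have g_inj: "inj_on g S" "g s \<notin> g ` (S - {s})" using g by simp_all
        have "inj_on g' S" using g_inj(1) inj_on_cong[of S g g'] eq by blast
        moreover have "y \<notin> g' ` S"
          using g_inj(2) insert.hyps(2) eq yg(3) by (auto simp: image_iff)
        ultimately show "g \<in> ?c ` (SIGMA g:?G S. J - g ` S)"
          using yg by (intro image_eqI[of _ _ "(g', y)"]) simp_all
      qed
    qed
  qed
  then have "card (?G (insert s S)) = card (SIGMA g:?G S. J - g ` S)"
    by (rule bij_betw_same_card[symmetric])
  also have "\<dots> = (\<Sum>g\<in>?G S. card (J - g ` S))"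
  proof (rule card_SigmaI)
    show "finite (?G S)"
      using finite_PiE[OF insert.hyps(1), of "\<lambda>_. J"] assms(2) by simp
  qed (use assms(2) in simp)
  also have "\<dots> = (\<Sum>g\<in>?G S. card J - card S)"
  proof (intro sum.cong refl)
    fix g assume "g \<in> ?G S"
    then have "g ` S \<subseteq> J" "card (g ` S) = card S" by (auto simp: card_image)
    then show "card (J - g ` S) = card J - card S"
      using insert.hyps by (simp add: card_Diff_subset)
  qed
  also have "\<dots> = (\<Prod>i<card (insert s S). card J - i)"
    using insert by simp
  finally show ?case .
qed

lemma card_inj_PiE_asymptotics:
  assumes S: "finite S" and N: "filterlim N at_top sequentially"
  shows "(\<lambda>k. of_nat (card {g \<in> S \<rightarrow>\<^sub>E {1..N k}. inj_on g S}) / of_nat (N k) ^ card S :: complex) \<longlonglongrightarrow> 1"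
proof -
  have "(\<lambda>k. \<Prod>i<card S. 1 - of_nat i / of_nat (N k) :: complex) \<longlonglongrightarrow> (\<Prod>i<card S. 1 - 0)"
  proof (intro tendsto_prod tendsto_diff tendsto_const)
    fix i
    have "(\<lambda>k. of_nat i * inverse (of_nat (N k)) :: complex) \<longlonglongrightarrow> of_nat i * 0"
      by (intro tendsto_mult tendsto_const filterlim_compose[OF tendsto_inverse_0 filterlim_compose[OF tendsto_of_nat N]])
    then show "(\<lambda>k. of_nat i / of_nat (N k) :: complex) \<longlonglongrightarrow> 0" by (simp add: divide_inverse)
  qed
  moreover have "\<forall>\<^sub>F k in sequentially. (\<Prod>i<card S. 1 - of_nat i / of_nat (N k) :: complex)
      = of_nat (card {g \<in> S \<rightarrow>\<^sub>E {1..N k}. inj_on g S}) / of_nat (N k) ^ card S"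
    using N[unfolded filterlim_at_top, rule_format, of "Suc (card S)"]
  proof eventually_elim
    case (elim k)
    have "(\<Prod>i<card S. 1 - of_nat i / of_nat (N k) :: complex) = (\<Prod>i<card S. of_nat (N k - i) / of_nat (N k))"
      using elim by (intro prod.cong refl) (simp add: of_nat_diff field_simps)
    also have "\<dots> = of_nat (\<Prod>i<card S. N k - i) / of_nat (N k) ^ card S"
      by (simp add: prod_dividef)
    finally show ?case using card_inj_PiE[OF S, of "{1..N k}"] by simp
  qed
  ultimately show ?thesis by (auto intro: Lim_transform_eventually)
qed

section \<open>The free limit theorem\<close>

text \<open>The word on the positions \<open>V\<close> in which position \<open>k\<close> carries the index \<open>i k\<close> and is coloured by
  its block in \<open>\<pi>\<close>.\<close>

definition partition_word :: "nat set \<Rightarrow> nat set set \<Rightarrow> (nat \<Rightarrow> 'i) \<Rightarrow> (nat set, 'i) letter list" where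
  "partition_word V \<pi> i = map (\<lambda>k. (block_of \<pi> k, [i k], False)) (sorted_list_of_set V)"

lemma crossing_word_blocks:
  assumes V: "finite V" and p: "partition_on V \<pi>"
  shows "crossing_word (map (block_of \<pi>) (sorted_list_of_set V)) \<longleftrightarrow> \<not> noncrossing \<pi>"
proof
  let ?s = "sorted_list_of_set V"
  assume "crossing_word (map (block_of \<pi>) ?s)"
  then obtain X Y S where XY: "X \<noteq> Y" "[X, Y, X, Y] = map (block_of \<pi>) (nths ?s S)"
    unfolding crossing_word_def subseq_conv_nths nths_map by metis
  then obtain a b c d where abcd: "nths ?s S = [a, b, c, d]"
      "X = block_of \<pi> a" "Y = block_of \<pi> b" "X = block_of \<pi> c" "Y = block_of \<pi> d"
    by (auto simp: Cons_eq_map_conv)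
  have "sorted (nths ?s S)" "distinct (nths ?s S)" by (simp_all add: sorted_nths)
  then have o: "a < b" "b < c" "c < d" unfolding abcd(1) by auto
  have "set (nths ?s S) \<subseteq> V" using set_nths_subset[of ?s S] V by simp
  then have "a \<in> V" "b \<in> V" "c \<in> V" "d \<in> V" unfolding abcd(1) by auto
  then have "X \<in> \<pi>" "Y \<in> \<pi>" "a \<in> X" "c \<in> X" "b \<in> Y" "d \<in> Y"
    using block_of_mem[OF p] abcd by metis+
  then show "\<not> noncrossing \<pi>" using noncrossingD[of \<pi> X Y, OF _ _ _ o] XY(1) by blast
next
  let ?s = "sorted_list_of_set V"
  assume "\<not> noncrossing \<pi>"
  then obtain X Y where XY: "X \<in> \<pi>" "Y \<in> \<pi>" "X \<noteq> Y" "crosses X Y"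
    unfolding noncrossing_def by blast
  then obtain a b c d where o: "a < b" "b < c" "c < d" and i: "a \<in> X" "c \<in> X" "b \<in> Y" "d \<in> Y"
    unfolding crosses_def by metis
  have "subseq [a, b, c, d] ?s"
  proof (rule sorted_subset_imp_subseq)
    show "set [a, b, c, d] \<subseteq> set ?s"
      using i XY(1,2) partition_on_block_subset[OF p] V by auto
  qed (use o in auto)
  then have "subseq (map (block_of \<pi>) [a, b, c, d]) (map (block_of \<pi>) ?s)" by (rule subseq_map)
  moreover have "map (block_of \<pi>) [a, b, c, d] = [X, Y, X, Y]"
    using block_of_eq[OF p XY(1)] block_of_eq[OF p XY(2)] i by simp
  ultimately show "crossing_word (map (block_of \<pi>) ?s)"
    using XY(3) unfolding crossing_word_def by metis
qed

lemma leading_coeff_partition_word: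
  assumes V: "finite V" and p: "partition_on V \<pi>"
  shows "set (colours (partition_word V \<pi> i)) = \<pi>"
    and "leading_coeff L (partition_word V \<pi> i)
      = (if noncrossing \<pi> then \<Prod>W\<in>\<pi>. L (map i (sorted_list_of_set W)) else 0)"
proof -
  let ?s = "sorted_list_of_set V" and ?w = "partition_word V \<pi> i"
  have col: "colours ?w = map (block_of \<pi>) ?s"
    by (simp add: colours_def partition_word_def)
  have "block_of \<pi> ` V = \<pi>"
  proof
    show "block_of \<pi> ` V \<subseteq> \<pi>" using block_of_mem[OF p] by blast
    show "\<pi> \<subseteq> block_of \<pi> ` V"
    proof
      fix W assume W: "W \<in> \<pi>"
      then obtain k where "k \<in> W" using partition_on_block_nonempty[OF p W] by blast
      then show "W \<in> block_of \<pi> ` V"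
        using block_of_eq[OF p W] partition_on_block_subset[OF p W] by blast
    qed
  qed
  then show set: "set (colours ?w) = \<pi>" using V by (simp add: col)
  have "block_word W ?w = map i (sorted_list_of_set W)" if W: "W \<in> \<pi>" for W
  proof -
    have "filter (\<lambda>k. block_of \<pi> k = W) ?s = sorted_list_of_set W"
    proof (rule sorted_distinct_set_unique)
      have "finite W" using partition_on_block_subset[OF p W] V by (rule finite_subset)
      moreover have "{k \<in> V. block_of \<pi> k = W} = W"
        using block_of_eq[OF p W] block_of_mem[OF p] partition_on_block_subset[OF p W] by blast
      ultimately show "set (filter (\<lambda>k. block_of \<pi> k = W) ?s) = set (sorted_list_of_set W)"
        using V by simp
    qed (simp_all add: sorted_wrt_filter)
    then show ?thesis
      by (simp add: block_word_def partition_word_def filter_map o_def)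
  qed
  moreover have cross: "crossing_word (colours ?w) \<longleftrightarrow> \<not> noncrossing \<pi>"
    unfolding col by (rule crossing_word_blocks[OF V p])
  moreover have "\<not> isolated_centred ?w"
    by (auto simp: isolated_centred_def partition_word_def)
  ultimately show "leading_coeff L ?w
      = (if noncrossing \<pi> then \<Prod>W\<in>\<pi>. L (map i (sorted_list_of_set W)) else 0)"
    unfolding leading_coeff_def set cross by simp
qed

text \<open>Row \<open>k\<close> of the array consists of the families \<open>a k 1, \<dots>, a k (N k)\<close>, which are free with
  respect to the subalgebras \<open>B k r\<close> and have expectations of order \<open>1 / N k\<close>.\<close>

locale free_array =
  fixes A :: "nat \<Rightarrow> 'a cstar" and \<phi> :: "nat \<Rightarrow> 'a \<Rightarrow> complex" and N :: "nat \<Rightarrow> nat"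
    and a :: "nat \<Rightarrow> nat \<Rightarrow> 'i \<Rightarrow> 'a" and B :: "nat \<Rightarrow> nat \<Rightarrow> 'a set" and L :: "'i list \<Rightarrow> complex"
  assumes space: "cstar_prob_space (A k) (\<phi> k)"
    and N_at_top: "filterlim N at_top sequentially"
    and closed: "r \<in> {1..N k} \<Longrightarrow> a k r i \<in> carrier (A k)"
    and free: "free_subalgebras (A k) (\<phi> k) {1..N k} (B k)"
    and in_B: "r \<in> {1..N k} \<Longrightarrow> letter_value (A k) (\<phi> k) (a k) (r, u, True) \<in> B k r"
    and ident: "r \<in> {1..N k} \<Longrightarrow> \<phi> k (lprod (A k) (map (a k r) u)) = \<phi> k (lprod (A k) (map (a k 1) u))"
    and lim: "u \<noteq> [] \<Longrightarrow> (\<lambda>k. of_nat (N k) * \<phi> k (lprod (A k) (map (a k 1) u))) \<longlonglongrightarrow> L u"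
begin

lemma shift: "free_array (\<lambda>k. A (k + m)) (\<lambda>k. \<phi> (k + m)) (\<lambda>k. N (k + m)) (\<lambda>k. a (k + m)) (\<lambda>k. B (k + m)) L"
proof (rule free_array.intro)
  show "filterlim (\<lambda>k. N (k + m)) sequentially sequentially"
    using filterlim_compose[OF N_at_top filterlim_add_const_nat_at_top] .
  show "(\<lambda>k. of_nat (N (k + m)) * \<phi> (k + m) (lprod (A (k + m)) (map (a (k + m) 1) u))) \<longlonglongrightarrow> L u"
    if "u \<noteq> []" for u
    using LIMSEQ_ignore_initial_segment[OF lim[OF that], of m] .
qed (rule space | rule free | erule closed | erule in_B | erule ident)+

text \<open>The choice \<open>g k\<close> of rows for the blocks may change with \<open>k\<close> in any way. This freedom
  replaces an estimate that is uniform in the choice.\<close>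

lemma coloured_word_limit:
  assumes V: "finite V" and p: "partition_on V \<pi>"
    and g: "\<And>k. g k ` \<pi> \<subseteq> {1..N k}" "\<And>k. inj_on (g k) \<pi>"
  shows "(\<lambda>k. of_nat (N k) ^ card \<pi> *
      \<phi> k (lprod (A k) (map (\<lambda>j. a k (g k (block_of \<pi> j)) (i j)) (sorted_list_of_set V))))
    \<longlonglongrightarrow> (if noncrossing \<pi> then \<Prod>W\<in>\<pi>. L (map i (sorted_list_of_set W)) else 0)"
proof (cases "\<pi> = {}")
  case True
  then have "V = {}" using p by (simp add: partition_on_def)
  moreover have "\<phi> k (lprod (A k) []) = 1" for k
  proof -
    interpret cstar_prob_space "A k" "\<phi> k" by (rule space)
    show ?thesis by (simp add: state_one)
  qed
  ultimately show ?thesis using True by (simp add: noncrossing_def)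
next
  case False
  then obtain W0 where W0: "W0 \<in> \<pi>" by blast
  \<comment> \<open>Colours outside \<open>\<pi>\<close> never occur; they get the value of some block to stay inside the algebra.\<close>
  define b where "b k c = a k (g k (if c \<in> \<pi> then c else W0))" for k c
  have bcl: "b k c j \<in> carrier (A k)" for k c j
    using g(1)[of k] W0 by (auto simp: b_def intro!: closed)
  let ?E = "\<lambda>k. word_moment (A k) (\<phi> k) (b k)"
  have "(\<lambda>k. of_nat (N k) ^ card (set (colours (partition_word V \<pi> i))) * ?E k (partition_word V \<pi> i))
      \<longlonglongrightarrow> leading_coeff L (partition_word V \<pi> i)"
  proof (rule free_word_asymptotics[OF N_at_top, where C = \<pi> and t = "\<lambda>k c u. \<phi> k (lprod (A k) (map (b k c) u))"])
    fix c and u :: "'i list" assume c: "c \<in> \<pi>" and u: "u \<noteq> []"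
    have "\<phi> k (lprod (A k) (map (b k c) u)) = \<phi> k (lprod (A k) (map (a k 1) u))" for k
      using ident[of "g k c" k u] g(1)[of k] c by (auto simp: b_def)
    then show "(\<lambda>k. of_nat (N k) * \<phi> k (lprod (A k) (map (b k c) u))) \<longlonglongrightarrow> L u"
      using lim[OF u] by simp
  next
    fix k
    interpret cstar_prob_space "A k" "\<phi> k" by (rule space)
    show "?E k [] = 1" by (simp add: word_moment_def state_one)
    show "?E k (p @ (c, u, False) # q) = ?E k (p @ (c, u, True) # q)
        + \<phi> k (lprod (A k) (map (b k c) u)) * ?E k (p @ q)" for p c u q
      by (rule word_moment_centre) (rule bcl)
    show "?E k (p @ (c, u, False) # (c, v, False) # q) = ?E k (p @ (c, u @ v, False) # q)" for p c u v q
      by (rule word_moment_merge) (rule bcl)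
    fix w :: "(nat set, 'i) letter list"
    assume w: "w \<noteq> []" "fst ` set w \<subseteq> \<pi>" "distinct_adj (colours w)" "\<forall>(c, u, f)\<in>set w. f"
    show "?E k w = 0"
    proof (rule word_moment_free[OF free bcl _ g(2) g(1) w])
      fix c u assume c: "c \<in> \<pi>"
      then have "g k c \<in> {1..N k}" using g(1) by blast
      from in_B[OF this, of u] show "letter_value (A k) (\<phi> k) (b k) (c, u, True) \<in> B k (g k c)"
        using c by (simp add: letter_value_def b_def)
    qed
  next
    show "fst ` set (partition_word V \<pi> i) \<subseteq> \<pi>"
      using leading_coeff_partition_word(1)[OF V p, of i] by (simp add: colours_def)
    show "\<forall>(c, u, f)\<in>set (partition_word V \<pi> i). u \<noteq> []"
      by (auto simp: partition_word_def)
  qed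
  moreover have "?E k (partition_word V \<pi> i)
      = \<phi> k (lprod (A k) (map (\<lambda>j. a k (g k (block_of \<pi> j)) (i j)) (sorted_list_of_set V)))" for k
  proof -
    interpret cstar_prob_space "A k" "\<phi> k" by (rule space)
    have "letter_value (A k) (\<phi> k) (b k) (block_of \<pi> j, [i j], False) = a k (g k (block_of \<pi> j)) (i j)"
      if "j \<in> V" for j
      using block_of_mem[OF p that] bcl[of k "block_of \<pi> j" "i j"]
      by (simp add: letter_value_def b_def)
    then have "map (letter_value (A k) (\<phi> k) (b k)) (partition_word V \<pi> i)
        = map (\<lambda>j. a k (g k (block_of \<pi> j)) (i j)) (sorted_list_of_set V)"
      using V by (simp add: partition_word_def)
    then show ?thesis by (simp add: word_moment_def)
  qed
  ultimately show ?thesis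
    unfolding leading_coeff_partition_word[OF V p] by simp
qed

text \<open>All injections have nearly the same expectation: for each \<open>k\<close> take one with the largest error and
  apply the previous limit to it.\<close>

lemma sum_injections_limit_aux:
  assumes V: "finite V" and p: "partition_on V \<pi>" and big: "\<And>k. card \<pi> \<le> N k"
  shows "(\<lambda>k. \<Sum>g\<in>{g \<in> \<pi> \<rightarrow>\<^sub>E {1..N k}. inj_on g \<pi>}.
      \<phi> k (lprod (A k) (map (\<lambda>j. a k (g (block_of \<pi> j)) (i j)) (sorted_list_of_set V))))
    \<longlonglongrightarrow> (if noncrossing \<pi> then \<Prod>W\<in>\<pi>. L (map i (sorted_list_of_set W)) else 0)"
    (is "_ \<longlonglongrightarrow> ?F")
proof -
  let ?G = "\<lambda>k. {g \<in> \<pi> \<rightarrow>\<^sub>E {1..N k}. inj_on g \<pi>}"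
  define f where "f k g = \<phi> k (lprod (A k) (map (\<lambda>j. a k (g (block_of \<pi> j)) (i j)) (sorted_list_of_set V)))" for k g
  define e where "e k g = cmod (of_nat (N k) ^ card \<pi> * f k g - ?F)" for k g
  define c :: "nat \<Rightarrow> complex" where "c k = of_nat (card (?G k)) / of_nat (N k) ^ card \<pi>" for k
  have fin\<pi>: "finite \<pi>" using finite_elements[OF V p] .
  have finG: "finite (?G k)" for k
    using finite_PiE[OF fin\<pi>, of "\<lambda>_. {1..N k}"] by simp
  have neG: "?G k \<noteq> {}" for k
  proof -
    obtain g where "inj_on g \<pi>" "g ` \<pi> \<subseteq> {1..N k}"
      using card_le_inj[OF fin\<pi>, of "{1..N k}"] big[of k] by auto
    then have "restrict g \<pi> \<in> ?G k" by (auto simp: inj_on_def)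
    then show ?thesis by blast
  qed
  have "\<exists>g. \<forall>k. g k \<in> ?G k \<and> (\<forall>h\<in>?G k. e k h \<le> e k (g k))"
  proof (rule choice, rule allI)
    fix k
    have "Max (e k ` ?G k) \<in> e k ` ?G k" using finG neG by (intro Max_in) auto
    then obtain g where g: "Max (e k ` ?G k) = e k g" "g \<in> ?G k" by (rule imageE)
    have "\<forall>h\<in>?G k. e k h \<le> e k g"
      using finG[of k] unfolding g(1)[symmetric] by (intro ballI Max_ge finite_imageI imageI)
    with g(2) show "\<exists>g. g \<in> ?G k \<and> (\<forall>h\<in>?G k. e k h \<le> e k g)"
      by (intro exI[of _ g] conjI)
  qed
  then obtain g where gw: "\<forall>k. g k \<in> ?G k \<and> (\<forall>h\<in>?G k. e k h \<le> e k (g k))" by (rule exE)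
  have g: "g k \<in> ?G k" for k
    by (rule conjunct1[OF spec[OF gw]])
  have worst: "e k h \<le> e k (g k)" if "h \<in> ?G k" for k h
    by (rule bspec[OF conjunct2[OF spec[OF gw]] that])
  have "(\<lambda>k. of_nat (N k) ^ card \<pi> * f k (g k)) \<longlonglongrightarrow> ?F"
    unfolding f_def using g by (intro coloured_word_limit[OF V p]) (auto simp: PiE_def Pi_def)
  then have e0: "(\<lambda>k. e k (g k)) \<longlonglongrightarrow> 0"
    unfolding e_def using tendsto_norm_zero LIM_zero by blast
  have c1: "c \<longlonglongrightarrow> 1"
    unfolding c_def by (rule card_inj_PiE_asymptotics[OF fin\<pi> N_at_top])
  have "(\<lambda>k. (\<Sum>h\<in>?G k. f k h) - c k * ?F) \<longlonglongrightarrow> 0"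
  proof (rule tendsto_0_le[where K = 1])
    have "(\<lambda>k. cmod (c k) * e k (g k)) \<longlonglongrightarrow> cmod 1 * 0"
      by (intro tendsto_mult tendsto_norm c1 e0)
    then show "(\<lambda>k. cmod (c k) * e k (g k)) \<longlonglongrightarrow> 0" by simp
    show "\<forall>\<^sub>F k in sequentially. cmod ((\<Sum>h\<in>?G k. f k h) - c k * ?F) \<le> norm (cmod (c k) * e k (g k)) * 1"
      using N_at_top[unfolded filterlim_at_top, rule_format, of 1]
    proof eventually_elim
      case (elim k)
      define M :: complex where "M = of_nat (N k) ^ card \<pi>"
      have M: "M \<noteq> 0" using elim by (simp add: M_def)
      have "(\<Sum>h\<in>?G k. f k h) - c k * ?F = (\<Sum>h\<in>?G k. (M * f k h - ?F) / M)"
      proof -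
        have "(\<Sum>h\<in>?G k. (M * f k h - ?F) / M) = (\<Sum>h\<in>?G k. f k h - ?F / M)"
          using M by (simp add: diff_divide_distrib)
        also have "\<dots> = (\<Sum>h\<in>?G k. f k h) - of_nat (card (?G k)) * (?F / M)"
          by (simp only: sum_subtractf sum_constant)
        finally show ?thesis by (simp add: c_def M_def)
      qed
      also have "cmod \<dots> \<le> (\<Sum>h\<in>?G k. e k h / cmod M)"
        by (rule order_trans[OF norm_sum]) (simp add: e_def M_def norm_divide)
      also have "\<dots> \<le> (\<Sum>h\<in>?G k. e k (g k) / cmod M)"
        by (intro sum_mono divide_right_mono worst) auto
      also have "\<dots> = norm (cmod (c k) * e k (g k)) * 1"
        by (simp add: c_def M_def norm_divide e_def)
      finally show ?case .
    qed
  qed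
  moreover have "(\<lambda>k. c k * ?F) \<longlonglongrightarrow> 1 * ?F"
    by (intro tendsto_mult c1 tendsto_const)
  ultimately have "(\<lambda>k. ((\<Sum>h\<in>?G k. f k h) - c k * ?F) + c k * ?F) \<longlonglongrightarrow> 0 + 1 * ?F"
    by (rule tendsto_add)
  then show ?thesis unfolding f_def by simp
qed

end

text \<open>For small \<open>k\<close> there may be fewer than \<open>card \<pi>\<close> rows and no injection at all; these \<open>k\<close> are cut
  off.\<close>

lemma (in free_array) sum_injections_limit:
  assumes V: "finite V" and p: "partition_on V \<pi>"
  shows "(\<lambda>k. \<Sum>g\<in>{g \<in> \<pi> \<rightarrow>\<^sub>E {1..N k}. inj_on g \<pi>}.
      \<phi> k (lprod (A k) (map (\<lambda>j. a k (g (block_of \<pi> j)) (i j)) (sorted_list_of_set V))))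
    \<longlonglongrightarrow> (if noncrossing \<pi> then \<Prod>W\<in>\<pi>. L (map i (sorted_list_of_set W)) else 0)"
proof -
  obtain m where m: "\<And>k. k \<ge> m \<Longrightarrow> card \<pi> \<le> N k"
    using N_at_top[unfolded filterlim_at_top, rule_format, of "card \<pi>"]
    unfolding eventually_sequentially by blast
  interpret s: free_array "\<lambda>k. A (k + m)" "\<lambda>k. \<phi> (k + m)" "\<lambda>k. N (k + m)" "\<lambda>k. a (k + m)" "\<lambda>k. B (k + m)" L
    by (rule shift)
  have "card \<pi> \<le> N (k + m)" for k by (rule m) simp
  then show ?thesis
    by (rule LIMSEQ_offset[where k = m, OF s.sum_injections_limit_aux[OF V p]])
qed

text \<open>Grouping the terms of an expanded product of row sums by the pattern of equal rows, only the
  non-crossing patterns survive in the limit.\<close>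

theorem (in free_array) free_limit:
  assumes V: "finite V"
  shows "(\<lambda>k. \<phi> k (lprod (A k) (map (\<lambda>j. \<Oplus>\<^bsub>A k\<^esub>r\<in>{1..N k}. a k r (i j)) (sorted_list_of_set V))))
    \<longlonglongrightarrow> (\<Sum>\<pi>\<in>NC_on V. \<Prod>W\<in>\<pi>. L (map i (sorted_list_of_set W)))"
proof -
  let ?s = "sorted_list_of_set V" and ?P = "{\<pi>. partition_on V \<pi>}"
  let ?h = "\<lambda>k \<pi> g. \<phi> k (lprod (A k) (map (\<lambda>j. a k (g (block_of \<pi> j)) (i j)) ?s))"
  have finP: "finite ?P" using finitely_many_partition_on[OF V] .
  have "\<phi> k (lprod (A k) (map (\<lambda>j. \<Oplus>\<^bsub>A k\<^esub>r\<in>{1..N k}. a k r (i j)) ?s))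
      = (\<Sum>\<pi>\<in>?P. \<Sum>g\<in>{g \<in> \<pi> \<rightarrow>\<^sub>E {1..N k}. inj_on g \<pi>}. ?h k \<pi> g)" for k
  proof -
    interpret cstar_prob_space "A k" "\<phi> k" by (rule space)
    have cl: "lprod (A k) (map (\<lambda>j. a k (\<rho> j) (i j)) ?s) \<in> carrier (A k)" if "\<rho> \<in> V \<rightarrow>\<^sub>E {1..N k}" for \<rho>
      using that V by (intro lprod_map_closed closed) auto
    have clS: "lprod (A k) (map (\<lambda>j. \<Oplus>\<^bsub>A k\<^esub>r\<in>{1..N k}. a k r (i j)) ?s) \<in> carrier (A k)"
      by (intro lprod_map_closed alg_finsum_closed) (auto intro: closed)
    have "\<phi> k (lprod (A k) (map (\<lambda>j. \<Oplus>\<^bsub>A k\<^esub>r\<in>{1..N k}. a k r (i j)) ?s))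
        = \<phi> k (\<one>\<^bsub>A k\<^esub> \<otimes>\<^bsub>A k\<^esub> lprod (A k) (map (\<lambda>j. \<Oplus>\<^bsub>A k\<^esub>r\<in>{1..N k}. a k r (i j)) ?s))"
      using clS by simp
    also have "\<dots> = (\<Sum>\<rho>\<in>V \<rightarrow>\<^sub>E {1..N k}. \<phi> k (\<one>\<^bsub>A k\<^esub> \<otimes>\<^bsub>A k\<^esub> lprod (A k) (map (\<lambda>j. a k (\<rho> j) (i j)) ?s)))"
      using state_lprod_finsum[of "{1..N k}" ?s "\<one>\<^bsub>A k\<^esub>" "\<lambda>r j. a k r (i j)"] V closed by simp
    also have "\<dots> = (\<Sum>\<rho>\<in>V \<rightarrow>\<^sub>E {1..N k}. \<phi> k (lprod (A k) (map (\<lambda>j. a k (\<rho> j) (i j)) ?s)))"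
      using cl by (intro sum.cong) auto
    also have "\<dots> = (\<Sum>\<pi>\<in>?P. \<Sum>g\<in>{g \<in> \<pi> \<rightarrow>\<^sub>E {1..N k}. inj_on g \<pi>}.
        \<phi> k (lprod (A k) (map (\<lambda>j. a k ((\<lambda>j\<in>V. g (block_of \<pi> j)) j) (i j)) ?s)))"
      by (rule sum_PiE_fibres[OF V]) simp
    also have "\<dots> = (\<Sum>\<pi>\<in>?P. \<Sum>g\<in>{g \<in> \<pi> \<rightarrow>\<^sub>E {1..N k}. inj_on g \<pi>}. ?h k \<pi> g)"
      using V by (intro sum.cong refl arg_cong[of _ _ "\<phi> k"] arg_cong[of _ _ "lprod (A k)"] map_cong) auto
    finally show ?thesis .
  qed
  moreover have "(\<lambda>k. \<Sum>\<pi>\<in>?P. \<Sum>g\<in>{g \<in> \<pi> \<rightarrow>\<^sub>E {1..N k}. inj_on g \<pi>}. ?h k \<pi> g)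
    \<longlonglongrightarrow> (\<Sum>\<pi>\<in>?P. if noncrossing \<pi> then \<Prod>W\<in>\<pi>. L (map i (sorted_list_of_set W)) else 0)"
    using sum_injections_limit[OF V] by (intro tendsto_sum) auto
  moreover have "(\<Sum>\<pi>\<in>?P. if noncrossing \<pi> then \<Prod>W\<in>\<pi>. L (map i (sorted_list_of_set W)) else 0)
      = (\<Sum>\<pi>\<in>NC_on V. \<Prod>W\<in>\<pi>. L (map i (sorted_list_of_set W)))"
    using finP by (simp add: NC_on_def sum.inter_filter[symmetric])
  ultimately show ?thesis by simp
qed

section \<open>The C*-algebra of bounded operators on square-summable sequences\<close>

lemma Cauchy_Schwarz_of_form:
  fixes a d :: real and b :: complex
  assumes pos: "\<And>c. 0 \<le> a + 2 * Re (c * b) + (cmod c)\<^sup>2 * d" and d: "0 \<le> d"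
  shows "(cmod b)\<^sup>2 \<le> a * d"
proof -
  \<comment> \<open>The form is smallest in the directions \<open>c = t \<cdot> cnj b\<close> with real \<open>t\<close>.\<close>
  have real: "0 \<le> a + 2 * t * (cmod b)\<^sup>2 + t\<^sup>2 * (cmod b)\<^sup>2 * d" for t :: real
  proof -
    have 1: "Re (of_real t * cnj b * b) = t * (cmod b)\<^sup>2"
      unfolding cmod_power2 by (simp add: power2_eq_square algebra_simps)
    have 2: "(cmod (of_real t * cnj b))\<^sup>2 = t\<^sup>2 * (cmod b)\<^sup>2"
      by (simp add: norm_mult power_mult_distrib)
    show ?thesis using pos[of "of_real t * cnj b"] unfolding 1 2 by (simp add: mult.assoc)
  qed
  show ?thesis
  proof (cases "d = 0")
    case True
    have "(cmod b)\<^sup>2 = 0"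
    proof (rule ccontr)
      assume nz: "(cmod b)\<^sup>2 \<noteq> 0"
      have "a + 2 * (- (a + 1) / (2 * (cmod b)\<^sup>2)) * (cmod b)\<^sup>2 = - 1"
        using nz by (simp add: field_simps)
      then show False using real[of "- (a + 1) / (2 * (cmod b)\<^sup>2)"] True by simp
    qed
    then show ?thesis using True by simp
  next
    case False
    then have dp: "d > 0" using d by simp
    have "a + 2 * (- 1 / d) * (cmod b)\<^sup>2 + (- 1 / d)\<^sup>2 * (cmod b)\<^sup>2 * d = a - (cmod b)\<^sup>2 / d"
      using dp by (simp add: field_simps power2_eq_square)
    then have "0 \<le> a - (cmod b)\<^sup>2 / d" using real[of "- 1 / d"] by simp
    then show ?thesis using dp by (simp add: field_simps)
  qed
qed

definition l2 :: "(nat \<Rightarrow> complex) set" where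
  "l2 = {x. summable (\<lambda>j. (cmod (x j))\<^sup>2)}"

definition ip :: "(nat \<Rightarrow> complex) \<Rightarrow> (nat \<Rightarrow> complex) \<Rightarrow> complex" where
  "ip x y = (\<Sum>j. cnj (x j) * y j)"

definition l2norm :: "(nat \<Rightarrow> complex) \<Rightarrow> real" where
  "l2norm x = sqrt (\<Sum>j. (cmod (x j))\<^sup>2)"

lemma summable_ip:
  assumes "x \<in> l2" "y \<in> l2"
  shows "summable (\<lambda>j. cnj (x j) * y j)"
proof (rule summable_comparison_test[OF _ summable_add])
  show "summable (\<lambda>j. (cmod (x j))\<^sup>2)" "summable (\<lambda>j. (cmod (y j))\<^sup>2)"
    using assms by (simp_all add: l2_def)
  have "norm (cnj (x j) * y j) \<le> (cmod (x j))\<^sup>2 + (cmod (y j))\<^sup>2" for j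
    using sum_squares_bound[of "cmod (x j)" "cmod (y j)"]
      mult_nonneg_nonneg[OF norm_ge_zero[of "x j"] norm_ge_zero[of "y j"]]
    unfolding norm_mult complex_mod_cnj by linarith
  then show "\<exists>N. \<forall>n\<ge>N. norm (cnj (x n) * y n) \<le> (cmod (x n))\<^sup>2 + (cmod (y n))\<^sup>2" by blast
qed

lemma l2_scale: "x \<in> l2 \<Longrightarrow> (\<lambda>j. c * x j) \<in> l2"
  by (simp add: l2_def norm_mult power_mult_distrib summable_mult)

lemma l2_add:
  assumes "x \<in> l2" "y \<in> l2"
  shows "(\<lambda>j. x j + y j) \<in> l2"
  unfolding l2_def mem_Collect_eq
proof (rule summable_comparison_test[OF _ summable_mult[OF summable_add]])
  show "summable (\<lambda>j. (cmod (x j))\<^sup>2)" "summable (\<lambda>j. (cmod (y j))\<^sup>2)"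
    using assms by (simp_all add: l2_def)
  have "norm ((cmod (x j + y j))\<^sup>2) \<le> 2 * ((cmod (x j))\<^sup>2 + (cmod (y j))\<^sup>2)" for j
  proof -
    have "(cmod (x j + y j))\<^sup>2 \<le> (cmod (x j) + cmod (y j))\<^sup>2"
      by (intro power_mono norm_triangle_ineq) simp
    then show ?thesis
      using sum_squares_bound[of "cmod (x j)" "cmod (y j)"] by (simp add: power2_sum)
  qed
  then show "\<exists>N. \<forall>n\<ge>N. norm ((cmod (x n + y n))\<^sup>2) \<le> 2 * ((cmod (x n))\<^sup>2 + (cmod (y n))\<^sup>2)" by blast
qed

lemma l2_zero: "(\<lambda>_. 0) \<in> l2"
  by (simp add: l2_def)

lemma l2_uminus: "x \<in> l2 \<Longrightarrow> (\<lambda>j. - x j) \<in> l2"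
  by (simp add: l2_def)

lemma l2_diff: "x \<in> l2 \<Longrightarrow> y \<in> l2 \<Longrightarrow> (\<lambda>j. x j - y j) \<in> l2"
  using l2_add[OF _ l2_uminus, of x y] by simp

lemma l2_finite_support: "finite F \<Longrightarrow> (\<And>j. j \<notin> F \<Longrightarrow> x j = 0) \<Longrightarrow> x \<in> l2"
  unfolding l2_def by (auto intro: summable_finite)

lemma ip_add_right: "x \<in> l2 \<Longrightarrow> y \<in> l2 \<Longrightarrow> z \<in> l2 \<Longrightarrow> ip x (\<lambda>j. y j + z j) = ip x y + ip x z"
  by (simp add: ip_def ring_distribs suminf_add summable_ip)

lemma ip_scale_right: "x \<in> l2 \<Longrightarrow> y \<in> l2 \<Longrightarrow> ip x (\<lambda>j. c * y j) = c * ip x y"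
  using suminf_mult[OF summable_ip, of x y c] by (simp add: ip_def algebra_simps)

lemma ip_commute: "x \<in> l2 \<Longrightarrow> y \<in> l2 \<Longrightarrow> ip y x = cnj (ip x y)"
proof -
  assume xy: "x \<in> l2" "y \<in> l2"
  have "(\<lambda>j. cnj (cnj (x j) * y j)) sums cnj (ip x y)"
    unfolding ip_def sums_cnj using summable_sums[OF summable_ip[OF xy]] .
  then show ?thesis by (simp add: ip_def sums_iff mult.commute)
qed

lemma ip_add_left: "x \<in> l2 \<Longrightarrow> y \<in> l2 \<Longrightarrow> z \<in> l2 \<Longrightarrow> ip (\<lambda>j. x j + y j) z = ip x z + ip y z"
  by (simp add: ip_commute[of z] ip_add_right l2_add)

lemma ip_scale_left: "x \<in> l2 \<Longrightarrow> y \<in> l2 \<Longrightarrow> ip (\<lambda>j. c * x j) y = cnj c * ip x y"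
  by (simp add: ip_commute[of y] ip_scale_right l2_scale)

lemma ip_diff_right: "x \<in> l2 \<Longrightarrow> y \<in> l2 \<Longrightarrow> z \<in> l2 \<Longrightarrow> ip x (\<lambda>j. y j - z j) = ip x y - ip x z"
  using ip_add_right[of x y "\<lambda>j. - 1 * z j"] ip_scale_right[of x z "- 1"] l2_scale[of z "- 1"] by simp

lemma l2norm_nonneg [simp]: "x \<in> l2 \<Longrightarrow> 0 \<le> l2norm x"
  by (simp add: l2norm_def l2_def suminf_nonneg)

lemma l2norm_power2: "x \<in> l2 \<Longrightarrow> (l2norm x)\<^sup>2 = (\<Sum>j. (cmod (x j))\<^sup>2)"
  by (simp add: l2norm_def l2_def suminf_nonneg)

lemma ip_self: "x \<in> l2 \<Longrightarrow> ip x x = of_real ((l2norm x)\<^sup>2)"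
proof -
  assume x: "x \<in> l2"
  have "(\<lambda>j. of_real ((cmod (x j))\<^sup>2) :: complex) sums of_real (\<Sum>j. (cmod (x j))\<^sup>2)"
    using x by (intro sums_of_real summable_sums) (simp add: l2_def)
  moreover have "of_real ((cmod (x j))\<^sup>2) = cnj (x j) * x j" for j
    using complex_norm_square[of "x j"] by (simp add: mult.commute)
  ultimately show ?thesis by (simp add: ip_def sums_iff l2norm_power2[OF x])
qed

lemma l2norm_eq_0: "x \<in> l2 \<Longrightarrow> l2norm x = 0 \<longleftrightarrow> x = (\<lambda>_. 0)"
proof
  assume x: "x \<in> l2" and "l2norm x = 0"
  then have "(\<Sum>j. (cmod (x j))\<^sup>2) = 0" using l2norm_power2[OF x] by simp
  then have "\<forall>j. (cmod (x j))\<^sup>2 = 0"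
    using x by (subst (asm) suminf_eq_zero_iff) (auto simp: l2_def)
  then show "x = (\<lambda>_. 0)" by auto
qed (simp add: l2norm_def)

lemma l2norm_scale: "x \<in> l2 \<Longrightarrow> l2norm (\<lambda>j. c * x j) = cmod c * l2norm x"
  by (simp add: l2norm_def l2_def norm_mult power_mult_distrib suminf_mult real_sqrt_mult)

lemma l2norm_add_power2:
  assumes "x \<in> l2" "y \<in> l2"
  shows "(l2norm (\<lambda>j. x j + y j))\<^sup>2 = (l2norm x)\<^sup>2 + 2 * Re (ip x y) + (l2norm y)\<^sup>2"
proof -
  have "of_real ((l2norm (\<lambda>j. x j + y j))\<^sup>2) = ip x x + ip x y + (cnj (ip x y) + ip y y)"
    using assms by (simp only: ip_self[symmetric] l2_add ip_add_left ip_add_right ip_commute[of x y])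
  then have "Re (of_real ((l2norm (\<lambda>j. x j + y j))\<^sup>2)) = Re (ip x x + ip x y + (cnj (ip x y) + ip y y))"
    by (rule arg_cong)
  then show ?thesis using assms by (simp add: ip_self)
qed

lemma ip_Cauchy_Schwarz:
  assumes "x \<in> l2" "y \<in> l2"
  shows "cmod (ip x y) \<le> l2norm x * l2norm y"
proof -
  have "(cmod (ip x y))\<^sup>2 \<le> (l2norm x)\<^sup>2 * (l2norm y)\<^sup>2"
  proof (rule Cauchy_Schwarz_of_form)
    fix c
    have "(l2norm x)\<^sup>2 + 2 * Re (c * ip x y) + (cmod c)\<^sup>2 * (l2norm y)\<^sup>2
        = (l2norm (\<lambda>j. x j + c * y j))\<^sup>2"
      using assms by (simp add: l2norm_add_power2 l2_scale ip_scale_right l2norm_scale power_mult_distrib)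
    then show "0 \<le> (l2norm x)\<^sup>2 + 2 * Re (c * ip x y) + (cmod c)\<^sup>2 * (l2norm y)\<^sup>2" by simp
  qed simp
  then show ?thesis
    using assms by (simp flip: power_mult_distrib)
qed

lemma l2norm_triangle:
  assumes "x \<in> l2" "y \<in> l2"
  shows "l2norm (\<lambda>j. x j + y j) \<le> l2norm x + l2norm y"
proof (rule power2_le_imp_le)
  have "Re (ip x y) \<le> l2norm x * l2norm y"
    using ip_Cauchy_Schwarz[OF assms] complex_Re_le_cmod[of "ip x y"] by linarith
  then show "(l2norm (\<lambda>j. x j + y j))\<^sup>2 \<le> (l2norm x + l2norm y)\<^sup>2"
    using assms by (simp add: l2norm_add_power2 power2_sum)
qed (use assms in simp)

lemma l2norm_diff_commute: "l2norm (\<lambda>j. x j - y j) = l2norm (\<lambda>j. y j - x j)"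
  by (simp add: l2norm_def norm_minus_commute)

lemma l2_coordinate_le: "x \<in> l2 \<Longrightarrow> cmod (x j) \<le> l2norm x"
proof (rule power2_le_imp_le)
  assume x: "x \<in> l2"
  have "sum (\<lambda>j. (cmod (x j))\<^sup>2) {j} \<le> (\<Sum>j. (cmod (x j))\<^sup>2)"
    using x by (intro sum_le_suminf) (auto simp: l2_def)
  then show "(cmod (x j))\<^sup>2 \<le> (l2norm x)\<^sup>2" by (simp add: l2norm_power2[OF x])
qed simp

lemma l2I_partial_sums:
  assumes "\<And>J. (\<Sum>j<J. (cmod (x j))\<^sup>2) \<le> c\<^sup>2" "0 \<le> c"
  shows "x \<in> l2" "l2norm x \<le> c"
proof -
  show x: "x \<in> l2"
    unfolding l2_def mem_Collect_eq by (rule summableI_nonneg_bounded[OF _ assms(1)]) simp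
  have "(l2norm x)\<^sup>2 \<le> c\<^sup>2"
    unfolding l2norm_power2[OF x] using x assms(1) by (intro suminf_le_const) (auto simp: l2_def)
  then show "l2norm x \<le> c" using assms(2) by (rule power2_le_imp_le)
qed

lemma l2_partial_sums_le:
  "x \<in> l2 \<Longrightarrow> (\<Sum>j<J. (cmod (x j))\<^sup>2) \<le> (l2norm x)\<^sup>2"
  unfolding l2norm_power2 by (rule sum_le_suminf) (auto simp: l2_def)

lemma ip_eq_imp_eq:
  assumes "x \<in> l2" "y \<in> l2" "\<And>z. z \<in> l2 \<Longrightarrow> ip z x = ip z y"
  shows "x = y"
proof -
  have d: "(\<lambda>j. x j - y j) \<in> l2" using assms(1,2) by (rule l2_diff)
  have "ip (\<lambda>j. x j - y j) (\<lambda>j. x j - y j) = 0"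
    using assms(3)[OF d] by (simp add: ip_diff_right[OF d assms(1,2)])
  then have "l2norm (\<lambda>j. x j - y j) = 0" using ip_self[OF d] by simp
  then have "x j - y j = 0" for j using l2norm_eq_0[OF d] by (auto simp: fun_eq_iff)
  then show ?thesis by auto
qed

subsection \<open>Adjointable bounded operators\<close>

text \<open>An operator is a total map on sequences that vanishes off \<open>l2\<close>, so that equality of operators
  is equality of maps. Requiring an adjoint makes linearity automatic.\<close>

definition bounded_on_l2 :: "seq_map \<Rightarrow> bool" where
  "bounded_on_l2 T \<longleftrightarrow> (\<forall>x. x \<notin> l2 \<longrightarrow> T x = (\<lambda>_. 0)) \<and> (\<forall>x\<in>l2. T x \<in> l2) \<and>
    (\<exists>C\<ge>0. \<forall>x\<in>l2. l2norm (T x) \<le> C * l2norm x)"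

definition adjoint_pair :: "seq_map \<Rightarrow> seq_map \<Rightarrow> bool" where
  "adjoint_pair T S \<longleftrightarrow> bounded_on_l2 T \<and> bounded_on_l2 S \<and> (\<forall>x\<in>l2. \<forall>y\<in>l2. ip (S y) x = ip y (T x))"

definition l2_operators :: "seq_map set" where
  "l2_operators = {T. \<exists>S. adjoint_pair T S}"

definition adj :: "seq_map \<Rightarrow> seq_map" where
  "adj T = (THE S. adjoint_pair T S)"

definition op_norm :: "seq_map \<Rightarrow> real" where
  "op_norm T = (SUP x\<in>{x \<in> l2. l2norm x \<le> 1}. l2norm (T x))"

definition B_l2 :: "seq_map cstar" where
  "B_l2 = \<lparr>carrier = l2_operators, mult = (\<lambda>S T x. S (T x)),
     one = (\<lambda>x. if x \<in> l2 then x else (\<lambda>_. 0)), zero = (\<lambda>_ _. 0),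
     add = (\<lambda>S T x j. S x j + T x j), smult = (\<lambda>c T x j. c * T x j),
     star = adj, nrm = op_norm\<rparr>"

lemma bounded_on_l2D:
  assumes "bounded_on_l2 T"
  shows "x \<notin> l2 \<Longrightarrow> T x = (\<lambda>_. 0)" and "x \<in> l2 \<Longrightarrow> T x \<in> l2" and "T x \<in> l2"
  using assms l2_zero by (auto simp: bounded_on_l2_def)

lemma adjoint_pair_sym: "adjoint_pair T S \<Longrightarrow> adjoint_pair S T"
  unfolding adjoint_pair_def
  by (metis bounded_on_l2D(2) complex_cnj_cnj ip_commute)

lemma adjoint_pair_unique:
  assumes "adjoint_pair T S" "adjoint_pair T S'"
  shows "S = S'"
proof
  fix y
  have b: "bounded_on_l2 S" "bounded_on_l2 S'" using assms by (auto simp: adjoint_pair_def)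
  show "S y = S' y"
  proof (cases "y \<in> l2")
    case True
    show ?thesis
    proof (rule ip_eq_imp_eq)
      fix z assume z: "z \<in> l2"
      have "ip (S y) z = ip (S' y) z" using assms True z by (auto simp: adjoint_pair_def)
      then show "ip z (S y) = ip z (S' y)"
        using ip_commute[of "S y" z] ip_commute[of "S' y" z] z b bounded_on_l2D(3) by metis
    qed (use b in \<open>auto intro: bounded_on_l2D\<close>)
  qed (simp add: bounded_on_l2D(1) b)
qed

lemma adjoint_pair_adj: "T \<in> l2_operators \<Longrightarrow> adjoint_pair T (adj T)"
proof -
  assume "T \<in> l2_operators"
  then obtain S where S: "adjoint_pair T S" by (auto simp: l2_operators_def)
  show ?thesis
    unfolding adj_def by (rule theI[of "adjoint_pair T", OF S]) (rule adjoint_pair_unique[OF _ S])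
qed

lemma adj_eq: "adjoint_pair T S \<Longrightarrow> adj T = S"
proof -
  assume S: "adjoint_pair T S"
  then have "T \<in> l2_operators" by (auto simp: l2_operators_def)
  then show ?thesis by (rule adjoint_pair_unique[OF adjoint_pair_adj S])
qed

lemma l2_operatorsD:
  assumes "T \<in> l2_operators"
  shows "bounded_on_l2 T" "T x \<in> l2" "x \<notin> l2 \<Longrightarrow> T x = (\<lambda>_. 0)"
    "x \<in> l2 \<Longrightarrow> y \<in> l2 \<Longrightarrow> ip (adj T y) x = ip y (T x)"
  using adjoint_pair_adj[OF assms] bounded_on_l2D unfolding adjoint_pair_def by blast+

lemma l2_operators_add:
  assumes T: "T \<in> l2_operators" and "x \<in> l2" "y \<in> l2"
  shows "T (\<lambda>j. x j + y j) = (\<lambda>j. T x j + T y j)"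
proof (rule ip_eq_imp_eq)
  fix z assume z: "z \<in> l2"
  have a: "adj T z \<in> l2"
    using adjoint_pair_adj[OF T] bounded_on_l2D(3) by (auto simp: adjoint_pair_def)
  show "ip z (T (\<lambda>j. x j + y j)) = ip z (\<lambda>j. T x j + T y j)"
    using assms z a
    by (simp add: l2_operatorsD(4)[OF T, symmetric] ip_add_right l2_add l2_operatorsD(2)[OF T])
qed (use assms in \<open>auto intro: l2_operatorsD l2_add\<close>)

lemma l2_operators_scale:
  assumes T: "T \<in> l2_operators" and "x \<in> l2"
  shows "T (\<lambda>j. c * x j) = (\<lambda>j. c * T x j)"
proof (rule ip_eq_imp_eq)
  fix z assume z: "z \<in> l2"
  have a: "adj T z \<in> l2"
    using adjoint_pair_adj[OF T] bounded_on_l2D(3) by (auto simp: adjoint_pair_def)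
  show "ip z (T (\<lambda>j. c * x j)) = ip z (\<lambda>j. c * T x j)"
    using assms z a
    by (simp add: l2_operatorsD(4)[OF T, symmetric] ip_scale_right l2_scale l2_operatorsD(2)[OF T])
qed (use assms in \<open>auto intro: l2_operatorsD l2_scale\<close>)

lemma l2_operators_zero: "T \<in> l2_operators \<Longrightarrow> T (\<lambda>_. 0) = (\<lambda>_. 0)"
  using l2_operators_scale[of T "\<lambda>_. 0" 0] l2_zero by simp

lemma bounded_on_l2_add:
  assumes "bounded_on_l2 S" "bounded_on_l2 T"
  shows "bounded_on_l2 (\<lambda>x j. S x j + T x j)"
proof -
  obtain C D where C: "C \<ge> 0" "\<And>x. x \<in> l2 \<Longrightarrow> l2norm (S x) \<le> C * l2norm x"
    and D: "D \<ge> 0" "\<And>x. x \<in> l2 \<Longrightarrow> l2norm (T x) \<le> D * l2norm x"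
    using assms unfolding bounded_on_l2_def by metis
  have "l2norm (\<lambda>j. S x j + T x j) \<le> (C + D) * l2norm x" if x: "x \<in> l2" for x
  proof -
    have "l2norm (\<lambda>j. S x j + T x j) \<le> l2norm (S x) + l2norm (T x)"
      using assms by (intro l2norm_triangle bounded_on_l2D(3))
    then show ?thesis using C(2)[OF x] D(2)[OF x] by (simp add: distrib_right)
  qed
  moreover have "C + D \<ge> 0" using C D by simp
  ultimately show ?thesis
    unfolding bounded_on_l2_def using assms
    by (auto intro!: l2_add simp: bounded_on_l2D)
qed

lemma bounded_on_l2_scale:
  assumes "bounded_on_l2 T"
  shows "bounded_on_l2 (\<lambda>x j. c * T x j)"
proof -
  obtain D where D: "D \<ge> 0" "\<And>x. x \<in> l2 \<Longrightarrow> l2norm (T x) \<le> D * l2norm x"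
    using assms unfolding bounded_on_l2_def by metis
  have "l2norm (\<lambda>j. c * T x j) \<le> (cmod c * D) * l2norm x" if x: "x \<in> l2" for x
    using mult_left_mono[OF D(2)[OF x], of "cmod c"] l2norm_scale[OF bounded_on_l2D(3)[OF assms]]
    by (simp add: mult.assoc)
  moreover have "cmod c * D \<ge> 0" using D by simp
  ultimately show ?thesis
    unfolding bounded_on_l2_def using assms
    by (auto intro!: l2_scale simp: bounded_on_l2D)
qed

lemma bounded_on_l2_mult:
  assumes "bounded_on_l2 S" "bounded_on_l2 T" and "S (\<lambda>_. 0) = (\<lambda>_. 0)"
  shows "bounded_on_l2 (\<lambda>x. S (T x))"
proof -
  obtain C D where C: "C \<ge> 0" "\<And>x. x \<in> l2 \<Longrightarrow> l2norm (S x) \<le> C * l2norm x"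
    and D: "D \<ge> 0" "\<And>x. x \<in> l2 \<Longrightarrow> l2norm (T x) \<le> D * l2norm x"
    using assms unfolding bounded_on_l2_def by metis
  have "l2norm (S (T x)) \<le> (C * D) * l2norm x" if x: "x \<in> l2" for x
    using C(2)[OF bounded_on_l2D(3)[OF assms(2)], of x] mult_left_mono[OF D(2)[OF x] C(1)]
    by (simp add: mult.assoc)
  moreover have "C * D \<ge> 0" using C D by simp
  ultimately show ?thesis
    unfolding bounded_on_l2_def using assms by (auto simp: bounded_on_l2D)
qed

lemma adjoint_pair_add:
  assumes "adjoint_pair S S'" "adjoint_pair T T'"
  shows "adjoint_pair (\<lambda>x j. S x j + T x j) (\<lambda>x j. S' x j + T' x j)"
  using assms unfolding adjoint_pair_def
  by (auto intro!: bounded_on_l2_add simp: ip_add_left ip_add_right bounded_on_l2D)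

lemma adjoint_pair_scale:
  assumes "adjoint_pair T T'"
  shows "adjoint_pair (\<lambda>x j. c * T x j) (\<lambda>x j. cnj c * T' x j)"
  using assms unfolding adjoint_pair_def
  by (auto intro!: bounded_on_l2_scale simp: ip_scale_left ip_scale_right bounded_on_l2D)

lemma adjoint_pair_imp_operator: "adjoint_pair T S \<Longrightarrow> T \<in> l2_operators \<and> S \<in> l2_operators"
  using adjoint_pair_sym unfolding l2_operators_def by blast

lemma adjoint_pair_mult:
  assumes "adjoint_pair S S'" "adjoint_pair T T'"
  shows "adjoint_pair (\<lambda>x. S (T x)) (\<lambda>x. T' (S' x))"
proof -
  have op: "S \<in> l2_operators" "T' \<in> l2_operators"
    using assms adjoint_pair_imp_operator by blast+
  have b: "bounded_on_l2 S" "bounded_on_l2 S'" "bounded_on_l2 T" "bounded_on_l2 T'"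
    using assms by (simp_all add: adjoint_pair_def)
  have "ip (T' (S' y)) x = ip y (S (T x))" if "x \<in> l2" "y \<in> l2" for x y
  proof -
    have "ip (T' (S' y)) x = ip (S' y) (T x)"
      using assms(2) that(1) bounded_on_l2D(3)[OF b(2), of y] by (simp add: adjoint_pair_def)
    also have "\<dots> = ip y (S (T x))"
      using assms(1) that(2) bounded_on_l2D(3)[OF b(3), of x] by (simp add: adjoint_pair_def)
    finally show ?thesis .
  qed
  then show ?thesis
    unfolding adjoint_pair_def
    using bounded_on_l2_mult[OF b(1,3) l2_operators_zero[OF op(1)]]
      bounded_on_l2_mult[OF b(4,2) l2_operators_zero[OF op(2)]] by simp
qed

lemma adjoint_pair_one:
  "adjoint_pair (\<lambda>x. if x \<in> l2 then x else (\<lambda>_. 0)) (\<lambda>x. if x \<in> l2 then x else (\<lambda>_. 0))"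
  unfolding adjoint_pair_def bounded_on_l2_def by (auto intro!: exI[of _ 1])

lemma adjoint_pair_zero: "adjoint_pair (\<lambda>_ _. 0) (\<lambda>_ _. 0)"
  unfolding adjoint_pair_def bounded_on_l2_def
  by (auto simp: l2_zero ip_def l2norm_def intro!: exI[of _ 0])

subsection \<open>The operator norm\<close>

lemma op_norm_bdd:
  assumes "bounded_on_l2 T"
  shows "bdd_above ((\<lambda>x. l2norm (T x)) ` {x \<in> l2. l2norm x \<le> 1})"
proof -
  obtain C where C: "C \<ge> 0" "\<And>x. x \<in> l2 \<Longrightarrow> l2norm (T x) \<le> C * l2norm x"
    using assms unfolding bounded_on_l2_def by metis
  have "l2norm (T x) \<le> C" if "x \<in> l2" "l2norm x \<le> 1" for x
    using C(2)[OF that(1)] mult_left_mono[OF that(2) C(1)] by simp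
  then show ?thesis by (intro bdd_aboveI2) auto
qed

lemma op_norm_nonneg: "bounded_on_l2 T \<Longrightarrow> 0 \<le> op_norm T"
proof -
  assume T: "bounded_on_l2 T"
  have z: "(\<lambda>_. 0) \<in> {x \<in> l2. l2norm x \<le> 1}" using l2_zero by (simp add: l2norm_def)
  have "l2norm (T (\<lambda>_. 0)) \<le> op_norm T"
    unfolding op_norm_def by (rule cSUP_upper[OF z op_norm_bdd[OF T]])
  then show ?thesis using l2norm_nonneg[OF bounded_on_l2D(3)[OF T]] by (rule order_trans[rotated])
qed

lemma op_norm_bound:
  assumes T: "T \<in> l2_operators" and x: "x \<in> l2"
  shows "l2norm (T x) \<le> op_norm T * l2norm x"
proof (cases "l2norm x = 0")
  case True
  then have "x = (\<lambda>_. 0)" using l2norm_eq_0[OF x] by simp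
  then show ?thesis using l2_operators_zero[OF T] by (simp add: l2norm_def)
next
  case False
  define c where "c = l2norm x"
  have c: "c > 0" using False l2norm_nonneg[OF x] unfolding c_def by linarith
  let ?y = "\<lambda>j. of_real (1 / c) * x j"
  have y: "?y \<in> {x \<in> l2. l2norm x \<le> 1}"
  proof -
    have "l2norm ?y = 1"
      using c unfolding l2norm_scale[OF x] c_def[symmetric] norm_of_real by simp
    then show ?thesis using l2_scale[OF x, of "of_real (1 / c)"] by simp
  qed
  have "l2norm (T ?y) \<le> op_norm T"
    unfolding op_norm_def by (rule cSUP_upper[OF y op_norm_bdd[OF l2_operatorsD(1)[OF T]]])
  moreover have "l2norm (T ?y) = (1 / c) * l2norm (T x)"
    using c by (simp only: l2_operators_scale[OF T x] l2norm_scale[OF l2_operatorsD(2)[OF T]] norm_of_real) simp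
  ultimately have "1 / c * l2norm (T x) \<le> op_norm T" by (simp only:)
  then show ?thesis using c by (simp add: c_def[symmetric] field_simps)
qed

lemma op_norm_le:
  assumes "\<And>x. x \<in> l2 \<Longrightarrow> l2norm (T x) \<le> C * l2norm x" "0 \<le> C"
  shows "op_norm T \<le> C"
  unfolding op_norm_def
proof (rule cSUP_least)
  have "(\<lambda>_. 0) \<in> {x \<in> l2. l2norm x \<le> 1}" using l2_zero by (simp add: l2norm_def)
  then show "{x \<in> l2. l2norm x \<le> 1} \<noteq> {}" by blast
  fix x assume "x \<in> {x \<in> l2. l2norm x \<le> 1}"
  then show "l2norm (T x) \<le> C"
    using assms(1)[of x] mult_left_mono[of "l2norm x" 1 C] assms(2) by simp
qed

lemma adj_in: "T \<in> l2_operators \<Longrightarrow> adj T \<in> l2_operators"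
  using adjoint_pair_adj adjoint_pair_imp_operator by blast

lemma adj_adj: "T \<in> l2_operators \<Longrightarrow> adj (adj T) = T"
  using adjoint_pair_adj adjoint_pair_sym adj_eq by blast

lemma op_norm_adj_le:
  assumes T: "T \<in> l2_operators"
  shows "op_norm (adj T) \<le> op_norm T"
proof (rule op_norm_le)
  fix y assume y: "y \<in> l2"
  let ?z = "adj T y"
  have z: "?z \<in> l2" using l2_operatorsD(2)[OF adj_in[OF T]] .
  have "(l2norm ?z)\<^sup>2 = cmod (ip ?z ?z)"
    unfolding ip_self[OF z] norm_of_real by simp
  also have "\<dots> = cmod (ip y (T ?z))" using l2_operatorsD(4)[OF T z y] by simp
  also have "\<dots> \<le> l2norm y * (op_norm T * l2norm ?z)"
    using ip_Cauchy_Schwarz[OF y l2_operatorsD(2)[OF T], of ?z]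
      mult_left_mono[OF op_norm_bound[OF T z] l2norm_nonneg[OF y]] by linarith
  finally have "l2norm ?z * l2norm ?z \<le> (op_norm T * l2norm y) * l2norm ?z"
    by (simp add: power2_eq_square algebra_simps)
  then show "l2norm ?z \<le> op_norm T * l2norm y"
    using l2norm_nonneg[OF z] op_norm_nonneg[OF l2_operatorsD(1)[OF T]] l2norm_nonneg[OF y]
    by (cases "l2norm ?z = 0") auto
qed (use op_norm_nonneg l2_operatorsD(1)[OF T] in blast)

lemma op_norm_adj: "T \<in> l2_operators \<Longrightarrow> op_norm (adj T) = op_norm T"
  using op_norm_adj_le[of T] op_norm_adj_le[of "adj T"] adj_in[of T] adj_adj[of T] by simp

lemma op_norm_mult_le:
  assumes S: "S \<in> l2_operators" and T: "T \<in> l2_operators"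
  shows "op_norm (\<lambda>x. S (T x)) \<le> op_norm S * op_norm T"
proof (rule op_norm_le)
  fix x assume x: "x \<in> l2"
  show "l2norm (S (T x)) \<le> op_norm S * op_norm T * l2norm x"
    using op_norm_bound[OF S l2_operatorsD(2)[OF T], of x]
      mult_left_mono[OF op_norm_bound[OF T x] op_norm_nonneg[OF l2_operatorsD(1)[OF S]]]
    by (simp add: mult.assoc)
qed (intro mult_nonneg_nonneg op_norm_nonneg l2_operatorsD(1) S T)

lemma op_norm_cstar:
  assumes T: "T \<in> l2_operators"
  shows "op_norm (\<lambda>x. adj T (T x)) = (op_norm T)\<^sup>2"
proof (rule antisym)
  show "op_norm (\<lambda>x. adj T (T x)) \<le> (op_norm T)\<^sup>2"
    using op_norm_mult_le[OF adj_in[OF T] T] op_norm_adj[OF T] by (simp add: power2_eq_square)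
  let ?c = "op_norm (\<lambda>x. adj T (T x))"
  have M: "(\<lambda>x. adj T (T x)) \<in> l2_operators"
    using adjoint_pair_mult[OF adjoint_pair_sym[OF adjoint_pair_adj[OF T]] adjoint_pair_adj[OF T]]
      adjoint_pair_imp_operator by blast
  have c: "0 \<le> ?c" using op_norm_nonneg[OF l2_operatorsD(1)[OF M]] .
  have "op_norm T \<le> sqrt ?c"
  proof (rule op_norm_le)
    fix x assume x: "x \<in> l2"
    have Tx: "T x \<in> l2" using l2_operatorsD(2)[OF T] .
    have "(l2norm (T x))\<^sup>2 = cmod (ip (T x) (T x))"
      unfolding ip_self[OF Tx] norm_of_real by simp
    also have "\<dots> = cmod (ip (adj T (T x)) x)" using l2_operatorsD(4)[OF T x Tx] by simp
    also have "\<dots> \<le> (?c * l2norm x) * l2norm x"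
      using ip_Cauchy_Schwarz[OF l2_operatorsD(2)[OF M] x, of x]
        mult_right_mono[OF op_norm_bound[OF M x] l2norm_nonneg[OF x]] by linarith
    also have "\<dots> = (sqrt ?c * l2norm x)\<^sup>2"
      using c by (simp add: power_mult_distrib power2_eq_square mult.assoc)
    finally show "l2norm (T x) \<le> sqrt ?c * l2norm x"
      by (rule power2_le_imp_le) (use c x in simp)
  qed (use c in simp)
  then have "(op_norm T)\<^sup>2 \<le> (sqrt ?c)\<^sup>2"
    by (rule power_mono) (rule op_norm_nonneg[OF l2_operatorsD(1)[OF T]])
  then show "(op_norm T)\<^sup>2 \<le> ?c" using c by simp
qed

text \<open>Uniform Cauchy sequences of operators converge coordinatewise; estimates on finitely many
  coordinates pass to the limit.\<close>

lemma bounded_on_l2_complete: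
  fixes R :: "nat \<Rightarrow> seq_map"
  assumes R: "\<And>k. bounded_on_l2 (R k)"
    and cauchy: "\<And>e. e > 0 \<Longrightarrow> \<exists>M. \<forall>m\<ge>M. \<forall>n\<ge>M. \<forall>x\<in>l2. l2norm (\<lambda>j. R m x j - R n x j) \<le> e * l2norm x"
  shows "\<exists>S. bounded_on_l2 S \<and>
    (\<forall>e>0. \<exists>M. \<forall>n\<ge>M. \<forall>x\<in>l2. l2norm (\<lambda>j. R n x j - S x j) \<le> e * l2norm x)"
proof -
  define S where "S x = (if x \<in> l2 then (\<lambda>j. lim (\<lambda>n. R n x j)) else (\<lambda>_. 0))" for x
  have Rl2: "R n x \<in> l2" for n x using bounded_on_l2D(3)[OF R] .
  have conv: "(\<lambda>n. R n x j) \<longlonglongrightarrow> S x j" if x: "x \<in> l2" for x j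
  proof -
    have "Cauchy (\<lambda>n. R n x j)"
    proof (rule CauchyI)
      fix e :: real assume e: "e > 0"
      define d where "d = e / (l2norm x + 1)"
      have nx: "l2norm x \<ge> 0" using x by simp
      have d: "d > 0" "d * l2norm x < e" using e nx by (auto simp: d_def field_simps)
      obtain M where M: "\<forall>m\<ge>M. \<forall>n\<ge>M. \<forall>x\<in>l2. l2norm (\<lambda>j. R m x j - R n x j) \<le> d * l2norm x"
        using cauchy[OF d(1)] by blast
      have "norm (R m x j - R n x j) < e" if "m \<ge> M" "n \<ge> M" for m n
      proof -
        have "norm (R m x j - R n x j) \<le> l2norm (\<lambda>j. R m x j - R n x j)"
          using l2_coordinate_le[OF l2_diff[OF Rl2 Rl2]] .
        also have "\<dots> \<le> d * l2norm x" using M that x by blast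
        finally show ?thesis using d(2) by simp
      qed
      then show "\<exists>M. \<forall>m\<ge>M. \<forall>n\<ge>M. norm (R m x j - R n x j) < e" by blast
    qed
    then show ?thesis
      using x by (simp add: S_def Cauchy_convergent_iff convergent_LIMSEQ_iff)
  qed
  have est: "\<exists>M. \<forall>n\<ge>M. \<forall>x\<in>l2. (\<lambda>j. R n x j - S x j) \<in> l2 \<and> l2norm (\<lambda>j. R n x j - S x j) \<le> e * l2norm x"
    if e: "e > 0" for e
  proof -
    obtain M where M: "\<forall>m\<ge>M. \<forall>n\<ge>M. \<forall>x\<in>l2. l2norm (\<lambda>j. R m x j - R n x j) \<le> e * l2norm x"
      using cauchy[OF e] by blast
    have "(\<Sum>j<J. (cmod (R n x j - S x j))\<^sup>2) \<le> (e * l2norm x)\<^sup>2" if n: "n \<ge> M" and x: "x \<in> l2" for n x J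
    proof (rule tendsto_upperbound)
      show "(\<lambda>m. \<Sum>j<J. (cmod (R n x j - R m x j))\<^sup>2) \<longlonglongrightarrow> (\<Sum>j<J. (cmod (R n x j - S x j))\<^sup>2)"
        by (intro tendsto_intros conv x)
      show "\<forall>\<^sub>F m in sequentially. (\<Sum>j<J. (cmod (R n x j - R m x j))\<^sup>2) \<le> (e * l2norm x)\<^sup>2"
        using eventually_ge_at_top[of M]
      proof eventually_elim
        case (elim m)
        have "(\<Sum>j<J. (cmod (R n x j - R m x j))\<^sup>2) \<le> (l2norm (\<lambda>j. R n x j - R m x j))\<^sup>2"
          using l2_partial_sums_le[OF l2_diff[OF Rl2 Rl2]] .
        also have "\<dots> \<le> (e * l2norm x)\<^sup>2"
          using M n elim x l2norm_nonneg[OF l2_diff[OF Rl2[of n x] Rl2[of m x]]] by (intro power_mono) auto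
        finally show ?case .
      qed
    qed simp
    then show ?thesis
      using l2I_partial_sums[of "\<lambda>j. R n x j - S x j" "e * l2norm x" for n x] e by (meson l2norm_nonneg less_imp_le mult_nonneg_nonneg)
  qed
  have Sl2: "S x \<in> l2" if x: "x \<in> l2" for x
  proof -
    obtain M where "(\<lambda>j. R M x j - S x j) \<in> l2" using est[of 1] x by auto
    then show ?thesis using l2_diff[OF Rl2[of M x], of "\<lambda>j. R M x j - S x j"] by simp
  qed
  obtain M where M: "\<And>x. x \<in> l2 \<Longrightarrow> (\<lambda>j. R M x j - S x j) \<in> l2 \<and> l2norm (\<lambda>j. R M x j - S x j) \<le> 1 * l2norm x"
    using est[of 1] by auto
  obtain C where C: "C \<ge> 0" "\<And>x. x \<in> l2 \<Longrightarrow> l2norm (R M x) \<le> C * l2norm x"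
    using R[of M] unfolding bounded_on_l2_def by metis
  have "l2norm (S x) \<le> (C + 1) * l2norm x" if x: "x \<in> l2" for x
  proof -
    have d: "(\<lambda>j. S x j - R M x j) \<in> l2" using l2_diff[OF Sl2[OF x] Rl2] .
    have "l2norm (\<lambda>j. R M x j + (S x j - R M x j)) \<le> l2norm (R M x) + l2norm (\<lambda>j. S x j - R M x j)"
      by (rule l2norm_triangle[OF Rl2 d])
    then have "l2norm (S x) \<le> l2norm (R M x) + l2norm (\<lambda>j. R M x j - S x j)"
      using l2norm_diff_commute[of "S x" "R M x"] by simp
    also have "\<dots> \<le> C * l2norm x + 1 * l2norm x" using M[OF x] C(2)[OF x] by linarith
    finally show ?thesis by (simp add: distrib_right)
  qed
  then have "bounded_on_l2 S"
    unfolding bounded_on_l2_def using Sl2 C(1) by (auto simp: S_def intro!: exI[of _ "C + 1"])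
  then show ?thesis using est by blast
qed

subsection \<open>The C*-algebra axioms\<close>

lemma B_l2_simps [simp]:
  "carrier B_l2 = l2_operators"
  "S \<otimes>\<^bsub>B_l2\<^esub> T = (\<lambda>x. S (T x))"
  "\<one>\<^bsub>B_l2\<^esub> = (\<lambda>x. if x \<in> l2 then x else (\<lambda>_. 0))"
  "\<zero>\<^bsub>B_l2\<^esub> = (\<lambda>_ _. 0)"
  "S \<oplus>\<^bsub>B_l2\<^esub> T = (\<lambda>x j. S x j + T x j)"
  "c \<odot>\<^bsub>B_l2\<^esub> T = (\<lambda>x j. c * T x j)"
  "star B_l2 T = adj T"
  "nrm B_l2 T = op_norm T"
  by (simp_all add: B_l2_def)

lemma cring_complex_ring: "cring complex_ring"
proof (rule cringI)
  show "abelian_group complex_ring"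
  proof (rule abelian_groupI)
    show "\<exists>y\<in>carrier complex_ring. y \<oplus>\<^bsub>complex_ring\<^esub> x = \<zero>\<^bsub>complex_ring\<^esub>" for x
      by (rule bexI[of _ "- x"]) (simp_all add: complex_ring_def)
  qed (simp_all add: complex_ring_def)
  show "comm_monoid complex_ring"
    by (rule comm_monoidI) (simp_all add: complex_ring_def)
qed (simp_all add: complex_ring_def distrib_right)

lemma l2_operators_closed:
  assumes "S \<in> l2_operators" "T \<in> l2_operators"
  shows "(\<lambda>x j. S x j + T x j) \<in> l2_operators" "(\<lambda>x j. c * T x j) \<in> l2_operators"
    "(\<lambda>x. S (T x)) \<in> l2_operators"
  using adjoint_pair_add[OF assms[THEN adjoint_pair_adj], THEN adjoint_pair_imp_operator]
    adjoint_pair_scale[OF assms(2)[THEN adjoint_pair_adj], of c, THEN adjoint_pair_imp_operator]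
    adjoint_pair_mult[OF assms[THEN adjoint_pair_adj], THEN adjoint_pair_imp_operator]
  by simp_all

lemma l2_operators_units:
  "(\<lambda>x. if x \<in> l2 then x else (\<lambda>_. 0)) \<in> l2_operators" "(\<lambda>_ _. 0) \<in> l2_operators"
  using adjoint_pair_one[THEN adjoint_pair_imp_operator] adjoint_pair_zero[THEN adjoint_pair_imp_operator]
  by simp_all

lemma abelian_group_B_l2: "abelian_group B_l2"
proof (rule abelian_groupI)
  show "\<exists>y\<in>carrier B_l2. y \<oplus>\<^bsub>B_l2\<^esub> x = \<zero>\<^bsub>B_l2\<^esub>" if "x \<in> carrier B_l2" for x
    using l2_operators_closed(2)[of x x "- 1"] that
    by (intro bexI[of _ "\<lambda>y j. - 1 * x y j"]) simp_all
qed (simp_all add: l2_operators_closed l2_operators_units add.assoc, simp_all add: add.commute)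

lemma ring_B_l2: "ring B_l2"
proof (rule ringI[OF abelian_group_B_l2])
  show "monoid B_l2"
    by (rule monoidI)
      (auto simp: l2_operators_closed l2_operators_units l2_operatorsD l2_operators_zero fun_eq_iff)
qed (simp_all add: l2_operators_add l2_operatorsD(2))

lemma module_B_l2: "module complex_ring B_l2"
  by (rule moduleI[OF cring_complex_ring abelian_group_B_l2])
    (auto simp: complex_ring_def l2_operators_closed algebra_simps)

lemma minus_B_l2:
  assumes "S \<in> l2_operators" "T \<in> l2_operators"
  shows "S \<ominus>\<^bsub>B_l2\<^esub> T = (\<lambda>x j. S x j - T x j)"
proof -
  have n: "(\<lambda>x j. - 1 * T x j) \<in> carrier B_l2"
    using l2_operators_closed(2)[OF assms, of "- 1"] by simp
  have "\<ominus>\<^bsub>B_l2\<^esub> T = (\<lambda>x j. - 1 * T x j)"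
    by (rule abelian_group.minus_equality[OF abelian_group_B_l2 _ _ n]) (use assms in simp_all)
  then show ?thesis by (simp add: a_minus_def)
qed

text \<open>The adjoints of a Cauchy sequence are a Cauchy sequence too, and adjointness passes to the two
  limits; so the limit has an adjoint.\<close>

lemma B_l2_complete:
  assumes s: "\<And>k. s k \<in> l2_operators"
    and cauchy: "\<And>e. e > 0 \<Longrightarrow> \<exists>M. \<forall>m\<ge>M. \<forall>n\<ge>M. op_norm (\<lambda>x j. s m x j - s n x j) < e"
  shows "\<exists>T\<in>l2_operators. (\<lambda>k. op_norm (\<lambda>x j. s k x j - T x j)) \<longlonglongrightarrow> 0"
proof -
  have diff: "(\<lambda>x j. S x j - T x j) \<in> l2_operators" if "S \<in> l2_operators" "T \<in> l2_operators" for S T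
    using l2_operators_closed(1)[OF that(1) l2_operators_closed(2)[OF that, of "- 1"]] by simp
  have uni: "\<exists>M. \<forall>m\<ge>M. \<forall>n\<ge>M. \<forall>x\<in>l2. l2norm (\<lambda>j. R m x j - R n x j) \<le> e * l2norm x"
    if R: "\<And>k. R k \<in> l2_operators" and e: "e > 0"
      and c: "\<exists>M. \<forall>m\<ge>M. \<forall>n\<ge>M. op_norm (\<lambda>x j. R m x j - R n x j) < e" for R :: "nat \<Rightarrow> seq_map" and e
  proof -
    obtain M where M: "\<And>m n. m \<ge> M \<Longrightarrow> n \<ge> M \<Longrightarrow> op_norm (\<lambda>x j. R m x j - R n x j) < e"
      using c by blast
    have "l2norm (\<lambda>j. R m x j - R n x j) \<le> e * l2norm x" if "m \<ge> M" "n \<ge> M" "x \<in> l2" for m n x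
      using op_norm_bound[OF diff[OF R[of m] R[of n]] that(3)]
        mult_right_mono[OF less_imp_le[OF M[OF that(1,2)]] l2norm_nonneg[OF that(3)]] by linarith
    then show ?thesis by blast
  qed
  have adj_diff: "adj (\<lambda>x j. S x j - T x j) = (\<lambda>x j. adj S x j - adj T x j)"
    if "S \<in> l2_operators" "T \<in> l2_operators" for S T
  proof (rule adj_eq)
    show "adjoint_pair (\<lambda>x j. S x j - T x j) (\<lambda>x j. adj S x j - adj T x j)"
      using adjoint_pair_add[OF adjoint_pair_adj[OF that(1)] adjoint_pair_scale[OF adjoint_pair_adj[OF that(2)], of "- 1"]]
      by simp
  qed
  let ?a = "\<lambda>k. adj (s k)"
  have a: "?a k \<in> l2_operators" for k using adj_in[OF s] .
  have cauchy': "\<exists>M. \<forall>m\<ge>M. \<forall>n\<ge>M. op_norm (\<lambda>x j. ?a m x j - ?a n x j) < e" if e: "e > 0" for e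
    using cauchy[OF e] by (simp add: adj_diff[OF s s, symmetric] op_norm_adj[OF diff[OF s s]])
  obtain T where T: "bounded_on_l2 T"
    and limT: "\<And>e. e > 0 \<Longrightarrow> \<exists>M. \<forall>n\<ge>M. \<forall>x\<in>l2. l2norm (\<lambda>j. s n x j - T x j) \<le> e * l2norm x"
    using bounded_on_l2_complete[of s, OF l2_operatorsD(1)[OF s] uni[OF s _ cauchy]] by blast
  obtain U where U: "bounded_on_l2 U"
    and limU: "\<And>e. e > 0 \<Longrightarrow> \<exists>M. \<forall>n\<ge>M. \<forall>x\<in>l2. l2norm (\<lambda>j. ?a n x j - U x j) \<le> e * l2norm x"
    using bounded_on_l2_complete[of ?a, OF l2_operatorsD(1)[OF a] uni[OF a _ cauchy']] by blast
  have weak: "(\<lambda>n. ip y (R n x)) \<longlonglongrightarrow> ip y (Q x)"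
    if R: "\<And>k. R k \<in> l2_operators" and Q: "bounded_on_l2 Q" and x: "x \<in> l2" and y: "y \<in> l2"
      and l: "\<And>e. e > 0 \<Longrightarrow> \<exists>M. \<forall>n\<ge>M. \<forall>x\<in>l2. l2norm (\<lambda>j. R n x j - Q x j) \<le> e * l2norm x"
    for R :: "nat \<Rightarrow> seq_map" and Q x y
  proof (rule LIMSEQ_I)
    fix r :: real assume r: "r > 0"
    define d where "d = r / (l2norm x * l2norm y + 1)"
    have nn: "l2norm x * l2norm y \<ge> 0" using x y by simp
    have d: "d > 0" "d * (l2norm x * l2norm y) < r" using r nn by (auto simp: d_def field_simps)
    obtain M where M: "\<And>n. n \<ge> M \<Longrightarrow> l2norm (\<lambda>j. R n x j - Q x j) \<le> d * l2norm x"
      using l[OF d(1)] x by blast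
    have "norm (ip y (R n x) - ip y (Q x)) < r" if n: "n \<ge> M" for n
    proof -
      have "norm (ip y (R n x) - ip y (Q x)) = norm (ip y (\<lambda>j. R n x j - Q x j))"
        using ip_diff_right[OF y l2_operatorsD(2)[OF R] bounded_on_l2D(3)[OF Q]] by simp
      also have "\<dots> \<le> l2norm y * l2norm (\<lambda>j. R n x j - Q x j)"
        by (rule ip_Cauchy_Schwarz[OF y l2_diff[OF l2_operatorsD(2)[OF R] bounded_on_l2D(3)[OF Q]]])
      also have "\<dots> \<le> l2norm y * (d * l2norm x)"
        by (rule mult_left_mono[OF M[OF n] l2norm_nonneg[OF y]])
      also have "\<dots> < r" using d(2) by (simp add: algebra_simps)
      finally show ?thesis .
    qed
    then show "\<exists>M. \<forall>n\<ge>M. norm (ip y (R n x) - ip y (Q x)) < r" by blast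
  qed
  have "adjoint_pair T U"
    unfolding adjoint_pair_def
  proof (intro conjI T U ballI)
    fix x y assume x: "x \<in> l2" and y: "y \<in> l2"
    have 1: "(\<lambda>n. ip y (s n x)) \<longlonglongrightarrow> ip y (T x)" by (rule weak[OF s T x y limT])
    have "(\<lambda>n. cnj (ip x (?a n y))) \<longlonglongrightarrow> cnj (ip x (U y))"
      by (intro tendsto_cnj weak[OF a U y x limU])
    moreover have "cnj (ip x (?a n y)) = ip y (s n x)" for n
      using ip_commute[OF x l2_operatorsD(2)[OF a], of n y] l2_operatorsD(4)[OF s x y] by simp
    moreover have "cnj (ip x (U y)) = ip (U y) x"
      using ip_commute[OF x bounded_on_l2D(3)[OF U]] by simp
    ultimately have "(\<lambda>n. ip y (s n x)) \<longlonglongrightarrow> ip (U y) x" by simp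
    then show "ip (U y) x = ip y (T x)" using 1 by (rule LIMSEQ_unique)
  qed
  then have Top: "T \<in> l2_operators" using adjoint_pair_imp_operator by blast
  moreover have "(\<lambda>k. op_norm (\<lambda>x j. s k x j - T x j)) \<longlonglongrightarrow> 0"
  proof (rule LIMSEQ_I)
    fix r :: real assume r: "r > 0"
    obtain M where M: "\<And>n x. n \<ge> M \<Longrightarrow> x \<in> l2 \<Longrightarrow> l2norm (\<lambda>j. s n x j - T x j) \<le> r / 2 * l2norm x"
      using limT[of "r / 2"] r by auto
    have "norm (op_norm (\<lambda>x j. s n x j - T x j) - 0) < r" if n: "n \<ge> M" for n
    proof -
      have "op_norm (\<lambda>x j. s n x j - T x j) \<le> r / 2"
        by (rule op_norm_le) (use M[OF n] r in simp_all)
      then show ?thesis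
        using op_norm_nonneg[OF l2_operatorsD(1)[OF diff[OF s Top]]] r by simp
    qed
    then show "\<exists>M. \<forall>n\<ge>M. norm (op_norm (\<lambda>x j. s n x j - T x j) - 0) < r" by blast
  qed
  ultimately show ?thesis by blast
qed

theorem unital_cstar_algebra_B_l2: "unital_cstar_algebra B_l2"
proof (intro unital_cstar_algebra.intro ring_B_l2 module_B_l2 unital_cstar_algebra_axioms.intro)
  show "x \<otimes>\<^bsub>B_l2\<^esub> (c \<odot>\<^bsub>B_l2\<^esub> y) = c \<odot>\<^bsub>B_l2\<^esub> (x \<otimes>\<^bsub>B_l2\<^esub> y)"
    if "x \<in> carrier B_l2" "y \<in> carrier B_l2" for c x y
    using that by (simp add: l2_operators_scale l2_operatorsD(2))
  show "star B_l2 (x \<oplus>\<^bsub>B_l2\<^esub> y) = star B_l2 x \<oplus>\<^bsub>B_l2\<^esub> star B_l2 y"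
    if "x \<in> carrier B_l2" "y \<in> carrier B_l2" for x y
    using adj_eq[OF adjoint_pair_add[OF adjoint_pair_adj adjoint_pair_adj]] that by simp
  show "star B_l2 (c \<odot>\<^bsub>B_l2\<^esub> x) = cnj c \<odot>\<^bsub>B_l2\<^esub> star B_l2 x" if "x \<in> carrier B_l2" for c x
    using adj_eq[OF adjoint_pair_scale[OF adjoint_pair_adj]] that by simp
  show "star B_l2 (x \<otimes>\<^bsub>B_l2\<^esub> y) = star B_l2 y \<otimes>\<^bsub>B_l2\<^esub> star B_l2 x"
    if "x \<in> carrier B_l2" "y \<in> carrier B_l2" for x y
    using adj_eq[OF adjoint_pair_mult[OF adjoint_pair_adj adjoint_pair_adj]] that by simp
  show "nrm B_l2 (star B_l2 x \<otimes>\<^bsub>B_l2\<^esub> x) = (nrm B_l2 x)\<^sup>2" if "x \<in> carrier B_l2" for x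
    using op_norm_cstar that by simp
  show "nrm B_l2 x = 0 \<longleftrightarrow> x = \<zero>\<^bsub>B_l2\<^esub>" if "x \<in> carrier B_l2" for x
  proof
    assume 0: "nrm B_l2 x = 0"
    have "x y = (\<lambda>_. 0)" for y
    proof (cases "y \<in> l2")
      case True
      then have "l2norm (x y) \<le> 0" using op_norm_bound[of x y] that 0 by simp
      then show ?thesis
        using l2norm_eq_0[of "x y"] antisym[OF _ l2norm_nonneg[of "x y"]] l2_operatorsD(2)[of x y] that
        by simp
    qed (use that l2_operatorsD(3) in simp)
    then show "x = \<zero>\<^bsub>B_l2\<^esub>" by auto
  next
    assume "x = \<zero>\<^bsub>B_l2\<^esub>"
    then have "op_norm x \<le> 0" by (intro op_norm_le) (simp_all add: l2norm_def)
    then show "nrm B_l2 x = 0" using op_norm_nonneg[of x] l2_operatorsD(1)[of x] that by simp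
  qed
  show "nrm B_l2 (x \<oplus>\<^bsub>B_l2\<^esub> y) \<le> nrm B_l2 x + nrm B_l2 y"
    if "x \<in> carrier B_l2" "y \<in> carrier B_l2" for x y
  proof -
    have xy: "x \<in> l2_operators" "y \<in> l2_operators" using that by simp_all
    have "op_norm (\<lambda>z j. x z j + y z j) \<le> op_norm x + op_norm y"
    proof (rule op_norm_le)
      fix z assume z: "z \<in> l2"
      show "l2norm (\<lambda>j. x z j + y z j) \<le> (op_norm x + op_norm y) * l2norm z"
        using l2norm_triangle[OF l2_operatorsD(2)[OF xy(1)] l2_operatorsD(2)[OF xy(2)], of z z]
          op_norm_bound[OF xy(1) z] op_norm_bound[OF xy(2) z] by (simp add: distrib_right)
    qed (use op_norm_nonneg[OF l2_operatorsD(1)[OF xy(1)]] op_norm_nonneg[OF l2_operatorsD(1)[OF xy(2)]] in simp)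
    then show ?thesis by simp
  qed
  show "nrm B_l2 (c \<odot>\<^bsub>B_l2\<^esub> x) = cmod c * nrm B_l2 x" if "x \<in> carrier B_l2" for c x
  proof -
    have x: "x \<in> l2_operators" using that by simp
    have le: "op_norm (\<lambda>z j. d * y z j) \<le> cmod d * op_norm y" if y: "y \<in> l2_operators" for d y
    proof (rule op_norm_le)
      fix z assume z: "z \<in> l2"
      show "l2norm (\<lambda>j. d * y z j) \<le> cmod d * op_norm y * l2norm z"
        using mult_left_mono[OF op_norm_bound[OF y z], of "cmod d"] l2norm_scale[OF l2_operatorsD(2)[OF y]]
        by (simp add: mult.assoc)
    qed (use op_norm_nonneg[OF l2_operatorsD(1)[OF y]] in simp)
    have "cmod c * op_norm x \<le> op_norm (\<lambda>z j. c * x z j)"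
    proof (cases "c = 0")
      case True
      then show ?thesis
        using op_norm_nonneg[OF l2_operatorsD(1)[OF l2_operators_closed(2)[OF x x, of c]]] by simp
    next
      case False
      then have "op_norm x \<le> cmod (1 / c) * op_norm (\<lambda>z j. c * x z j)"
        using le[OF l2_operators_closed(2)[OF x x, of c], of "1 / c"] by simp
      then show ?thesis using False by (simp add: norm_divide field_simps)
    qed
    then show ?thesis using le[OF x, of c] by simp
  qed
  show "\<exists>x\<in>carrier B_l2. (\<lambda>k. nrm B_l2 (s k \<ominus>\<^bsub>B_l2\<^esub> x)) \<longlonglongrightarrow> 0"
    if s: "\<And>k. s k \<in> carrier B_l2"
      and c: "\<And>e. e > 0 \<Longrightarrow> \<exists>M. \<forall>m\<ge>M. \<forall>n\<ge>M. nrm B_l2 (s m \<ominus>\<^bsub>B_l2\<^esub> s n) < e" for s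
  proof -
    have s': "s k \<in> l2_operators" for k using s by simp
    have "\<exists>M. \<forall>m\<ge>M. \<forall>n\<ge>M. op_norm (\<lambda>x j. s m x j - s n x j) < e" if "e > 0" for e
      using c[OF that] by (simp add: minus_B_l2 s')
    then obtain T where "T \<in> l2_operators" "(\<lambda>k. op_norm (\<lambda>x j. s k x j - T x j)) \<longlonglongrightarrow> 0"
      using B_l2_complete[of s, OF s'] by blast
    then show ?thesis by (intro bexI[of _ T]) (simp_all add: minus_B_l2 s')
  qed
qed (simp_all add: adj_in adj_adj op_norm_nonneg l2_operatorsD(1) op_norm_mult_le)

theorem vector_state_B_l2:
  assumes w: "w \<in> l2" "l2norm w = 1"
  shows "cstar_prob_space B_l2 (\<lambda>T. ip w (T w))"
proof (intro cstar_prob_space.intro unital_cstar_algebra_B_l2 cstar_prob_space_axioms.intro)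
  show "ip w ((star B_l2 x \<otimes>\<^bsub>B_l2\<^esub> x) w) \<in> \<real>\<^sub>\<ge>\<^sub>0" if "x \<in> carrier B_l2" for x
  proof -
    have x: "x \<in> l2_operators" "adj x \<in> l2_operators" using that adj_in by simp_all
    have "ip w (adj x (x w)) = ip (x w) (x w)"
      using l2_operatorsD(4)[OF x(2), of "x w" w] l2_operatorsD(2)[OF x(1)] w adj_adj[OF x(1)] by simp
    then show ?thesis
      by (simp only: B_l2_simps ip_self[OF l2_operatorsD(2)[OF x(1)]] nonneg_Reals_of_real_iff zero_le_power2)
  qed
qed (use w ip_self[of w] in \<open>simp_all add: ip_add_right ip_scale_right l2_operatorsD(2)\<close>)

section \<open>Realising a positive definite moment functional by operators\<close>

subsection \<open>Positive semidefinite kernels\<close>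

definition kernel_form :: "nat set \<Rightarrow> (nat \<Rightarrow> nat \<Rightarrow> complex) \<Rightarrow> (nat \<Rightarrow> complex) \<Rightarrow> (nat \<Rightarrow> complex) \<Rightarrow> complex" where
  "kernel_form F K c d = (\<Sum>m\<in>F. \<Sum>n\<in>F. cnj (c m) * d n * K m n)"

definition psd_kernel :: "(nat \<Rightarrow> nat \<Rightarrow> complex) \<Rightarrow> bool" where
  "psd_kernel K \<longleftrightarrow> (\<forall>F c. finite F \<longrightarrow> kernel_form F K c c \<in> \<real>\<^sub>\<ge>\<^sub>0)"

lemma kernel_form_add_unit:
  assumes F: "finite F" and j: "j \<in> F"
  shows "kernel_form F K (\<lambda>n. c n + (if n = j then t else 0)) (\<lambda>n. c n + (if n = j then t else 0))
    = kernel_form F K c c + t * (\<Sum>m\<in>F. cnj (c m) * K m j) + cnj t * (\<Sum>n\<in>F. c n * K j n) + cnj t * t * K j j"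
proof -
  let ?e = "\<lambda>n. if n = j then t else 0"
  have 1: "kernel_form F K (\<lambda>n. c n + ?e n) (\<lambda>n. c n + ?e n)
      = kernel_form F K c c + kernel_form F K c ?e + kernel_form F K ?e c + kernel_form F K ?e ?e"
    by (simp add: kernel_form_def ring_distribs sum.distrib algebra_simps)
  have 2: "kernel_form F K d ?e = t * (\<Sum>m\<in>F. cnj (d m) * K m j)" for d
  proof -
    have "(\<Sum>n\<in>F. cnj (d m) * ?e n * K m n) = t * (cnj (d m) * K m j)" for m
    proof -
      have "(\<Sum>n\<in>F. cnj (d m) * ?e n * K m n) = (\<Sum>n\<in>F. if n = j then cnj (d m) * t * K m n else 0)"
        by (intro sum.cong) auto
      then show ?thesis using F j by (simp add: sum.delta)
    qed
    then show ?thesis by (simp add: kernel_form_def sum_distrib_left)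
  qed
  have 3: "(\<Sum>m\<in>F. cnj (?e m) * K m j) = cnj t * K j j"
  proof -
    have "(\<Sum>m\<in>F. cnj (?e m) * K m j) = (\<Sum>m\<in>F. if m = j then cnj t * K m j else 0)"
      by (intro sum.cong) auto
    then show ?thesis using F j by (simp add: sum.delta)
  qed
  have 4: "kernel_form F K ?e c = cnj t * (\<Sum>n\<in>F. c n * K j n)"
  proof -
    have "kernel_form F K ?e c = (\<Sum>m\<in>F. if m = j then cnj t * (\<Sum>n\<in>F. c n * K m n) else 0)"
      unfolding kernel_form_def by (intro sum.cong) (auto simp: sum_distrib_left mult.assoc)
    then show ?thesis using F j by (simp add: sum.delta)
  qed
  show ?thesis unfolding 1 4 unfolding 2 3 by (simp add: algebra_simps)
qed

lemma nonneg_Reals_eq_Re: "z \<in> \<real>\<^sub>\<ge>\<^sub>0 \<Longrightarrow> z = of_real (Re z) \<and> 0 \<le> Re z"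
  by (auto elim: nonneg_Reals_cases)

lemma psd_kernel_diag:
  assumes "psd_kernel K"
  shows "K j j = of_real (Re (K j j))" "0 \<le> Re (K j j)"
proof -
  have "kernel_form {j} K (\<lambda>_. 1) (\<lambda>_. 1) \<in> \<real>\<^sub>\<ge>\<^sub>0" using assms by (simp add: psd_kernel_def)
  then show "K j j = of_real (Re (K j j))" "0 \<le> Re (K j j)"
    using nonneg_Reals_eq_Re[of "K j j"] by (simp_all add: kernel_form_def)
qed

lemma psd_kernel_pair:
  assumes "psd_kernel K" "m \<noteq> n"
  shows "K m m + z * K m n + cnj z * K n m + cnj z * z * K n n \<in> \<real>\<^sub>\<ge>\<^sub>0"
proof -
  let ?c = "\<lambda>k. if k = n then z else 1"
  have "kernel_form {m, n} K ?c ?c \<in> \<real>\<^sub>\<ge>\<^sub>0" using assms(1) by (simp add: psd_kernel_def)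
  moreover have "kernel_form {m, n} K ?c ?c = K m m + z * K m n + cnj z * K n m + cnj z * z * K n n"
    using assms(2) by (simp add: kernel_form_def algebra_simps)
  ultimately show ?thesis by simp
qed

lemma psd_kernel_hermitian:
  assumes "psd_kernel K"
  shows "cnj (K m n) = K n m"
proof (cases "m = n")
  case True
  then show ?thesis using psd_kernel_diag(1)[OF assms, of m] complex_cnj_complex_of_real by metis
next
  case False
  have Im0: "Im (K k k) = 0" for k
    using psd_kernel_diag(1)[OF assms, of k] by (metis Im_complex_of_real)
  have "Im (K m m + 1 * K m n + cnj 1 * K n m + cnj 1 * 1 * K n n) = 0"
    using nonneg_Reals_eq_Re[OF psd_kernel_pair[OF assms False, of 1]] by (metis Im_complex_of_real)
  moreover have "Im (K m m + \<i> * K m n + cnj \<i> * K n m + cnj \<i> * \<i> * K n n) = 0"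
    using nonneg_Reals_eq_Re[OF psd_kernel_pair[OF assms False, of \<i>]] by (metis Im_complex_of_real)
  ultimately show ?thesis using Im0 by (simp add: complex_eq_iff)
qed

lemma psd_kernel_zero_row:
  assumes "psd_kernel K" "K j j = 0"
  shows "K j n = 0"
proof (cases "n = j")
  case False
  have "(cmod (K n j))\<^sup>2 \<le> Re (K n n) * 0"
  proof (rule Cauchy_Schwarz_of_form)
    fix c
    have "K n n + c * K n j + cnj c * K j n + cnj c * c * K j j \<in> \<real>\<^sub>\<ge>\<^sub>0"
      by (rule psd_kernel_pair[OF assms(1) False])
    then have "0 \<le> Re (K n n + c * K n j + cnj c * K j n)"
      using assms(2) nonneg_Reals_eq_Re by fastforce
    moreover have eq: "cnj c * K j n = cnj (c * K n j)"
      using psd_kernel_hermitian[OF assms(1), of n j] by simp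
    have "Re (cnj c * K j n) = Re (c * K n j)" by (simp only: eq cnj.sel)
    ultimately show "0 \<le> Re (K n n) + 2 * Re (c * K n j) + (cmod c)\<^sup>2 * 0" by simp
  qed simp
  then have "K n j = 0" by simp
  then show ?thesis using psd_kernel_hermitian[OF assms(1), of n j] by simp
qed (use assms in simp)

subsection \<open>Cholesky decomposition\<close>

definition schur_complement :: "nat \<Rightarrow> (nat \<Rightarrow> nat \<Rightarrow> complex) \<Rightarrow> nat \<Rightarrow> nat \<Rightarrow> complex" where
  "schur_complement j K m n = K m n - K m j * K j n / K j j"

text \<open>The Schur complement is the form minimised over the coefficient at \<open>j\<close>.\<close>

lemma psd_schur_complement:
  assumes K: "psd_kernel K"
  shows "psd_kernel (schur_complement j K)"
  unfolding psd_kernel_def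
proof (intro allI impI)
  fix F :: "nat set" and c :: "nat \<Rightarrow> complex"
  assume F: "finite F"
  let ?K = "schur_complement j K"
  define G where "G = insert j F"
  define c0 where "c0 n = (if n \<in> F then c n else 0)" for n
  have G: "finite G" "j \<in> G" "F \<subseteq> G" using F by (auto simp: G_def)
  have eq: "kernel_form F ?K c c = kernel_form G ?K c0 c0"
  proof -
    have "kernel_form G ?K c0 c0 = (\<Sum>m\<in>F. \<Sum>n\<in>G. cnj (c0 m) * c0 n * ?K m n)"
      unfolding kernel_form_def using G by (intro sum.mono_neutral_right) (auto simp: c0_def)
    also have "\<dots> = (\<Sum>m\<in>F. \<Sum>n\<in>F. cnj (c0 m) * c0 n * ?K m n)"
      using G by (intro sum.cong refl sum.mono_neutral_right) (auto simp: c0_def)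
    finally show ?thesis by (simp add: kernel_form_def c0_def)
  qed
  define B where "B = (\<Sum>n\<in>G. c0 n * K j n)"
  have cB: "(\<Sum>m\<in>G. cnj (c0 m) * K m j) = cnj B"
    unfolding B_def cnj_sum complex_cnj_mult psd_kernel_hermitian[OF K] by simp
  have S: "kernel_form G ?K c0 c0 = kernel_form G K c0 c0 - cnj B * B / K j j"
  proof -
    have "cnj B * B / K j j = (\<Sum>m\<in>G. cnj (c0 m) * K m j) * (\<Sum>n\<in>G. c0 n * K j n) / K j j"
      by (simp only: cB B_def[symmetric])
    also have "\<dots> = (\<Sum>m\<in>G. \<Sum>n\<in>G. cnj (c0 m) * c0 n * (K m j * K j n / K j j))"
      unfolding sum_product sum_divide_distrib by (intro sum.cong refl) simp
    finally have "cnj B * B / K j j = (\<Sum>m\<in>G. \<Sum>n\<in>G. cnj (c0 m) * c0 n * (K m j * K j n / K j j))" .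
    then show ?thesis
      by (simp add: kernel_form_def schur_complement_def right_diff_distrib sum_subtractf)
  qed
  show "kernel_form F ?K c c \<in> \<real>\<^sub>\<ge>\<^sub>0"
  proof (cases "K j j = 0")
    case True
    then show ?thesis using K G unfolding eq S by (simp add: psd_kernel_def)
  next
    case False
    define t where "t = - B / K j j"
    have r: "cnj (K j j) = K j j" by (rule psd_kernel_hermitian[OF K])
    have "kernel_form G K (\<lambda>n. c0 n + (if n = j then t else 0)) (\<lambda>n. c0 n + (if n = j then t else 0))
        = kernel_form G K c0 c0 + t * cnj B + cnj t * B + cnj t * t * K j j"
      unfolding kernel_form_add_unit[OF G(1,2)] cB B_def[symmetric] by simp
    also have "\<dots> = kernel_form G K c0 c0 - cnj B * B / K j j"
      using False by (simp add: t_def r field_simps)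
    finally have "kernel_form G ?K c0 c0
        = kernel_form G K (\<lambda>n. c0 n + (if n = j then t else 0)) (\<lambda>n. c0 n + (if n = j then t else 0))"
      unfolding S by simp
    then show ?thesis using K G(1) unfolding eq psd_kernel_def by metis
  qed
qed

primrec schur_iterate :: "(nat \<Rightarrow> nat \<Rightarrow> complex) \<Rightarrow> nat \<Rightarrow> nat \<Rightarrow> nat \<Rightarrow> complex" where
  "schur_iterate K 0 = K"
| "schur_iterate K (Suc j) = schur_complement j (schur_iterate K j)"

lemma psd_schur_iterate: "psd_kernel K \<Longrightarrow> psd_kernel (schur_iterate K j)"
  by (induction j) (simp_all add: psd_schur_complement)

lemma schur_iterate_eliminated:
  assumes K: "psd_kernel K" and "i < j"
  shows "schur_iterate K j i n = 0" "schur_iterate K j n i = 0"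
proof -
  show row: "schur_iterate K j i n = 0" for n
    using assms(2)
  proof (induction j arbitrary: n)
    case (Suc j)
    have z: "schur_iterate K j j j = 0 \<Longrightarrow> schur_iterate K j j n = 0"
      using psd_kernel_zero_row[OF psd_schur_iterate[OF K]] by blast
    show ?case
    proof (cases "i = j")
      case True
      then show ?thesis using z by (cases "schur_iterate K j j j = 0") (simp_all add: schur_complement_def)
    next
      case False
      then show ?thesis using Suc by (simp add: schur_complement_def)
    qed
  qed simp
  show "schur_iterate K j n i = 0"
    using psd_kernel_hermitian[OF psd_schur_iterate[OF K], of j i n] row by simp
qed

text \<open>These vectors are the columns of the Cholesky factor of the kernel.\<close>

definition kernel_vector :: "(nat \<Rightarrow> nat \<Rightarrow> complex) \<Rightarrow> nat \<Rightarrow> nat \<Rightarrow> complex" where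
  "kernel_vector K n j = schur_iterate K j j n / of_real (sqrt (Re (schur_iterate K j j j)))"

lemma kernel_vector_support: "psd_kernel K \<Longrightarrow> n < j \<Longrightarrow> kernel_vector K n j = 0"
  by (simp add: kernel_vector_def schur_iterate_eliminated)

lemma kernel_vector_l2: "psd_kernel K \<Longrightarrow> kernel_vector K n \<in> l2"
  by (rule l2_finite_support[of "{..n}"]) (simp_all add: kernel_vector_support)

text \<open>Each coordinate accounts for the difference of two consecutive Schur complements, and the sum
  telescopes until the complement is 0 in column \<open>n\<close>.\<close>

lemma ip_kernel_vector:
  assumes K: "psd_kernel K"
  shows "ip (kernel_vector K m) (kernel_vector K n) = K m n"
proof -
  let ?v = "kernel_vector K" and ?S = "schur_iterate K"
  have step: "cnj (?v m j) * ?v n j = ?S j m n - ?S (Suc j) m n" for j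
  proof -
    let ?d = "Re (?S j j j)"
    have d: "?S j j j = of_real ?d" "0 \<le> ?d"
      using psd_kernel_diag[OF psd_schur_iterate[OF K]] by auto
    have "cnj (?v m j) * ?v n j = cnj (?S j j m) * ?S j j n / (of_real (sqrt ?d) * of_real (sqrt ?d))"
      by (simp add: kernel_vector_def)
    also have "\<dots> = ?S j m j * ?S j j n / ?S j j j"
      using d psd_kernel_hermitian[OF psd_schur_iterate[OF K]] by (simp flip: of_real_mult)
    finally show ?thesis by (simp add: schur_complement_def)
  qed
  have "ip (?v m) (?v n) = (\<Sum>j<Suc n. cnj (?v m j) * ?v n j)"
    unfolding ip_def by (rule suminf_finite) (auto simp: kernel_vector_support[OF K])
  also have "\<dots> = ?S 0 m n - ?S (Suc n) m n"
    unfolding step by (rule sum_lessThan_telescope')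
  also have "\<dots> = K m n" by (simp add: schur_iterate_eliminated[OF K] del: schur_iterate.simps(2))
  finally show ?thesis .
qed

lemma l2_sum: "finite F \<Longrightarrow> (\<And>n. n \<in> F \<Longrightarrow> x n \<in> l2) \<Longrightarrow> (\<lambda>i. \<Sum>n\<in>F. c n * x n i) \<in> l2"
  by (induction F rule: finite_induct) (simp_all add: l2_zero l2_add l2_scale)

lemma ip_sum_left:
  assumes "finite F" "\<And>n. n \<in> F \<Longrightarrow> x n \<in> l2" "y \<in> l2"
  shows "ip (\<lambda>i. \<Sum>n\<in>F. c n * x n i) y = (\<Sum>n\<in>F. cnj (c n) * ip (x n) y)"
  using assms(1,2)
proof (induction F rule: finite_induct)
  case (insert n F)
  then show ?case
    using ip_add_left[OF l2_scale l2_sum assms(3), of "x n" F x "c n" c] assms(3)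
    by (simp add: ip_scale_left)
qed (simp add: ip_def)

lemma ip_sum_right:
  assumes "finite F" "\<And>n. n \<in> F \<Longrightarrow> x n \<in> l2" "y \<in> l2"
  shows "ip y (\<lambda>i. \<Sum>n\<in>F. c n * x n i) = (\<Sum>n\<in>F. c n * ip y (x n))"
  using assms(1,2)
proof (induction F rule: finite_induct)
  case (insert n F)
  then show ?case
    using ip_add_right[OF assms(3) l2_scale l2_sum, of "x n" F x "c n" c] assms(3)
    by (simp add: ip_scale_right)
qed (simp add: ip_def)

text \<open>By the triangular shape of the decomposition, the unit vectors of the occurring coordinates are
  finite combinations of the kernel vectors.\<close>

lemma kernel_vector_unit:
  assumes K: "psd_kernel K"
  shows "\<exists>c. (\<forall>j n. j < n \<longrightarrow> c j n = 0) \<and>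
    (\<forall>j i. (\<Sum>n\<le>j. c j n * kernel_vector K n i) = (if i = j \<and> schur_iterate K j j j \<noteq> 0 then 1 else 0))"
proof -
  let ?v = "kernel_vector K" and ?S = "schur_iterate K"
  have "\<exists>c. (\<forall>n>j. c n = 0) \<and> (\<forall>i. (\<Sum>n\<le>j. c n * ?v n i) = (if i = j \<and> ?S j j j \<noteq> 0 then 1 else 0))" for j
  proof (induction j rule: less_induct)
    case (less j)
    show ?case
    proof (cases "?S j j j = 0")
      case True
      then show ?thesis by (intro exI[of _ "\<lambda>_. 0"]) simp
    next
      case False
      obtain b where b: "\<And>k n. k < j \<Longrightarrow> k < n \<Longrightarrow> b k n = 0"
        "\<And>k i. k < j \<Longrightarrow> (\<Sum>n\<le>k. b k n * ?v n i) = (if i = k \<and> ?S k k k \<noteq> 0 then 1 else 0)"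
        using less.IH by metis
      define s where "s = ?v j j"
      have d: "?S j j j = of_real (Re (?S j j j))" "0 \<le> Re (?S j j j)"
        using psd_kernel_diag[OF psd_schur_iterate[OF K]] by auto
      have s: "s \<noteq> 0" using False d by (auto simp: s_def kernel_vector_def complex_eq_iff)
      define c where "c n = ((if n = j then 1 else 0) - (\<Sum>k<j. ?v j k * b k n)) / s" for n
      have "c n = 0" if "n > j" for n using b(1) that by (auto simp: c_def)
      moreover have "(\<Sum>n\<le>j. c n * ?v n i) = (if i = j then 1 else 0)" for i
      proof -
        have bk: "(\<Sum>n\<le>j. b k n * ?v n i) = (if i = k \<and> ?S k k k \<noteq> 0 then 1 else 0)" if "k < j" for k
        proof -
          have "(\<Sum>n\<le>j. b k n * ?v n i) = (\<Sum>n\<le>k. b k n * ?v n i)"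
            using that b(1) by (intro sum.mono_neutral_right) auto
          then show ?thesis using b(2)[OF that] by simp
        qed
        have "s * (\<Sum>n\<le>j. c n * ?v n i) = (\<Sum>n\<le>j. (if n = j then ?v n i else 0) - (\<Sum>k<j. ?v j k * b k n) * ?v n i)"
          using s unfolding sum_distrib_left by (intro sum.cong refl) (simp add: c_def left_diff_distrib)
        also have "\<dots> = ?v j i - (\<Sum>n\<le>j. \<Sum>k<j. ?v j k * (b k n * ?v n i))"
          by (simp add: sum_subtractf sum_distrib_right mult.assoc)
        also have "(\<Sum>n\<le>j. \<Sum>k<j. ?v j k * (b k n * ?v n i)) = (\<Sum>k<j. ?v j k * (\<Sum>n\<le>j. b k n * ?v n i))"
          by (subst sum.swap) (simp add: sum_distrib_left)
        also have "\<dots> = (\<Sum>k<j. if k = i then ?v j k else 0)"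
        proof (intro sum.cong refl)
          fix k assume "k \<in> {..<j}"
          moreover have "?v j k = 0" if "?S k k k = 0"
            using psd_kernel_zero_row[OF psd_schur_iterate[OF K] that] by (simp add: kernel_vector_def)
          ultimately show "?v j k * (\<Sum>n\<le>j. b k n * ?v n i) = (if k = i then ?v j k else 0)"
            using bk by auto
        qed
        also have "\<dots> = (if i < j then ?v j i else 0)" by simp
        finally have "s * (\<Sum>n\<le>j. c n * ?v n i) = (if i = j then s else 0)"
          using kernel_vector_support[OF K, of j i] by (auto simp: s_def)
        then show ?thesis using s by (auto split: if_splits)
      qed
      ultimately show ?thesis using False by (intro exI[of _ c]) auto
    qed
  qed
  then show ?thesis by metis
qed

text \<open>Iterating \<open>sq\<close> gives \<open>(a 1 / a 0) ^ (2 ^ k) \<le> a (2 ^ k) / a 0\<close>. The right-hand side is of order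
  \<open>r ^ (2 ^ k)\<close>, and \<open>2 ^ k\<close>-th roots for large \<open>k\<close> give the claim.\<close>

lemma growth_bound:
  fixes a :: "nat \<Rightarrow> real"
  assumes a: "\<And>n. 0 \<le> a n" and sq: "\<And>n. (a n)\<^sup>2 \<le> a 0 * a (2 * n)"
    and D: "\<And>n. a n \<le> D * r ^ n" and r: "r > 0"
  shows "a 1 \<le> r * a 0"
proof (cases "a 0 = 0")
  case True
  then show ?thesis using sq[of 1] by simp
next
  case False
  then have a0: "a 0 > 0" using a[of 0] by simp
  define b where "b k = a (2 ^ k) / (a 0 * r ^ (2 ^ k))" for k
  have b0: "0 \<le> b k" for k using a a0 r by (simp add: b_def)
  have step: "(b k)\<^sup>2 \<le> b (Suc k)" for k
  proof -
    have "(b k)\<^sup>2 = (a (2 ^ k))\<^sup>2 / ((a 0)\<^sup>2 * r ^ (2 ^ Suc k))"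
      by (simp add: b_def power_divide power_mult_distrib power_mult mult.commute flip: power_mult)
    also have "\<dots> \<le> (a 0 * a (2 ^ Suc k)) / ((a 0)\<^sup>2 * r ^ (2 ^ Suc k))"
      using sq[of "2 ^ k"] a0 r by (intro divide_right_mono) auto
    also have "\<dots> = b (Suc k)" using a0 by (simp add: b_def power2_eq_square)
    finally show ?thesis .
  qed
  have pw: "b 0 ^ (2 ^ k) \<le> b k" for k
  proof (induction k)
    case (Suc k)
    have "b 0 ^ (2 ^ Suc k) = (b 0 ^ (2 ^ k))\<^sup>2" by (simp add: power_mult mult.commute flip: power_mult)
    also have "\<dots> \<le> (b k)\<^sup>2" using Suc b0 by (intro power_mono) auto
    finally show ?case using step[of k] by linarith
  qed simp
  have bD: "b k \<le> D / a 0" for k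
    using D[of "2 ^ k"] a0 r by (simp add: b_def field_simps)
  have "b 0 \<le> 1"
  proof (rule ccontr)
    assume "\<not> b 0 \<le> 1"
    then have b1: "b 0 > 1" by simp
    then obtain n where n: "D / a 0 < b 0 ^ n" using real_arch_pow by blast
    also have "b 0 ^ n \<le> b 0 ^ (2 ^ n)" using b1 by (intro power_increasing) (auto intro: less_imp_le)
    also have "\<dots> \<le> D / a 0" using pw[of n] bD[of n] by linarith
    finally show False by simp
  qed
  then show ?thesis using a0 r by (simp add: b_def field_simps)
qed

text \<open>A map \<open>s\<close> of the indices that is symmetric for the kernel acts on the kernel vectors as a
  symmetric operator \<open>S\<close>. Exponential growth of its moments makes it bounded, because
  \<open>\<langle>f, S\<^sup>2\<^sup>n f\<rangle>\<^sup>2 \<le> \<langle>f, f\<rangle> \<langle>f, S\<^sup>4\<^sup>n f\<rangle>\<close> by the Cauchy-Schwarz inequality.\<close>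

lemma kernel_shift_bounded:
  assumes K: "psd_kernel K" and sym: "\<And>m n. K (s m) n = K m (s n)" and r: "r > 0"
    and growth: "\<And>m n. \<exists>D. \<forall>k. cmod (K m ((s ^^ k) n)) \<le> D * r ^ k" and F: "finite F"
  shows "l2norm (\<lambda>i. \<Sum>n\<in>F. c n * kernel_vector K (s n) i) \<le> r * l2norm (\<lambda>i. \<Sum>n\<in>F. c n * kernel_vector K n i)"
proof -
  let ?v = "kernel_vector K"
  define f where "f k = (\<lambda>i. \<Sum>n\<in>F. c n * ?v ((s ^^ k) n) i)" for k
  define a where "a k = (l2norm (f k))\<^sup>2" for k
  have fl2: "f k \<in> l2" for k
    unfolding f_def by (rule l2_sum[OF F]) (rule kernel_vector_l2[OF K])
  have pw: "K ((s ^^ k) m) n = K m ((s ^^ k) n)" for k m n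
    by (induction k arbitrary: m n) (simp_all add: sym funpow_swap1)
  have ipf: "ip (f k) (f l) = (\<Sum>m\<in>F. \<Sum>n\<in>F. cnj (c m) * c n * K m ((s ^^ (k + l)) n))" for k l
  proof -
    have "ip (f k) (f l) = (\<Sum>m\<in>F. cnj (c m) * ip (?v ((s ^^ k) m)) (f l))"
      unfolding f_def[of k] by (rule ip_sum_left[OF F kernel_vector_l2[OF K] fl2])
    also have "\<dots> = (\<Sum>m\<in>F. \<Sum>n\<in>F. cnj (c m) * c n * K m ((s ^^ (k + l)) n))"
    proof (intro sum.cong refl)
      fix m
      have "ip (?v ((s ^^ k) m)) (f l) = (\<Sum>n\<in>F. c n * ip (?v ((s ^^ k) m)) (?v ((s ^^ l) n)))"
        unfolding f_def by (rule ip_sum_right[OF F kernel_vector_l2[OF K] kernel_vector_l2[OF K]])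
      then show "cnj (c m) * ip (?v ((s ^^ k) m)) (f l) = (\<Sum>n\<in>F. cnj (c m) * c n * K m ((s ^^ (k + l)) n))"
        by (simp add: ip_kernel_vector[OF K] pw sum_distrib_left mult.assoc funpow_add)
    qed
    finally show ?thesis .
  qed
  have acm: "a k = cmod (ip (f k) (f k))" for k
    unfolding a_def ip_self[OF fl2] norm_of_real by simp
  obtain D where D: "\<And>m n k. cmod (K m ((s ^^ k) n)) \<le> D m n * r ^ k"
    using growth by metis
  have "a 1 \<le> r\<^sup>2 * a 0"
  proof (rule growth_bound[where D = "\<Sum>m\<in>F. \<Sum>n\<in>F. cmod (c m) * cmod (c n) * D m n"])
    show "0 \<le> a n" for n by (simp add: a_def)
    show "(a n)\<^sup>2 \<le> a 0 * a (2 * n)" for n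
    proof -
      have "ip (f n) (f n) = ip (f 0) (f (2 * n))" unfolding ipf by (simp add: mult_2)
      then have "a n \<le> l2norm (f 0) * l2norm (f (2 * n))"
        unfolding acm using ip_Cauchy_Schwarz[OF fl2 fl2] by simp
      then have "(a n)\<^sup>2 \<le> (l2norm (f 0) * l2norm (f (2 * n)))\<^sup>2"
        by (intro power_mono) (auto simp: a_def)
      then show ?thesis by (simp add: a_def power_mult_distrib)
    qed
    show "a k \<le> (\<Sum>m\<in>F. \<Sum>n\<in>F. cmod (c m) * cmod (c n) * D m n) * r\<^sup>2 ^ k" for k
    proof -
      have "a k \<le> (\<Sum>m\<in>F. \<Sum>n\<in>F. cmod (cnj (c m) * c n * K m ((s ^^ (k + k)) n)))"
        unfolding acm ipf by (intro order_trans[OF norm_sum] sum_mono norm_sum)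
      also have "\<dots> \<le> (\<Sum>m\<in>F. \<Sum>n\<in>F. cmod (c m) * cmod (c n) * (D m n * r ^ (k + k)))"
        unfolding norm_mult complex_mod_cnj by (intro sum_mono mult_left_mono D) auto
      also have "\<dots> = (\<Sum>m\<in>F. \<Sum>n\<in>F. cmod (c m) * cmod (c n) * D m n) * r\<^sup>2 ^ k"
        by (simp add: sum_distrib_right mult.assoc mult_2 flip: power_mult)
      finally show ?thesis .
    qed
    show "r\<^sup>2 > 0" using r by simp
  qed
  then have "(l2norm (f 1))\<^sup>2 \<le> (r * l2norm (f 0))\<^sup>2" by (simp add: a_def power_mult_distrib)
  then have "l2norm (f 1) \<le> r * l2norm (f 0)"
    by (rule power2_le_imp_le) (use r fl2 in simp)
  then show ?thesis by (simp add: f_def)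
qed

subsection \<open>Operators given by Hermitian matrices\<close>

definition truncate :: "nat \<Rightarrow> (nat \<Rightarrow> complex) \<Rightarrow> nat \<Rightarrow> complex" where
  "truncate J x = (\<lambda>j. if j < J then x j else 0)"

lemma truncate_l2: "truncate J x \<in> l2"
  by (rule l2_finite_support[of "{..<J}"]) (auto simp: truncate_def)

lemma ip_truncate: "ip (truncate J x) y = (\<Sum>j<J. cnj (x j) * y j)"
  "ip y (truncate J x) = (\<Sum>j<J. cnj (y j) * x j)"
  unfolding ip_def by (subst suminf_finite[of "{..<J}"]; simp add: truncate_def)+

lemma l2norm_truncate: "(l2norm (truncate J x))\<^sup>2 = (\<Sum>j<J. (cmod (x j))\<^sup>2)"
  unfolding l2norm_power2[OF truncate_l2]
  by (subst suminf_finite[of "{..<J}"]) (simp_all add: truncate_def)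

lemma truncate_tendsto:
  assumes x: "x \<in> l2"
  shows "(\<lambda>J. l2norm (\<lambda>j. x j - truncate J x j)) \<longlonglongrightarrow> 0"
proof -
  have s: "summable (\<lambda>j. (cmod (x j))\<^sup>2)" using x by (simp add: l2_def)
  have "(l2norm (\<lambda>j. x j - truncate J x j))\<^sup>2 = (\<Sum>j. (cmod (x j))\<^sup>2) - (\<Sum>j<J. (cmod (x j))\<^sup>2)" for J
  proof -
    have st: "summable (\<lambda>j. (cmod (truncate J x j))\<^sup>2)" using truncate_l2[of J x] by (simp add: l2_def)
    have "(cmod (x j - truncate J x j))\<^sup>2 = (cmod (x j))\<^sup>2 - (cmod (truncate J x j))\<^sup>2" for j
      by (simp add: truncate_def)
    then have "(l2norm (\<lambda>j. x j - truncate J x j))\<^sup>2 = (\<Sum>j. (cmod (x j))\<^sup>2) - (\<Sum>j. (cmod (truncate J x j))\<^sup>2)"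
      unfolding l2norm_power2[OF l2_diff[OF x truncate_l2]] using suminf_diff[OF s st] by simp
    then show ?thesis using l2norm_truncate[of J x] unfolding l2norm_power2[OF truncate_l2] by simp
  qed
  moreover have "(\<lambda>J. (\<Sum>j. (cmod (x j))\<^sup>2) - (\<Sum>j<J. (cmod (x j))\<^sup>2)) \<longlonglongrightarrow> 0"
    using tendsto_diff[OF tendsto_const[of "\<Sum>j. (cmod (x j))\<^sup>2"] summable_LIMSEQ[OF s]] by simp
  ultimately have "(\<lambda>J. (l2norm (\<lambda>j. x j - truncate J x j))\<^sup>2) \<longlonglongrightarrow> 0" by simp
  then have "(\<lambda>J. sqrt ((l2norm (\<lambda>j. x j - truncate J x j))\<^sup>2)) \<longlonglongrightarrow> sqrt 0"
    by (rule tendsto_real_sqrt)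
  then show ?thesis using l2_diff[OF x truncate_l2] by simp
qed

text \<open>The coordinates of \<open>T f\<close> are pairings of \<open>f\<close> with the rows of the matrix \<open>t\<close>. The bound on
  finitely supported sequences bounds all partial sums of the norm of \<open>T f\<close>, and symmetry, which is
  algebra for a truncated \<open>g\<close>, extends to all \<open>g\<close> by continuity.\<close>

lemma hermitian_matrix_operator:
  assumes t: "\<And>j. t j \<in> l2" and herm: "\<And>j k. t j k = cnj (t k j)"
    and bound: "\<And>J y. l2norm (\<lambda>i. \<Sum>j<J. y j * t j i) \<le> r * l2norm (truncate J y)" and r: "r > 0"
  defines "T \<equiv> \<lambda>f. if f \<in> l2 then (\<lambda>j. ip (t j) f) else (\<lambda>_. 0)"
  shows "adjoint_pair T T"
proof -
  have tl2: "(\<lambda>i. \<Sum>j<J. y j * t j i) \<in> l2" for J y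
    using t by (intro l2_sum) auto
  have part: "(\<Sum>j<J. cmod (T f j) ^ 2) \<le> (r * l2norm f)\<^sup>2" if f: "f \<in> l2" for f J
  proof -
    define y where "y j = ip (t j) f" for j
    define S where "S = l2norm (truncate J y)"
    have S0: "0 \<le> S" using truncate_l2 by (simp add: S_def)
    have "of_real (S\<^sup>2) = (\<Sum>j<J. cnj (y j) * y j)"
      unfolding S_def l2norm_truncate of_real_sum
      by (intro sum.cong refl) (simp only: complex_norm_square mult.commute)
    also have "\<dots> = ip (\<lambda>i. \<Sum>j<J. y j * t j i) f"
      using ip_sum_left[of "{..<J}" t f y] t f by (simp add: y_def)
    finally have "S\<^sup>2 = cmod (ip (\<lambda>i. \<Sum>j<J. y j * t j i) f)"
      by (metis norm_of_real abs_of_nonneg zero_le_power2)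
    also have "\<dots> \<le> (r * S) * l2norm f"
      using ip_Cauchy_Schwarz[OF tl2[of y J] f] mult_right_mono[OF bound[of y J] l2norm_nonneg[OF f]]
      unfolding S_def by linarith
    finally have "S * S \<le> (r * l2norm f) * S" by (simp add: power2_eq_square mult_ac)
    then have "S \<le> r * l2norm f"
      using S0 r f by (cases "S = 0") auto
    then have "S\<^sup>2 \<le> (r * l2norm f)\<^sup>2" using S0 by (intro power_mono)
    then show ?thesis using f by (simp add: S_def l2norm_truncate y_def T_def)
  qed
  have rf: "0 \<le> r * l2norm f" if "f \<in> l2" for f using r that by simp
  have Tl2: "T f \<in> l2" and Tb: "l2norm (T f) \<le> r * l2norm f" if f: "f \<in> l2" for f
    using l2I_partial_sums[of "T f", OF part[OF f] rf[OF f]] by blast+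
  have "bounded_on_l2 T"
    unfolding bounded_on_l2_def using Tl2 Tb r by (auto simp: T_def intro!: exI[of _ r])
  moreover have "ip (T g) f = ip g (T f)" if f: "f \<in> l2" and g: "g \<in> l2" for f g
  proof -
    have trunc: "ip (truncate J g) (T f) = ip (T (truncate J g)) f" for J
    proof -
      have "T (truncate J g) = (\<lambda>k. \<Sum>j<J. g j * t j k)"
      proof
        fix k
        have "T (truncate J g) k = (\<Sum>j<J. cnj (t k j) * g j)"
          by (simp add: T_def truncate_l2 ip_truncate)
        also have "\<dots> = (\<Sum>j<J. g j * t j k)"
          by (intro sum.cong refl) (subst herm, simp)
        finally show "T (truncate J g) k = (\<Sum>j<J. g j * t j k)" .
      qed
      then show ?thesis
        using ip_sum_left[of "{..<J}" t f g] t f by (simp add: ip_truncate T_def)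
    qed
    have "(\<lambda>J. ip (truncate J g) (T f)) \<longlonglongrightarrow> ip g (T f)"
      unfolding ip_truncate unfolding ip_def by (rule summable_LIMSEQ[OF summable_ip[OF g Tl2[OF f]]])
    moreover have "(\<lambda>J. ip (T (truncate J g)) f - ip (T g) f) \<longlonglongrightarrow> 0"
    proof (rule tendsto_0_le[where K = 1])
      let ?d = "\<lambda>J j. g j - truncate J g j"
      have "(\<lambda>J. r * l2norm (?d J) * l2norm f) \<longlonglongrightarrow> r * 0 * l2norm f"
        by (intro tendsto_mult tendsto_const truncate_tendsto[OF g])
      then show "(\<lambda>J. r * l2norm (?d J) * l2norm f) \<longlonglongrightarrow> 0" by simp
      have "norm (ip (T (truncate J g)) f - ip (T g) f) \<le> norm (r * l2norm (?d J) * l2norm f) * 1" for J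
      proof -
        have dl2: "?d J \<in> l2" using l2_diff[OF g truncate_l2] .
        have "T g = (\<lambda>j. T (truncate J g) j + T (?d J) j)"
          using g truncate_l2[of J g] dl2 by (auto simp: T_def ip_diff_right t)
        then have "ip (T g) f = ip (T (truncate J g)) f + ip (T (?d J)) f"
          using ip_add_left[OF Tl2[OF truncate_l2] Tl2[OF dl2] f] by simp
        then have "norm (ip (T (truncate J g)) f - ip (T g) f) = cmod (ip (T (?d J)) f)"
          by (simp add: norm_minus_commute)
        also have "\<dots> \<le> (r * l2norm (?d J)) * l2norm f"
          using ip_Cauchy_Schwarz[OF Tl2[OF dl2] f] mult_right_mono[OF Tb[OF dl2] l2norm_nonneg[OF f]]
          by linarith
        also have "\<dots> \<le> norm (r * l2norm (?d J) * l2norm f) * 1" by simp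
        finally show ?thesis .
      qed
      then show "\<forall>\<^sub>F J in sequentially. norm (ip (T (truncate J g)) f - ip (T g) f)
          \<le> norm (r * l2norm (?d J) * l2norm f) * 1" by simp
    qed
    then have "(\<lambda>J. ip (truncate J g) (T f)) \<longlonglongrightarrow> ip (T g) f"
      unfolding trunc by (rule LIM_zero_cancel)
    ultimately show ?thesis by (rule LIMSEQ_unique[symmetric])
  qed
  ultimately show ?thesis unfolding adjoint_pair_def by blast
qed

text \<open>The operator is given by its matrix: column \<open>j\<close> is the image of the \<open>j\<close>-th unit vector, computed
  from a representation of the unit vector by kernel vectors.\<close>

lemma kernel_shift_operator:
  assumes K: "psd_kernel K" and sym: "\<And>m n. K (s m) n = K m (s n)" and r: "r > 0"
    and growth: "\<And>m n. \<exists>D. \<forall>k. cmod (K m ((s ^^ k) n)) \<le> D * r ^ k"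
  shows "\<exists>T. adjoint_pair T T \<and> (\<forall>n. T (kernel_vector K n) = kernel_vector K (s n))"
proof -
  let ?v = "kernel_vector K" and ?d = "\<lambda>j. schur_iterate K j j j"
  obtain c where c0: "\<And>j n. j < n \<Longrightarrow> c j n = 0"
    and cu: "\<And>j i. (\<Sum>n\<le>j. c j n * ?v n i) = (if i = j \<and> ?d j \<noteq> 0 then 1 else 0)"
    using kernel_vector_unit[OF K] by blast
  define t where "t j = (\<lambda>i. \<Sum>n\<le>j. c j n * ?v (s n) i)" for j
  define e where "e j = (\<lambda>i. \<Sum>n\<le>j. c j n * ?v n i)" for j
  have v: "?v n \<in> l2" for n by (rule kernel_vector_l2[OF K])
  have tl2: "t j \<in> l2" and el2: "e j \<in> l2" for j
    unfolding t_def e_def by (rule l2_sum; simp add: v)+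
  \<comment> \<open>Pairing with \<open>e j\<close> reads off the \<open>j\<close>-th coordinate; if \<open>e j\<close> is 0, so is that
    coordinate of every kernel vector.\<close>
  have coord: "ip (e j) (?v n) = ?v n j" for j n
  proof (cases "?d j = 0")
    case True
    then have "e j = (\<lambda>_. 0)" by (simp add: e_def cu)
    moreover have "?v n j = 0"
      using psd_kernel_zero_row[OF psd_schur_iterate[OF K] True] by (simp add: kernel_vector_def)
    ultimately show ?thesis by (simp add: ip_def)
  next
    case False
    have "e j i = (if i = j then 1 else 0)" for i using cu[of j i] False by (simp add: e_def)
    then have "ip (e j) (?v n) = (\<Sum>i\<in>{j}. cnj (e j i) * ?v n i)"
      unfolding ip_def by (intro suminf_finite) auto
    then show ?thesis using \<open>\<And>i. e j i = (if i = j then 1 else 0)\<close> by simp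
  qed
  have coord': "?v n j = (\<Sum>m\<le>j. cnj (c j m) * K m n)" for n j
  proof -
    have "ip (e j) (?v n) = (\<Sum>m\<le>j. cnj (c j m) * ip (?v m) (?v n))"
      unfolding e_def by (rule ip_sum_left) (simp_all add: v)
    then show ?thesis by (simp add: coord ip_kernel_vector[OF K])
  qed
  have herm: "t j k = cnj (t k j)" for j k
  proof -
    have tjk: "t j k = (\<Sum>n\<le>j. \<Sum>m\<le>k. c j n * cnj (c k m) * K m (s n))" for j k
      unfolding t_def coord' by (simp add: sum_distrib_left mult.assoc)
    have "cnj (t k j) = (\<Sum>m\<le>k. \<Sum>n\<le>j. c j n * cnj (c k m) * cnj (K n (s m)))"
      unfolding tjk by (simp add: mult_ac)
    also have "\<dots> = (\<Sum>n\<le>j. \<Sum>m\<le>k. c j n * cnj (c k m) * K m (s n))"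
      by (subst sum.swap) (simp add: psd_kernel_hermitian[OF K] sym)
    finally show ?thesis by (simp add: tjk)
  qed
  have bound: "l2norm (\<lambda>i. \<Sum>j<J. y j * t j i) \<le> r * l2norm (truncate J y)" for J y
  proof -
    define d where "d n = (\<Sum>j<J. y j * c j n)" for n
    have swap: "(\<Sum>j<J. y j * (\<Sum>n\<le>j. c j n * u n)) = (\<Sum>n<J. d n * u n)" for u :: "nat \<Rightarrow> complex"
    proof -
      have "(\<Sum>n\<le>j. c j n * u n) = (\<Sum>n<J. c j n * u n)" if "j < J" for j
        using that c0 by (intro sum.mono_neutral_left) auto
      then have "(\<Sum>j<J. y j * (\<Sum>n\<le>j. c j n * u n)) = (\<Sum>j<J. \<Sum>n<J. y j * c j n * u n)"
        by (simp add: sum_distrib_left mult.assoc)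
      also have "\<dots> = (\<Sum>n<J. d n * u n)"
        by (subst sum.swap) (simp add: d_def sum_distrib_right)
      finally show ?thesis .
    qed
    have "l2norm (\<lambda>i. \<Sum>j<J. y j * t j i) \<le> r * l2norm (\<lambda>i. \<Sum>j<J. y j * e j i)"
      unfolding t_def e_def swap by (rule kernel_shift_bounded[OF K sym r growth]) simp
    also have "\<dots> \<le> r * l2norm (truncate J y)"
    proof (rule mult_left_mono)
      have ye: "(\<Sum>j<J. y j * e j i) = (if ?d i \<noteq> 0 then truncate J y i else 0)" for i
      proof -
        have "(\<Sum>j<J. y j * e j i) = (\<Sum>j<J. if j = i then (if ?d j \<noteq> 0 then y j else 0) else 0)"
          by (intro sum.cong refl) (simp add: e_def cu)
        then show ?thesis by (simp add: truncate_def)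
      qed
      have "(\<Sum>i<I. (cmod (\<Sum>j<J. y j * e j i))\<^sup>2) \<le> (l2norm (truncate J y))\<^sup>2" for I
      proof -
        have "(\<Sum>i<I. (cmod (\<Sum>j<J. y j * e j i))\<^sup>2) \<le> (\<Sum>i<I. (cmod (truncate J y i))\<^sup>2)"
          unfolding ye by (intro sum_mono) simp
        then show ?thesis using l2_partial_sums_le[OF truncate_l2[of J y], of I] by linarith
      qed
      then show "l2norm (\<lambda>i. \<Sum>j<J. y j * e j i) \<le> l2norm (truncate J y)"
        by (rule l2I_partial_sums(2)) (simp add: truncate_l2)
    qed (use r in simp)
    finally show ?thesis .
  qed
  define T where "T = (\<lambda>f. if f \<in> l2 then (\<lambda>j. ip (t j) f) else (\<lambda>_. 0))"
  have "adjoint_pair T T"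
    unfolding T_def by (rule hermitian_matrix_operator[OF tl2 herm bound r])
  moreover have "T (?v n) = ?v (s n)" for n
  proof
    fix j
    have "T (?v n) j = (\<Sum>m\<le>j. cnj (c j m) * ip (?v (s m)) (?v n))"
      unfolding T_def t_def using v[of n] by (simp add: ip_sum_left v)
    also have "\<dots> = ?v (s n) j" by (simp add: coord' ip_kernel_vector[OF K] sym)
    finally show "T (?v n) j = ?v (s n) j" .
  qed
  ultimately show ?thesis by blast
qed

subsection \<open>The Gelfand-Naimark-Segal representation of a moment functional\<close>

text \<open>Words are the indices of the kernel \<open>M (rev u @ w)\<close>. Putting a letter in front of a word is
  symmetric for it, so that letters act as bounded symmetric operators, and a product of them maps
  the vector of the empty word to the vector of the product.\<close>

theorem moment_realization:
  fixes M :: "nat list \<Rightarrow> complex" and r :: "nat \<Rightarrow> real"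
  assumes one: "M [] = 1"
    and pos: "\<And>F c. finite F \<Longrightarrow> (\<Sum>u\<in>F. \<Sum>w\<in>F. cnj (c u) * c w * M (rev u @ w)) \<in> \<real>\<^sub>\<ge>\<^sub>0"
    and r: "\<And>i. r i > 0"
    and growth: "\<And>i u w. \<exists>D. \<forall>k. cmod (M (u @ replicate k i @ w)) \<le> D * r i ^ k"
  shows "\<exists>b z. z \<in> l2 \<and> l2norm z = 1 \<and> (\<forall>i. b i \<in> l2_operators) \<and>
    (\<forall>js. ip z (lprod B_l2 (map b js) z) = M js)"
proof -
  define K where "K m n = M (rev (list_decode m) @ list_decode n)" for m n
  define s where "s i n = list_encode (i # list_decode n)" for i n
  have "psd_kernel K"
    unfolding psd_kernel_def
  proof (intro allI impI)
    fix F :: "nat set" and c :: "nat \<Rightarrow> complex"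
    assume F: "finite F"
    have inj: "inj_on list_decode F" by (metis inj_on_inverseI list_decode_inverse)
    have "kernel_form F K c c = (\<Sum>u\<in>list_decode ` F. \<Sum>w\<in>list_decode ` F.
        cnj (c (list_encode u)) * c (list_encode w) * M (rev u @ w))"
      by (simp add: sum.reindex[OF inj] kernel_form_def K_def)
    then show "kernel_form F K c c \<in> \<real>\<^sub>\<ge>\<^sub>0"
      using pos[of "list_decode ` F" "\<lambda>u. c (list_encode u)"] F by simp
  qed
  note K = this
  have sym: "K (s i m) n = K m (s i n)" for i m n by (simp add: K_def s_def)
  have dec: "list_decode ((s i ^^ k) n) = replicate k i @ list_decode n" for i k n
    by (induction k) (simp_all add: s_def)
  have gr: "\<exists>D. \<forall>k. cmod (K m ((s i ^^ k) n)) \<le> D * r i ^ k" for i m n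
    using growth[of "rev (list_decode m)" i "list_decode n"] by (simp add: K_def dec)
  have "\<exists>T. adjoint_pair T T \<and> (\<forall>n. T (kernel_vector K n) = kernel_vector K (s i n))" for i
    by (rule kernel_shift_operator[OF K sym r gr])
  then obtain b where b: "\<And>i. adjoint_pair (b i) (b i)"
    "\<And>i n. b i (kernel_vector K n) = kernel_vector K (s i n)" by metis
  define z where "z = kernel_vector K (list_encode [])"
  have zl2: "z \<in> l2" unfolding z_def by (rule kernel_vector_l2[OF K])
  have word: "lprod B_l2 (map b js) z = kernel_vector K (list_encode js)" for js
  proof (induction js)
    case Nil
    then show ?case using zl2 by (simp add: lprod_def z_def)
  next
    case (Cons i js)
    then show ?case using b(2)[of i "list_encode js"] by (simp add: lprod_def s_def)
  qed
  have moments: "ip z (lprod B_l2 (map b js) z) = M js" for js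
    unfolding word unfolding z_def ip_kernel_vector[OF K] by (simp add: K_def del: list_encode.simps)
  have "of_real ((l2norm z)\<^sup>2) = (1 :: complex)"
    unfolding ip_self[OF zl2, symmetric] using moments[of "[]"] zl2 one by (simp add: lprod_def)
  then have "(l2norm z)\<^sup>2 = 1" by (metis of_real_eq_1_iff)
  then have "l2norm z = 1" using l2norm_nonneg[OF zl2] by (simp add: power2_eq_1_iff)
  then show ?thesis
    using zl2 b(1) adjoint_pair_imp_operator moments by (intro exI[of _ b] exI[of _ z]) blast
qed

section \<open>Positivity and projections\<close>

context cstar_prob_space
begin

lemma star_one: "star A \<one> = \<one>"
proof -
  have o: "\<one> \<in> carrier A" "star A \<one> \<in> carrier A" using star_closed[of \<one>] by simp_all
  have "star A (star A \<one> \<otimes> \<one>) = star A \<one> \<otimes> star A (star A \<one>)"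
    using o by (intro star_mult)
  then show ?thesis using o by (simp add: star_star)
qed

lemma star_zero: "star A \<zero> = \<zero>"
proof -
  have z: "\<zero> \<in> carrier A" "star A \<zero> \<in> carrier A" using star_closed[of \<zero>] by simp_all
  have null: "0 \<odot> x = \<zero>" if "x \<in> carrier A" for x
    using smult_l_null[OF that] by (simp add: complex_ring_def)
  show ?thesis using star_smult[OF z(1), of 0] null[OF z(1)] null[OF z(2)] by simp
qed

lemma star_finsum:
  "finite F \<Longrightarrow> f \<in> F \<rightarrow> carrier A \<Longrightarrow> star A (\<Oplus>j\<in>F. f j) = (\<Oplus>j\<in>F. star A (f j))"
proof (induction F rule: finite_induct)
  case empty
  show ?case using abelian_monoid.finsum_empty[OF abelian_monoid_alg] by (simp add: star_zero)
next
  case (insert j F)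
  then show ?case
    by (simp add: alg_finsum_insert Pi_def star_closed star_add alg_finsum_closed)
qed

lemma star_lprod:
  "(\<And>i. i \<in> set u \<Longrightarrow> x i \<in> carrier A \<and> star A (x i) = x i) \<Longrightarrow>
    star A (lprod A (map x u)) = lprod A (map x (rev u))"
proof (induction u)
  case Nil
  then show ?case by (simp add: star_one)
next
  case (Cons i u)
  then have "x i \<in> carrier A" "lprod A (map x u) \<in> carrier A" "set (map x (rev u)) \<subseteq> carrier A" by auto
  then show ?case
    using Cons lprod_append[of "map x (rev u)" "[x i]"] by (simp add: star_mult)
qed

lemma state_gram_nonneg:
  assumes F: "finite F" and x: "\<And>u. u \<in> F \<Longrightarrow> x u \<in> carrier A"
  shows "(\<Sum>u\<in>F. \<Sum>w\<in>F. cnj (c u) * c w * \<phi> (star A (x u) \<otimes> x w)) \<in> \<real>\<^sub>\<ge>\<^sub>0"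
proof -
  define S where "S = (\<Oplus>u\<in>F. c u \<odot> x u)"
  have S: "S \<in> carrier A" unfolding S_def using x by (intro alg_finsum_closed) auto
  have sx: "star A (x u) \<in> carrier A" if "u \<in> F" for u using x[OF that] by (rule star_closed)
  have "star A S = (\<Oplus>u\<in>F. star A (c u \<odot> x u))"
    unfolding S_def using x by (intro star_finsum[OF F]) auto
  also have "\<dots> = (\<Oplus>u\<in>F. cnj (c u) \<odot> star A (x u))"
    using x sx by (intro abelian_monoid.finsum_cong'[OF abelian_monoid_alg]) (auto simp: star_smult)
  finally have sS: "star A S = (\<Oplus>u\<in>F. cnj (c u) \<odot> star A (x u))" .
  have "star A S \<otimes> S = (\<Oplus>u\<in>F. (cnj (c u) \<odot> star A (x u)) \<otimes> S)"
    unfolding sS using S sx by (intro alg_finsum_ldistr[OF F]) auto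
  then have "\<phi> (star A S \<otimes> S) = (\<Sum>u\<in>F. \<phi> ((cnj (c u) \<odot> star A (x u)) \<otimes> S))"
    using state_finsum[OF F, of "\<lambda>u. (cnj (c u) \<odot> star A (x u)) \<otimes> S"] S sx by (simp add: Pi_def)
  also have "\<dots> = (\<Sum>u\<in>F. \<Sum>w\<in>F. cnj (c u) * c w * \<phi> (star A (x u) \<otimes> x w))"
  proof (intro sum.cong refl)
    fix u assume u: "u \<in> F"
    have "(cnj (c u) \<odot> star A (x u)) \<otimes> S = (\<Oplus>w\<in>F. (cnj (c u) \<odot> star A (x u)) \<otimes> (c w \<odot> x w))"
      unfolding S_def using x sx[OF u] by (intro alg_finsum_rdistr[OF F]) auto
    then have "\<phi> ((cnj (c u) \<odot> star A (x u)) \<otimes> S)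
        = (\<Sum>w\<in>F. \<phi> ((cnj (c u) \<odot> star A (x u)) \<otimes> (c w \<odot> x w)))"
      using state_finsum[OF F, of "\<lambda>w. (cnj (c u) \<odot> star A (x u)) \<otimes> (c w \<odot> x w)"] x sx[OF u]
      by (simp add: Pi_def)
    also have "\<dots> = (\<Sum>w\<in>F. cnj (c u) * c w * \<phi> (star A (x u) \<otimes> x w))"
      using x sx[OF u]
      by (intro sum.cong refl) (simp add: smult_mult_left smult_mult_right state_smult)
    finally show "\<phi> ((cnj (c u) \<odot> star A (x u)) \<otimes> S) = (\<Sum>w\<in>F. cnj (c u) * c w * \<phi> (star A (x u) \<otimes> x w))" .
  qed
  finally show ?thesis using state_pos[OF S] by simp
qed

lemma psd_kernel_state:
  fixes x :: "nat \<Rightarrow> 'a"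
  assumes "\<And>n. x n \<in> carrier A"
  shows "psd_kernel (\<lambda>m n. \<phi> (star A (x m) \<otimes> x n))"
  unfolding psd_kernel_def kernel_form_def using assms by (auto intro: state_gram_nonneg)

text \<open>The inequality for the two kernel vectors that represent the Gram matrix of \<open>x\<close> and \<open>y\<close>.\<close>

lemma state_Cauchy_Schwarz:
  assumes "x \<in> carrier A" "y \<in> carrier A"
  shows "(cmod (\<phi> (star A x \<otimes> y)))\<^sup>2 \<le> Re (\<phi> (star A x \<otimes> x)) * Re (\<phi> (star A y \<otimes> y))"
proof -
  define z where "z n = (if n = 0 then x else y)" for n :: nat
  define K where "K m n = \<phi> (star A (z m) \<otimes> z n)" for m n
  have K: "psd_kernel K" unfolding K_def using assms by (intro psd_kernel_state) (simp add: z_def)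
  let ?v = "kernel_vector K"
  have v: "?v n \<in> l2" for n by (rule kernel_vector_l2[OF K])
  have n: "(l2norm (?v n))\<^sup>2 = Re (K n n)" for n
    using ip_self[OF v[of n]] unfolding ip_kernel_vector[OF K] by simp
  have "(cmod (K 0 1))\<^sup>2 \<le> (l2norm (?v 0) * l2norm (?v 1))\<^sup>2"
    using ip_Cauchy_Schwarz[OF v v, of 0 1] unfolding ip_kernel_vector[OF K] by (intro power_mono) auto
  then have "(cmod (K 0 1))\<^sup>2 \<le> Re (K 0 0) * Re (K 1 1)"
    by (simp only: power_mult_distrib n)
  then show ?thesis by (simp add: K_def z_def)
qed

text \<open>Since \<open>1 - p\<close> is a projection too, a projection contracts the seminorm of the state.\<close>

lemma state_projection_contract:
  assumes p: "projection A p" and y: "y \<in> carrier A"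
  shows "Re (\<phi> (star A (p \<otimes> y) \<otimes> (p \<otimes> y))) \<le> Re (\<phi> (star A y \<otimes> y))"
proof -
  have pc: "p \<in> carrier A" "star A p = p" "p \<otimes> p = p" using p by (auto simp: projection_def)
  have sy: "star A y \<in> carrier A" using y by (rule star_closed)
  define z where "z n = (if n = 0 then y else p \<otimes> y)" for n :: nat
  define K where "K m n = \<phi> (star A (z m) \<otimes> z n)" for m n
  have K: "psd_kernel K" unfolding K_def using y pc by (intro psd_kernel_state) (simp add: z_def)
  have star: "star A (p \<otimes> y) = star A y \<otimes> p" using star_mult[OF pc(1) y] pc(2) by simp
  have pp: "(star A y \<otimes> p) \<otimes> (p \<otimes> y) = star A y \<otimes> (p \<otimes> y)"
  proof -
    have "(star A y \<otimes> p) \<otimes> (p \<otimes> y) = star A y \<otimes> ((p \<otimes> p) \<otimes> y)"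
      using pc(1) y sy by (simp add: alg_assoc)
    then show ?thesis by (simp only: pc(3))
  qed
  have K01: "K 0 1 = K 1 1" "K 1 0 = K 1 1"
    using pp alg_assoc[OF sy pc(1) y] by (simp_all add: K_def z_def star)
  have "K 0 0 + (- 1) * K 0 1 + cnj (- 1) * K 1 0 + cnj (- 1) * (- 1) * K 1 1 \<in> \<real>\<^sub>\<ge>\<^sub>0"
    by (rule psd_kernel_pair[OF K]) simp
  then have "0 \<le> Re (K 0 0 - K 1 1)" using nonneg_Reals_eq_Re unfolding K01 by force
  then show ?thesis by (simp add: K_def z_def)
qed

text \<open>By contraction the product without its first factor has seminorm at most that of the last
  projection; the Cauchy-Schwarz inequality with the first projection gives the bound.\<close>

lemma state_projections_bound:
  assumes p: "\<And>i. projection A (p i)" and t: "\<And>i. \<phi> (p i) = of_real (t i)"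
    and tb: "\<And>i. 0 \<le> t i" "\<And>i. t i \<le> b" and u: "u \<noteq> []"
  shows "cmod (\<phi> (lprod A (map p u))) \<le> b"
proof -
  have pc: "p i \<in> carrier A" "star A (p i) = p i" "p i \<otimes> p i = p i" for i
    using p[of i] by (auto simp: projection_def)
  have sq: "Re (\<phi> (star A (lprod A (map p u)) \<otimes> lprod A (map p u))) \<le> b" if "u \<noteq> []" for u
    using that
  proof (induction u rule: list_nonempty_induct)
    case (single i)
    then show ?case using tb(2)[of i] pc by (simp add: t)
  next
    case (cons i u)
    have "Re (\<phi> (star A (p i \<otimes> lprod A (map p u)) \<otimes> (p i \<otimes> lprod A (map p u))))
        \<le> Re (\<phi> (star A (lprod A (map p u)) \<otimes> lprod A (map p u)))"
      using pc by (intro state_projection_contract[OF p]) auto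
    then show ?case using cons.IH by simp
  qed
  have b0: "0 \<le> b" using tb order_trans by blast
  obtain i v where v: "u = i # v" using u by (cases u) auto
  show ?thesis
  proof (cases "v = []")
    case True
    then show ?thesis using v tb[of i] pc by (simp add: t)
  next
    case False
    let ?y = "lprod A (map p v)"
    have y: "?y \<in> carrier A" using pc by auto
    have "(cmod (\<phi> (p i \<otimes> ?y)))\<^sup>2 \<le> t i * Re (\<phi> (star A ?y \<otimes> ?y))"
      using state_Cauchy_Schwarz[OF pc(1)[of i] y] by (simp add: pc t)
    also have "\<dots> \<le> b * b"
      using mult_left_mono[OF sq[OF False] tb(1)[of i]] mult_right_mono[OF tb(2)[of i] b0] by linarith
    finally have "(cmod (\<phi> (p i \<otimes> ?y)))\<^sup>2 \<le> b\<^sup>2" by (simp add: power2_eq_square)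
    then have "cmod (\<phi> (p i \<otimes> ?y)) \<le> b" using b0 by (rule power2_le_imp_le)
    then show ?thesis using v by simp
  qed
qed

end

section \<open>Limits of moments\<close>

lemma complex_bounded_convergent_subsequence:
  fixes f :: "nat \<Rightarrow> complex"
  assumes "\<And>k. cmod (f k) \<le> C"
  shows "\<exists>s. strict_mono (s :: nat \<Rightarrow> nat) \<and> convergent (\<lambda>k. f (s k))"
proof -
  obtain s1 where s1: "strict_mono (s1 :: nat \<Rightarrow> nat)" "monoseq (\<lambda>k. Re (f (s1 k)))"
    using seq_monosub[of "\<lambda>k. Re (f k)"] by (auto simp: o_def)
  obtain s2 where s2: "strict_mono (s2 :: nat \<Rightarrow> nat)" "monoseq (\<lambda>k. Im (f (s1 (s2 k))))"
    using seq_monosub[of "\<lambda>k. Im (f (s1 k))"] by (auto simp: o_def)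
  have B: "Bseq (\<lambda>k. Re (f (s k)))" "Bseq (\<lambda>k. Im (f (s k)))" for s
    using order_trans[OF abs_Re_le_cmod assms] order_trans[OF abs_Im_le_cmod assms]
    by (auto intro!: BseqI'[of _ C])
  have "convergent (\<lambda>k. Re (f (s1 k)))" "convergent (\<lambda>k. Im (f (s1 (s2 k))))"
    by (rule Bseq_monoseq_convergent[OF B(1) s1(2)], rule Bseq_monoseq_convergent[OF B(2) s2(2)])
  then obtain a b where ab: "(\<lambda>k. Re (f (s1 k))) \<longlonglongrightarrow> a" "(\<lambda>k. Im (f (s1 (s2 k)))) \<longlonglongrightarrow> b"
    unfolding convergent_LIMSEQ_iff by (rule that)
  have "(\<lambda>k. Re (f (s1 (s2 k)))) \<longlonglongrightarrow> a"
    using LIMSEQ_subseq_LIMSEQ[OF ab(1) s2(1)] by (simp add: o_def)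
  then have "(\<lambda>k. Complex (Re (f (s1 (s2 k)))) (Im (f (s1 (s2 k))))) \<longlonglongrightarrow> Complex a b"
    using ab(2) by (rule tendsto_Complex)
  then have "convergent (\<lambda>k. f ((s1 \<circ> s2) k))" by (auto simp: convergent_def o_def)
  then show ?thesis using strict_mono_o[OF s1(1) s2(1)] by blast
qed

lemma diagonal_convergent_subsequence:
  fixes f :: "nat \<Rightarrow> nat \<Rightarrow> complex"
  assumes bdd: "\<And>m k. cmod (f m k) \<le> C m"
  shows "\<exists>s. strict_mono (s :: nat \<Rightarrow> nat) \<and> (\<forall>m. convergent (\<lambda>k. f m (s k)))"
proof -
  interpret subseqs "\<lambda>m s. convergent (\<lambda>k. f m (s k))"
  proof
    fix m and s :: "nat \<Rightarrow> nat"
    show "\<exists>r'. strict_mono r' \<and> convergent (\<lambda>k. f m ((s \<circ> r') k))"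
      using complex_bounded_convergent_subsequence[of "\<lambda>k. f m (s k)" "C m"] bdd by (simp add: o_def)
  qed
  have "convergent (\<lambda>k. f m (diagseq k))" for m
  proof -
    have "convergent (\<lambda>k. f m ((diagseq \<circ> (+) (Suc m)) k))"
    proof (rule diagseq_holds)
      fix r s :: "nat \<Rightarrow> nat" and n assume r: "strict_mono r" and c: "convergent (\<lambda>k. f n (s k))"
      then show "convergent (\<lambda>k. f n ((s \<circ> r) k))"
        using convergent_subseq_convergent[OF c r] by (simp add: o_def)
    qed
    then have "convergent (\<lambda>k. f m (diagseq (k + Suc m)))"
      by (simp add: o_def add.commute)
    then show ?thesis by (rule convergent_ignore_initial_segment[THEN iffD1])
  qed
  then show ?thesis using subseq_diagseq by blast
qed

lemma nonneg_Reals_limit: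
  assumes "f \<longlonglongrightarrow> l" "\<And>k. f k \<in> \<real>\<^sub>\<ge>\<^sub>0"
  shows "l \<in> (\<real>\<^sub>\<ge>\<^sub>0 :: complex set)"
proof -
  have f: "Im (f k) = 0" "0 \<le> Re (f k)" for k
    using nonneg_Reals_eq_Re[OF assms(2)[of k]] by (metis Im_complex_of_real, simp)
  have "(\<lambda>k. Im (f k)) \<longlonglongrightarrow> Im l" "(\<lambda>k. Re (f k)) \<longlonglongrightarrow> Re l"
    using assms(1) by (auto intro: tendsto_intros)
  then have "Im l = 0" "0 \<le> Re l"
    using f LIMSEQ_le_const[of "\<lambda>k. Re (f k)" "Re l" 0] LIMSEQ_unique[of "\<lambda>k. Im (f k)" "Im l" 0]
    by simp_all
  then have "l = of_real (Re l)" by (simp add: complex_eq_iff)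
  then show ?thesis using \<open>0 \<le> Re l\<close> by (metis nonneg_Reals_of_real_iff)
qed

text \<open>The free cumulants of the limit grow at most exponentially, and so do the moments, there being
  at most \<open>4\<^sup>n\<close> non-crossing partitions of \<open>n\<close> points.\<close>

lemma moment_growth:
  fixes L :: "'i list \<Rightarrow> complex" and g :: "'i \<Rightarrow> real"
  assumes V: "finite V" and L: "\<And>u. u \<noteq> [] \<Longrightarrow> cmod (L u) \<le> (\<Prod>i\<leftarrow>u. g i)" and g: "\<And>i. 0 \<le> g i"
  shows "cmod (\<Sum>\<pi>\<in>NC_on V. \<Prod>W\<in>\<pi>. L (map i (sorted_list_of_set W))) \<le> (\<Prod>j\<in>V. 4 * g (i j))"
proof -
  have "cmod (\<Prod>W\<in>\<pi>. L (map i (sorted_list_of_set W))) \<le> (\<Prod>j\<in>V. g (i j))" if \<pi>: "\<pi> \<in> NC_on V" for \<pi>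
  proof -
    have p: "partition_on V \<pi>" using \<pi> by (simp add: NC_on_def)
    have fW: "finite W" if "W \<in> \<pi>" for W
      using partition_on_block_subset[OF p that] V by (rule finite_subset)
    have "cmod (\<Prod>W\<in>\<pi>. L (map i (sorted_list_of_set W))) \<le> (\<Prod>W\<in>\<pi>. \<Prod>j\<in>W. g (i j))"
      unfolding prod_norm[symmetric]
    proof (rule prod_mono, intro conjI)
      fix W assume W: "W \<in> \<pi>"
      have "sorted_list_of_set W \<noteq> []"
        using partition_on_block_nonempty[OF p W] fW[OF W] by simp
      then have "cmod (L (map i (sorted_list_of_set W))) \<le> (\<Prod>j\<leftarrow>sorted_list_of_set W. g (i j))"
        using L[of "map i (sorted_list_of_set W)"] by (simp add: o_def)
      also have "\<dots> = (\<Prod>j\<in>W. g (i j))"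
        using fW[OF W] by (simp flip: prod.distinct_set_conv_list)
      finally show "cmod (L (map i (sorted_list_of_set W))) \<le> (\<Prod>j\<in>W. g (i j))" .
    qed simp
    also have "\<dots> = (\<Prod>j\<in>\<Union>\<pi>. g (i j))"
      using fW partition_onD2[OF p] by (subst prod.Union_disjoint) (auto simp: disjoint_def)
    finally show ?thesis using partition_onD1[OF p] by simp
  qed
  then have "cmod (\<Sum>\<pi>\<in>NC_on V. \<Prod>W\<in>\<pi>. L (map i (sorted_list_of_set W))) \<le> of_nat (card (NC_on V)) * (\<Prod>j\<in>V. g (i j))"
    by (intro sum_norm_bound)
  also have "\<dots> \<le> 4 ^ card V * (\<Prod>j\<in>V. g (i j))"
  proof (rule mult_right_mono)
    have "real (card (NC_on V)) \<le> real (4 ^ card V)" using card_NC_on_le[OF V] by (rule of_nat_mono)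
    then show "real (card (NC_on V)) \<le> 4 ^ card V" by simp
  qed (intro prod_nonneg ballI g)
  also have "\<dots> = (\<Prod>j\<in>V. 4 * g (i j))" by (simp add: prod.distrib)
  finally show ?thesis .
qed

section \<open>The compound free Poisson limit\<close>

text \<open>An element lies in the hull as soon as it lies in every unital subalgebra that contains the
  generators.\<close>

lemma (in cstar_prob_space) letter_value_hull:
  assumes "\<And>i. a c i = \<beta> i \<odot> x i"
  shows "letter_value A \<phi> a (c, u, f) \<in> unital_subalgebra A hull range x"
  unfolding hull_def
proof (rule InterI, clarify)
  fix t assume t: "unital_subalgebra A t" "range x \<subseteq> t"
  then have sub: "subring t A" and sm: "\<And>c y. y \<in> t \<Longrightarrow> c \<odot> y \<in> t"
    by (auto simp: unital_subalgebra_def)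
  have "a c i \<in> t" for i using assms t(2) sm by auto
  then have "lprod A (map (a c) u) \<in> t"
    using subringE(3,6)[OF sub] by (induction u) auto
  then show "letter_value A \<phi> a (c, u, f) \<in> t"
    using subringE(3,7)[OF sub] sm by (auto simp: letter_value_def Let_def)
qed

theorem theorem2p5:
  fixes \<alpha> lam :: "nat \<Rightarrow> real"
    and A :: "nat \<Rightarrow> 'a cstar" and \<phi> :: "nat \<Rightarrow> 'a \<Rightarrow> complex"
    and p :: "nat \<Rightarrow> nat \<Rightarrow> nat \<Rightarrow> 'a"
  assumes lam_pos: "\<And>i. lam i > 0"
    and lam_bdd: "bdd_above (range lam)"
    and space: "\<And>N. real N \<ge> (SUP i. lam i) \<Longrightarrow> cstar_prob_space (A N) (\<phi> N)"
    and proj: "\<And>N r i. real N \<ge> (SUP i. lam i) \<Longrightarrow> r \<in> {1..N} \<Longrightarrow> projection (A N) (p N r i)"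
    and free: "\<And>N. real N \<ge> (SUP i. lam i) \<Longrightarrow> free_sequences (A N) (\<phi> N) {1..N} (p N)"
    and ident: "\<And>N r s. real N \<ge> (SUP i. lam i) \<Longrightarrow> r \<in> {1..N} \<Longrightarrow> s \<in> {1..N} \<Longrightarrow>
      identically_distributed (A N) (\<phi> N) (p N r) (p N s)"
    and trace: "\<And>N r i. real N \<ge> (SUP i. lam i) \<Longrightarrow> r \<in> {1..N} \<Longrightarrow>
      \<phi> N (p N r i) = complex_of_real (lam i / real N)"
  shows "\<exists>(B :: seq_map cstar) \<psi> (b :: nat \<Rightarrow> seq_map) (n :: nat \<Rightarrow> nat).
    cstar_prob_space B \<psi> \<and> (\<forall>i. b i \<in> carrier B) \<and>
    (\<forall>k. real (n k) \<ge> (SUP i. lam i)) \<and> filterlim n at_top sequentially \<and>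
    converges_in_distribution (\<lambda>k. A (n k)) (\<lambda>k. \<phi> (n k))
      (\<lambda>k i. \<Oplus>\<^bsub>A (n k)\<^esub>j\<in>{1..n k}. complex_of_real (\<alpha> i) \<odot>\<^bsub>A (n k)\<^esub> p (n k) j i)
      B \<psi> b \<and>
    (\<forall>m\<ge>1. \<forall>i :: nat \<Rightarrow> nat.
      convergent (\<lambda>k. of_nat (n k) *
        \<phi> (n k) (lprod (A (n k)) (map (\<lambda>j. p (n k) 1 (i j)) [1..<m + 1]))) \<and>
      free_cumulant B \<psi> m (\<lambda>j. b (i j)) =
        (\<Prod>j=1..m. complex_of_real (\<alpha> (i j))) *
        lim (\<lambda>k. of_nat (n k) *
          \<phi> (n k) (lprod (A (n k)) (map (\<lambda>j. p (n k) 1 (i j)) [1..<m + 1]))))"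
proof -
  define Lam where "Lam = (SUP i. lam i)"
  have lam_le: "lam i \<le> Lam" for i
    unfolding Lam_def using lam_bdd by (intro cSUP_upper) auto
  have Lam: "0 < Lam" using lam_pos[of 0] lam_le[of 0] by linarith
  define N0 where "N0 = nat \<lceil>Lam\<rceil>"
  have large: "Lam \<le> real (k + N0)" and pos: "1 \<le> k + N0" for k
    using Lam unfolding N0_def by linarith+
  note space' = space[folded Lam_def] and proj' = proj[folded Lam_def] and free' = free[folded Lam_def]
    and ident' = ident[folded Lam_def] and trace' = trace[folded Lam_def]

  \<comment> \<open>Up to the coefficients \<open>\<alpha>\<close>, the limits of these quantities are going to be the free cumulants.\<close>
  define q where "q N w = of_nat N * \<phi> N (lprod (A N) (map (p N 1) w))" for N w
  have q_bound: "cmod (q N w) \<le> Lam" if N: "Lam \<le> real N" "1 \<le> N" and w: "w \<noteq> []" for N w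
  proof -
    have r: "1 \<in> {1..N}" using N by simp
    have "cmod (\<phi> N (lprod (A N) (map (p N 1) w))) \<le> Lam / real N"
    proof (rule cstar_prob_space.state_projections_bound[OF space'[OF N(1)]])
      show "projection (A N) (p N 1 i)" for i using proj'[OF N(1) r] .
      show "\<phi> N (p N 1 i) = complex_of_real (lam i / real N)" for i using trace'[OF N(1) r] .
      show "0 \<le> lam i / real N" for i using less_imp_le[OF lam_pos] by simp
      show "lam i / real N \<le> Lam / real N" for i using lam_le by (intro divide_right_mono) auto
    qed (rule w)
    then show ?thesis using N(2) by (simp add: q_def norm_mult field_simps)
  qed
  \<comment> \<open>The empty word, for which \<open>q N [] = N\<close> diverges, is replaced by 0.\<close>
  define f where "f m k = (if list_decode m = [] then 0 else q (k + N0) (list_decode m))" for m k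
  have "cmod (f m k) \<le> Lam" for m k
    using q_bound[OF large pos] Lam by (simp add: f_def)
  then obtain s where s: "strict_mono s" and sc: "\<And>m. convergent (\<lambda>k. f m (s k))"
    using diagonal_convergent_subsequence[of f "\<lambda>_. Lam"] by blast
  define n where "n k = s k + N0" for k
  have nL: "Lam \<le> real (n k)" and n1: "1 \<le> n k" for k
    using large[of "s k"] pos[of "s k"] by (simp_all add: n_def)
  have n_top: "filterlim n at_top sequentially"
    unfolding n_def
    by (rule filterlim_at_top_mono[OF filterlim_subseq[OF s]]) simp
  define l where "l w = lim (\<lambda>k. q (n k) w)" for w
  have q_conv: "convergent (\<lambda>k. q (n k) w)" if "w \<noteq> []" for w
    using sc[of "list_encode w"] that by (simp add: f_def n_def)
  have q_lim: "(\<lambda>k. q (n k) w) \<longlonglongrightarrow> l w" if "w \<noteq> []" for w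
    using q_conv[OF that] by (simp add: l_def convergent_LIMSEQ_iff)

  define ac where "ac u = (\<Prod>i\<leftarrow>u. complex_of_real (\<alpha> i))" for u
  define L where "L u = ac u * l u" for u
  define a where "a k r i = complex_of_real (\<alpha> i) \<odot>\<^bsub>A (n k)\<^esub> p (n k) r i" for k r i
  have pcl: "p (n k) r i \<in> carrier (A (n k))" if "r \<in> {1..n k}" for k r i
    using proj'[OF nL that] by (simp add: projection_def)
  have a_prod: "\<phi> (n k) (lprod (A (n k)) (map (a k r) u)) = ac u * \<phi> (n k) (lprod (A (n k)) (map (p (n k) r) u))"
    if r: "r \<in> {1..n k}" for k r u
  proof -
    interpret cstar_prob_space "A (n k)" "\<phi> (n k)" by (rule space'[OF nL])
    have "p (n k) r ` set u \<subseteq> carrier (A (n k))" using pcl[OF r] by auto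
    moreover have "map (a k r) u = map (\<lambda>i. complex_of_real (\<alpha> i) \<odot>\<^bsub>A (n k)\<^esub> p (n k) r i) u"
      by (simp add: a_def)
    ultimately show ?thesis
      using pcl[OF r] by (simp only: lprod_smult ac_def) (simp add: state_smult lprod_map_closed)
  qed
  interpret free_array "\<lambda>k. A (n k)" "\<lambda>k. \<phi> (n k)" n a
    "\<lambda>k r. unital_subalgebra (A (n k)) hull range (p (n k) r)" L
  proof (rule free_array.intro)
    show space_k: "cstar_prob_space (A (n k)) (\<phi> (n k))" for k by (rule space'[OF nL])
    show "filterlim n at_top sequentially" by (rule n_top)
    show "free_subalgebras (A (n k)) (\<phi> (n k)) {1..n k} (\<lambda>r. unital_subalgebra (A (n k)) hull range (p (n k) r))" for k
      using free'[OF nL] by (simp add: free_sequences_def)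
    fix k r u and i assume r: "r \<in> {1..n k}"
    interpret cstar_prob_space "A (n k)" "\<phi> (n k)" by (rule space_k)
    show "a k r i \<in> carrier (A (n k))" using pcl[OF r] by (simp add: a_def smult_closed')
    show "letter_value (A (n k)) (\<phi> (n k)) (a k) (r, u, True) \<in> unital_subalgebra (A (n k)) hull range (p (n k) r)"
      by (rule letter_value_hull) (rule a_def)
    have r1: "1 \<in> {1..n k}" using n1[of k] by simp
    show "\<phi> (n k) (lprod (A (n k)) (map (a k r) u)) = \<phi> (n k) (lprod (A (n k)) (map (a k 1) u))"
      using ident'[OF nL r r1] unfolding a_prod[OF r] a_prod[OF r1] identically_distributed_def by simp
  next
    fix u :: "nat list" assume u: "u \<noteq> []"
    have "(\<lambda>k. ac u * q (n k) u) \<longlonglongrightarrow> L u"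
      unfolding L_def by (intro tendsto_mult tendsto_const q_lim u)
    moreover have "of_nat (n k) * \<phi> (n k) (lprod (A (n k)) (map (a k 1) u)) = ac u * q (n k) u" for k
      using a_prod[of 1 k u] n1[of k] by (simp add: q_def)
    ultimately show "(\<lambda>k. of_nat (n k) * \<phi> (n k) (lprod (A (n k)) (map (a k 1) u))) \<longlonglongrightarrow> L u" by simp
  qed

  define X where "X k i = (\<Oplus>\<^bsub>A (n k)\<^esub>r\<in>{1..n k}. a k r i)" for k i
  define mom where "mom V i = (\<Sum>\<pi>\<in>NC_on V. \<Prod>W\<in>\<pi>. L (map i (sorted_list_of_set W)))" for V and i :: "nat \<Rightarrow> nat"
  define M where "M w = mom {0..<length w} (\<lambda>j. w ! j)" for w
  have mom_lim: "(\<lambda>k. \<phi> (n k) (lprod (A (n k)) (map (X k) (map i (sorted_list_of_set V))))) \<longlonglongrightarrow> mom V i"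
    if "finite V" for V i
    using free_limit[OF that, of i] by (simp add: X_def mom_def o_def)
  have M_lim: "(\<lambda>k. \<phi> (n k) (lprod (A (n k)) (map (X k) w))) \<longlonglongrightarrow> M w" for w
  proof -
    have "map (\<lambda>j. w ! j) (sorted_list_of_set {0..<length w}) = w"
      by (simp add: map_nth)
    then show ?thesis using mom_lim[of "{0..<length w}" "\<lambda>j. w ! j"] by (simp only: M_def finite_atLeastLessThan)
  qed
  have M_mom: "M (map i (sorted_list_of_set V)) = mom V i" if "finite V" for V i
    by (rule LIMSEQ_unique[OF M_lim mom_lim[OF that]])

  have X: "X k i \<in> carrier (A (n k)) \<and> star (A (n k)) (X k i) = X k i" for k i
  proof
    interpret cstar_prob_space "A (n k)" "\<phi> (n k)" by (rule space)
    have fn: "(\<lambda>r. a k r i) \<in> {1..n k} \<rightarrow> carrier (A (n k))" using closed by auto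
    then show "X k i \<in> carrier (A (n k))" unfolding X_def by (rule alg_finsum_closed)
    have "star (A (n k)) (a k r i) = a k r i" if "r \<in> {1..n k}" for r
      using proj'[OF nL that, of i] by (simp add: a_def projection_def star_smult)
    then have "(\<Oplus>\<^bsub>A (n k)\<^esub>r\<in>{1..n k}. star (A (n k)) (a k r i)) = X k i"
      unfolding X_def using fn by (intro abelian_monoid.finsum_cong'[OF abelian_monoid_alg]) auto
    moreover have "star (A (n k)) (X k i) = (\<Oplus>\<^bsub>A (n k)\<^esub>r\<in>{1..n k}. star (A (n k)) (a k r i))"
      unfolding X_def by (rule star_finsum[OF _ fn]) simp
    ultimately show "star (A (n k)) (X k i) = X k i" by simp
  qed

  \<comment> \<open>The factor \<open>max 1 Lam\<close> is attached to every letter to make the bound multiplicative.\<close>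
  define g where "g i = max 1 Lam * (\<bar>\<alpha> i\<bar> + 1)" for i
  have g: "0 < g i" for i by (simp add: g_def)
  have L_bound: "cmod (L u) \<le> (\<Prod>i\<leftarrow>u. g i)" if u: "u \<noteq> []" for u
  proof -
    have "cmod (l u) \<le> Lam"
      using q_bound[OF nL n1 u] by (intro LIMSEQ_le_const2[OF tendsto_norm[OF q_lim[OF u]]]) auto
    moreover have "cmod (ac u) * max 1 Lam \<le> (\<Prod>i\<leftarrow>u. g i)"
      using u
    proof (induction u rule: list_nonempty_induct)
      case (single i)
      show ?case by (simp add: ac_def g_def distrib_left mult.commute)
    next
      case (cons i u)
      have "\<bar>\<alpha> i\<bar> * (cmod (ac u) * max 1 Lam) \<le> g i * (\<Prod>i\<leftarrow>u. g i)"
      proof (rule mult_mono[OF _ cons.IH])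
        show "\<bar>\<alpha> i\<bar> \<le> g i"
          using mult_right_mono[of 1 "max 1 Lam" "\<bar>\<alpha> i\<bar> + 1"] by (simp add: g_def)
      qed (use g[of i] in simp_all)
      then show ?case by (simp add: ac_def norm_mult mult.assoc)
    qed
    moreover have "cmod (ac u) * cmod (l u) \<le> cmod (ac u) * max 1 Lam"
      using calculation(1) by (intro mult_left_mono) auto
    ultimately show ?thesis by (simp add: L_def norm_mult)
  qed
  have M_bound: "cmod (M w) \<le> (\<Prod>i\<leftarrow>w. 4 * g i)" for w
  proof -
    have "cmod (M w) \<le> (\<Prod>j\<in>{0..<length w}. 4 * g (w ! j))"
      unfolding M_def mom_def using L_bound less_imp_le[OF g] by (intro moment_growth) auto
    also have "\<dots> = (\<Prod>i\<leftarrow>w. 4 * g i)"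
      using prod.list_conv_set_nth[of "map (\<lambda>i. 4 * g i) w"] by simp
    finally show ?thesis .
  qed

  have "\<exists>b z. z \<in> l2 \<and> l2norm z = 1 \<and> (\<forall>i. b i \<in> l2_operators) \<and>
    (\<forall>js. ip z (lprod B_l2 (map b js) z) = M js)"
  proof (rule moment_realization[where r = "\<lambda>i. 4 * g i"])
    have "\<phi> (n k) (lprod (A (n k)) (map (X k) [])) = 1" for k
    proof -
      interpret cstar_prob_space "A (n k)" "\<phi> (n k)" by (rule space)
      show ?thesis by (simp add: state_one)
    qed
    then show "M [] = 1" using LIMSEQ_unique[OF M_lim[of "[]"]] by simp
  next
    fix F :: "nat list set" and c :: "nat list \<Rightarrow> complex"
    assume F: "finite F"
    show "(\<Sum>u\<in>F. \<Sum>w\<in>F. cnj (c u) * c w * M (rev u @ w)) \<in> \<real>\<^sub>\<ge>\<^sub>0"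
    proof (rule nonneg_Reals_limit)
      show "(\<lambda>k. \<Sum>u\<in>F. \<Sum>w\<in>F. cnj (c u) * c w * \<phi> (n k) (lprod (A (n k)) (map (X k) (rev u @ w))))
        \<longlonglongrightarrow> (\<Sum>u\<in>F. \<Sum>w\<in>F. cnj (c u) * c w * M (rev u @ w))"
        by (intro tendsto_sum tendsto_mult tendsto_const M_lim)
      show "(\<Sum>u\<in>F. \<Sum>w\<in>F. cnj (c u) * c w * \<phi> (n k) (lprod (A (n k)) (map (X k) (rev u @ w)))) \<in> \<real>\<^sub>\<ge>\<^sub>0" for k
      proof -
        interpret cstar_prob_space "A (n k)" "\<phi> (n k)" by (rule space)
        have Xl: "set (map (X k) u) \<subseteq> carrier (A (n k))" for u using X by auto
        have "lprod (A (n k)) (map (X k) (rev u @ w))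
            = star (A (n k)) (lprod (A (n k)) (map (X k) u)) \<otimes>\<^bsub>A (n k)\<^esub> lprod (A (n k)) (map (X k) w)" for u w
          using star_lprod[of u "X k"] X lprod_append[OF Xl Xl, of "rev u" w] by simp
        then show ?thesis
          using state_gram_nonneg[OF F, of "\<lambda>u. lprod (A (n k)) (map (X k) u)" c] Xl by (simp add: lprod_closed)
      qed
    qed
  next
    show "0 < 4 * g i" for i using g by simp
    fix i u w
    have "cmod (M (u @ replicate k i @ w)) \<le> ((\<Prod>i\<leftarrow>u. 4 * g i) * (\<Prod>i\<leftarrow>w. 4 * g i)) * (4 * g i) ^ k" for k
      using M_bound[of "u @ replicate k i @ w"] by (simp add: prod_list_replicate mult_ac)
    then show "\<exists>D. \<forall>k. cmod (M (u @ replicate k i @ w)) \<le> D * (4 * g i) ^ k" by blast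
  qed
  then obtain b z where z: "z \<in> l2" "l2norm z = 1" and b: "\<And>i. b i \<in> l2_operators"
    and bM: "\<And>js. ip z (lprod B_l2 (map b js) z) = M js" by blast
  define \<psi> where "\<psi> T = ip z (T z)" for T :: seq_map
  have \<psi>M: "\<psi> (lprod B_l2 (map b js)) = M js" for js by (simp add: \<psi>_def bM)

  have "cstar_prob_space B_l2 \<psi>"
    unfolding \<psi>_def by (rule vector_state_B_l2[OF z])
  moreover have "\<forall>i. b i \<in> carrier B_l2" using b by simp
  moreover have "\<forall>k. real (n k) \<ge> (SUP i. lam i)" using nL by (simp add: Lam_def)
  moreover have "converges_in_distribution (\<lambda>k. A (n k)) (\<lambda>k. \<phi> (n k))
      (\<lambda>k i. \<Oplus>\<^bsub>A (n k)\<^esub>j\<in>{1..n k}. complex_of_real (\<alpha> i) \<odot>\<^bsub>A (n k)\<^esub> p (n k) j i) B_l2 \<psi> b"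
    unfolding converges_in_distribution_def \<psi>M using M_lim unfolding X_def a_def by blast
  moreover have "\<forall>m\<ge>1. \<forall>i :: nat \<Rightarrow> nat.
      convergent (\<lambda>k. of_nat (n k) *
        \<phi> (n k) (lprod (A (n k)) (map (\<lambda>j. p (n k) 1 (i j)) [1..<m + 1]))) \<and>
      free_cumulant B_l2 \<psi> m (\<lambda>j. b (i j)) =
        (\<Prod>j=1..m. complex_of_real (\<alpha> (i j))) *
        lim (\<lambda>k. of_nat (n k) *
          \<phi> (n k) (lprod (A (n k)) (map (\<lambda>j. p (n k) 1 (i j)) [1..<m + 1])))"
  proof (intro allI impI)
    fix m :: nat and i :: "nat \<Rightarrow> nat" assume m: "1 \<le> m"
    define w where "w = map i [1..<m + 1]"
    have w: "w \<noteq> []" using m by (simp add: w_def)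
    have qw: "of_nat (n k) * \<phi> (n k) (lprod (A (n k)) (map (\<lambda>j. p (n k) 1 (i j)) [1..<m + 1])) = q (n k) w" for k
      by (simp add: q_def w_def o_def del: upt_Suc)
    have sl: "sorted_list_of_set {1..m} = [1..<m + 1]"
      using sorted_list_of_set_range[of 1 "m + 1"] by (simp add: atLeastLessThanSuc_atLeastAtMost del: upt_Suc)
    have acw: "ac w = (\<Prod>j=1..m. complex_of_real (\<alpha> (i j)))"
    proof -
      have "ac w = (\<Prod>j\<leftarrow>[1..<m + 1]. complex_of_real (\<alpha> (i j)))"
        by (simp add: ac_def w_def o_def del: upt_Suc)
      also have "\<dots> = (\<Prod>j\<in>set [1..<m + 1]. complex_of_real (\<alpha> (i j)))"
        by (rule prod.distinct_set_conv_list[symmetric]) simp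
      finally show ?thesis by (simp add: atLeastLessThanSuc_atLeastAtMost del: upt_Suc)
    qed
    have "moment_part B_l2 \<psi> \<pi> (\<lambda>j. b (i j)) = (\<Prod>W\<in>\<pi>. M (map i (sorted_list_of_set W)))" for \<pi>
      by (simp add: moment_part_def o_def flip: \<psi>M)
    then have "free_cumulant B_l2 \<psi> m (\<lambda>j. b (i j)) = (\<Sum>\<pi>\<in>NC m. (\<Prod>W\<in>\<pi>. M (map i (sorted_list_of_set W)))
        * of_int (moebius (NC m) (refines {1..m}) \<pi> {{1..m}}))"
      by (simp add: free_cumulant_def)
    also have "\<dots> = L (map i (sorted_list_of_set {1..m}))"
    proof (rule cumulant_of_moments[OF m])
      fix W :: "nat set" assume "W \<subseteq> {1..m}"
      then have "finite W" by (rule finite_subset) simp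
      then show "M (map i (sorted_list_of_set W)) = (\<Sum>\<sigma>\<in>NC_on W. \<Prod>U\<in>\<sigma>. L (map i (sorted_list_of_set U)))"
        by (simp add: M_mom mom_def)
    qed
    also have "\<dots> = ac w * l w" by (simp only: sl L_def w_def)
    finally show "convergent (\<lambda>k. of_nat (n k) *
        \<phi> (n k) (lprod (A (n k)) (map (\<lambda>j. p (n k) 1 (i j)) [1..<m + 1]))) \<and>
      free_cumulant B_l2 \<psi> m (\<lambda>j. b (i j)) =
        (\<Prod>j=1..m. complex_of_real (\<alpha> (i j))) *
        lim (\<lambda>k. of_nat (n k) *
          \<phi> (n k) (lprod (A (n k)) (map (\<lambda>j. p (n k) 1 (i j)) [1..<m + 1])))"
      unfolding qw acw l_def using q_conv[OF w] by simp
  qed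
  ultimately show ?thesis
    using n_top by (intro exI[of _ B_l2] exI[of _ \<psi>] exI[of _ b] exI[of _ n] conjI)
qed

end
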